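(* Let $\mathbf{c} = (c_1, \dots, c_m)$ and $\mathbf{a} = (a_1, \dots, a_n)$ be vectors of non-negative real numbers such that $\sum_{\ell=1}^m c_\ell > \sum_{j=1}^n a_j$. For an integer $k \geq 12$, let $f_1, \dots, f_r$ be the normalized eigenforms of $S_k$ (with $r = \dim S_k$), and let $$\mathcal{F}_k(\mathbf{c}, \mathbf{a}) := \{ c_1 f_{i_1} + \dots + c_m f_{i_m} - a_1 f_{j_1} - \dots - a_n f_{j_n} : 1 \leq i_1, \dots, i_m, j_1, \dots, j_n \leq r \text{ distinct} \}, \qquad \mathcal{F}(\mathbf{c}, \mathbf{a}) := \bigcup_{k \geq 0} \mathcal{F}_k(\mathbf{c}, \mathbf{a}).$$ Then there is a constant $k_0$ depending on $\mathbf{c}, \mathbf{a}$ such that for all $k \geq k_0$, the period polynomial $r_f(z)$ satisfies the Riemann hypothesis for all $f \in \mathcal{F}_k(\mathbf{c}, \mathbf{a})$. In particular, at most finitely many $f \in \mathcal{F}(\mathbf{c}, \mathbf{a})$ have the property that $r_f(z)$ does not satisfy the Riemann hypothesis.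
   Context: $S_k$ is the complex vector space of cusp forms of weight $k$ for $\mathrm{SL}_2(\mathbb{Z})$, and $q = e^{2\pi i z}$. The normalized eigenforms of $S_k$ are the Hecke eigenforms with Fourier expansion $q + O(q^2)$; they form a basis of $S_k$. The set $\mathcal{F}_k(\mathbf{c},\mathbf{a})$ is empty when $S_k$ has too few eigenforms (in particular when $S_k = 0$, e.g. for $k<12$ or $k$ odd). For $f \in S_k$ with Fourier expansion $f(z)=\sum_{n\ge1} a_n q^n$, the Eichler integral is $\mathcal{E}_f(z) := \int_z^{i\infty} f(\tau)(\tau - z)^{k-2}\, d\tau$ (for $\mathrm{Im}\, z>0$), and the period polynomial of $f$ is $$r_f(z) := \mathcal{E}_f(z) - z^{k-2}\mathcal{E}_f(-1/z) = -\frac{(k-2)!}{(2\pi i)^{k-1}} \sum_{n=0}^{k-2} \frac{(2\pi i z)^n}{n!} L(f, k-n-1),$$ a polynomial of degree at most $k-2$, where $L(f,s)$ is the analytic continuation of $\sum_{n \geq 1} a_n n^{-s}$ (here the $a_n$ are Fourier coefficients, unrelated to the vector $\mathbf{a}$). We say that $r_f(z)$ satisfies the Riemann hypothesis (equivalently, is unimodular) if all of its complex zeros lie on the unit circle $|z| = 1$. *)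

theory Defs
  imports "HOL-Complex_Analysis.Complex_Analysis" "HOL-Computational_Algebra.Computational_Algebra"
begin

definition upper_half_plane :: "complex set" where
  "upper_half_plane = {z. Im z > 0}"

definition cusp_expansion :: "(complex \<Rightarrow> complex) \<Rightarrow> (nat \<Rightarrow> complex) \<Rightarrow> bool" where
  "cusp_expansion f a \<longleftrightarrow> a 0 = 0 \<and>
     (\<forall>z\<in>upper_half_plane. (\<lambda>n. a n * exp (2 * of_real pi * \<i> * z) ^ n) sums f z)"

(* Cusp forms live on the upper half plane; extending them by 0 to all complex numbers makes
   equality of functions coincide with equality of cusp forms. *)
definition cusp_forms :: "nat \<Rightarrow> (complex \<Rightarrow> complex) set" where
  "cusp_forms k = {f.
     f holomorphic_on upper_half_plane \<and>
     (\<forall>a b c d :: int. a * d - b * c = 1 \<longrightarrow>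
        (\<forall>z\<in>upper_half_plane.
           f ((of_int a * z + of_int b) / (of_int c * z + of_int d)) =
             (of_int c * z + of_int d) ^ k * f z)) \<and>
     (\<exists>a. cusp_expansion f a) \<and>
     (\<forall>z. z \<notin> upper_half_plane \<longrightarrow> f z = 0)}"

definition hecke_op :: "nat \<Rightarrow> nat \<Rightarrow> (complex \<Rightarrow> complex) \<Rightarrow> complex \<Rightarrow> complex" where
  "hecke_op k n f z =
     of_nat n powi (int k - 1) *
     (\<Sum>d | d dvd n. \<Sum>b<d. f ((of_nat (n div d) * z + of_nat b) / of_nat d) / of_nat d ^ k)"

definition hecke_eigenform :: "nat \<Rightarrow> (complex \<Rightarrow> complex) \<Rightarrow> bool" where
  "hecke_eigenform k f \<longleftrightarrow> f \<in> cusp_forms k \<and> f \<noteq> (\<lambda>z. 0) \<and>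
     (\<forall>n\<ge>1. \<exists>ev. \<forall>z\<in>upper_half_plane. hecke_op k n f z = ev * f z)"

definition normalized_eigenforms :: "nat \<Rightarrow> (complex \<Rightarrow> complex) set" where
  "normalized_eigenforms k =
     {f. hecke_eigenform k f \<and> (\<exists>a. cusp_expansion f a \<and> a 1 = 1)}"

(* The path from z to i*infinity is the vertical ray z + i*t, t >= 0.  The exponent k - 2 is a
   truncated subtraction, which is harmless because there are no nonzero cusp forms with k < 2. *)
definition eichler_integral :: "nat \<Rightarrow> (complex \<Rightarrow> complex) \<Rightarrow> complex \<Rightarrow> complex" where
  "eichler_integral k f z =
     integral {0..} (\<lambda>t. f (z + \<i> * of_real t) * (\<i> * of_real t) ^ (k - 2) * \<i>)"

(* The defining formula makes sense only on the upper half plane, while the zeros of interest are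
   those of the polynomial on the whole complex plane. *)
definition period_poly :: "nat \<Rightarrow> (complex \<Rightarrow> complex) \<Rightarrow> complex poly" where
  "period_poly k f = (THE p. \<forall>z\<in>upper_half_plane.
     poly p z = eichler_integral k f z - z ^ (k - 2) * eichler_integral k f (- 1 / z))"

lemma period_poly_eqI:
  assumes "\<And>z. z \<in> upper_half_plane \<Longrightarrow>
    poly p z = eichler_integral k f z - z ^ (k - 2) * eichler_integral k f (- 1 / z)"
  shows "period_poly k f = p"
  unfolding period_poly_def
proof (rule the_equality)
  fix p'
  assume p': "\<forall>z\<in>upper_half_plane.
    poly p' z = eichler_integral k f z - z ^ (k - 2) * eichler_integral k f (- 1 / z)"
  have "inj (\<lambda>n::nat. \<i> * of_nat (Suc n))"
    by (auto simp: inj_on_def)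
  hence "infinite (range (\<lambda>n::nat. \<i> * of_nat (Suc n)))"
    using finite_imageD by blast
  moreover have "range (\<lambda>n::nat. \<i> * of_nat (Suc n)) \<subseteq> {z. poly (p' - p) z = 0}"
    using p' assms by (auto simp: upper_half_plane_def)
  ultimately have "infinite {z. poly (p' - p) z = 0}"
    using finite_subset by blast
  thus "p' = p"
    using poly_roots_finite[of "p' - p"] by auto
qed (use assms in auto)

(* The zero polynomial is not unimodular. *)
definition unimodular :: "complex poly \<Rightarrow> bool" where
  "unimodular p \<longleftrightarrow> (\<forall>z. poly p z = 0 \<longrightarrow> norm z = 1)"

(* Distinct indices into the list of normalized eigenforms are rendered as pairwise distinct
   normalized eigenforms. *)
definition comb_forms :: "nat \<Rightarrow> real list \<Rightarrow> real list \<Rightarrow> (complex \<Rightarrow> complex) set" where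
  "comb_forms k c a =
     {\<lambda>z. (\<Sum>l<length c. of_real (c ! l) * (fs ! l) z) - (\<Sum>j<length a. of_real (a ! j) * (gs ! j) z) |fs gs.
        length fs = length c \<and> length gs = length a \<and> distinct (fs @ gs) \<and>
        set (fs @ gs) \<subseteq> normalized_eigenforms k}"

definition all_comb_forms :: "real list \<Rightarrow> real list \<Rightarrow> (complex \<Rightarrow> complex) set" where
  "all_comb_forms c a = (\<Union>k. comb_forms k c a)"

end

theory Submission imports Defs begin

text \<open>
  Let \<open>f\<close> be a combination of normalized eigenforms with coefficient sum \<open>A > 0\<close>, and \<open>k = 2 m + 2\<close>.
  Up to a constant, \<open>r_f\<close> is \<open>\<Sum>n\<le>2m. i^n h_n z^n\<close>, where \<open>h_n\<close> is a normalized moment of \<open>f\<close> on the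
  imaginary axis, and the transformation law under \<open>z \<mapsto> -1/z\<close> makes this \<open>H(z) - z^(2m) H(-1/z)\<close> with
  \<open>H\<close> the lower half of the polynomial. If the \<open>h_n\<close> are real, both terms have the same modulus on
  the unit circle, so by the maximum principle all zeros lie on it once \<open>H\<close> has none in the closed
  disc; and \<open>H(z)\<close> tends to \<open>A exp(2 pi i z)\<close> uniformly on the disc.

  Comparing suprema of \<open>|f| y^(k/2)\<close> in \<open>T_n f = a_n f\<close> gives \<open>|a_n| \<le> n^(k/2-1) \<sigma>(n)\<close> with no implied
  constant, which replaces Deligne's bound. The \<open>a_n\<close> are real because \<open>T_n\<close> is self-adjoint: with a
  weight \<open>w\<close> whose translates under the modular group sum to \<open>1\<close>, the Petersson product of \<open>T_n f\<close> and
  \<open>f\<close> unfolds to integrals weighted by \<open>w(z) w(\<beta> z)\<close> over all integer matrices \<open>\<beta>\<close> of determinant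
  \<open>n\<close>, and replacing \<open>\<beta>\<close> by its adjugate conjugates each term.

  Each weight has finitely many normalized eigenforms, since they are linearly independent and a
  cusp form of weight \<open>k\<close> is determined by its first \<open>2 k + 2\<close> coefficients.
\<close>

section \<open>Integer matrices acting on the upper half plane\<close>

text \<open>With sigma(n) bounded by n^2, the coefficient estimate used below is |a_n| <= n^(k/2+1),
  weaker than Deligne's by about n^(3/2). For k = 2 m + 2 it makes the Dirichlet series of the j-th
  moment converge absolutely once j >= m + 3, which serves the coefficients h_n with n <= m - 3. The
  three remaining coefficients of H, those with n = m - 2, m - 1, m, are not approximated at all:
  splitting their moments at v = 1 bounds them, and the factorials in the normalization make that
  bound tend to 0. Having no implied constant is essential, since the forms vary with k and an
  unspecified constant depending on f could not be controlled.

  The weight w replaces a fundamental domain. It only needs a set that meets every orbit, each one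
  finitely often, so no boundary identifications arise; and the symmetric factor w(z) w(\<beta> z)
  turns the passage from \<beta> to its adjugate into a measure-preserving substitution.\<close>

type_synonym imat = "int \<times> int \<times> int \<times> int"

fun mob :: "imat \<Rightarrow> complex \<Rightarrow> complex" where
  "mob (a, b, c, d) z = (of_int a * z + of_int b) / (of_int c * z + of_int d)"

fun jac :: "imat \<Rightarrow> complex \<Rightarrow> complex" where
  "jac (a, b, c, d) z = of_int c * z + of_int d"

fun mdet :: "imat \<Rightarrow> int" where
  "mdet (a, b, c, d) = a * d - b * c"

fun mmul :: "imat \<Rightarrow> imat \<Rightarrow> imat" where
  "mmul (a, b, c, d) (a', b', c', d') =
     (a * a' + b * c', a * b' + b * d', c * a' + d * c', c * b' + d * d')"

text \<open>The adjugate acts on the half plane as the inverse of the matrix, while staying integral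
  and keeping the determinant.\<close>

fun madj :: "imat \<Rightarrow> imat" where
  "madj (a, b, c, d) = (d, -b, -c, a)"

lemma mdet_mmul: "mdet (mmul A B) = mdet A * mdet B"
  by (cases A; cases B) (simp add: algebra_simps)

lemma mdet_madj [simp]: "mdet (madj A) = mdet A"
  by (cases A) simp

lemma madj_madj [simp]: "madj (madj A) = A"
  by (cases A) simp

lemma mmul_assoc: "mmul (mmul A B) C = mmul A (mmul B C)"
  by (cases A; cases B; cases C) (simp add: algebra_simps)

lemma mmul_madj_left: "mmul (madj A) A = (mdet A, 0, 0, mdet A)"
  by (cases A) (simp add: algebra_simps)

lemma mmul_madj_right: "mmul A (madj A) = (mdet A, 0, 0, mdet A)"
  by (cases A) (simp add: algebra_simps)

lemma mmul_one_left [simp]: "mmul (1, 0, 0, 1) A = A"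
  by (cases A) simp

lemma mmul_one_right [simp]: "mmul A (1, 0, 0, 1) = A"
  by (cases A) simp

lemma jac_nonzero:
  assumes "mdet A \<noteq> 0" "Im z > 0"
  shows "jac A z \<noteq> 0"
proof (cases A)
  case (fields a b c d)
  show ?thesis
  proof
    assume "jac A z = 0"
    then have *: "of_int c * z + of_int d = 0" using fields by simp
    then have "Im (of_int c * z + of_int d) = 0" by (metis zero_complex.sel(2))
    then have "c = 0" using assms(2) by simp
    with * have "d = 0" by simp
    with \<open>c = 0\<close> assms(1) fields show False by simp
  qed
qed

lemma Im_mob:
  assumes "Im z > 0"
  shows "Im (mob A z) = of_int (mdet A) * Im z / norm (jac A z) ^ 2"
proof (cases A)
  case (fields a b c d)
  have "Im (mob A z) = Im ((of_int a * z + of_int b) * cnj (jac A z)) / norm (jac A z) ^ 2"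
    by (simp add: fields complex_div_cnj[of "of_int a * z + of_int b"])
  also have "Im ((of_int a * z + of_int b) * cnj (jac A z)) = of_int (mdet A) * Im z"
    by (simp add: fields algebra_simps)
  finally show ?thesis .
qed

lemma Im_mob_pos:
  assumes "Im z > 0" "mdet A > 0"
  shows "Im (mob A z) > 0"
  unfolding Im_mob[OF assms(1)] using assms jac_nonzero[of A z] by simp

lemma jac_mmul:
  assumes "Im z > 0" "mdet B \<noteq> 0"
  shows "jac (mmul A B) z = jac A (mob B z) * jac B z"
proof -
  obtain a b c d where A: "A = (a,b,c,d)" by (cases A) auto
  obtain a' b' c' d' where B: "B = (a',b',c',d')" by (cases B) auto
  have nz: "of_int c' * z + of_int d' \<noteq> 0"
    using jac_nonzero[OF assms(2,1)] by (simp add: B)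
  show ?thesis using nz by (simp add: A B field_simps)
qed

lemma mob_mmul:
  assumes "Im z > 0" "mdet B \<noteq> 0"
  shows "mob (mmul A B) z = mob A (mob B z)"
proof -
  obtain a b c d where A: "A = (a,b,c,d)" by (cases A) auto
  obtain a' b' c' d' where B: "B = (a',b',c',d')" by (cases B) auto
  have nz: "of_int c' * z + of_int d' \<noteq> 0"
    using jac_nonzero[OF assms(2,1)] by (simp add: B)
  let ?j = "of_int c' * z + of_int d'"
  have num: "of_int a * mob B z + of_int b = (of_int (a*a'+b*c') * z + of_int (a*b'+b*d')) / ?j"
    using nz by (simp add: B field_simps)
  have den: "of_int c * mob B z + of_int d = (of_int (c*a'+d*c') * z + of_int (c*b'+d*d')) / ?j"
    using nz by (simp add: B field_simps)
  have "mob A (mob B z) = (of_int a * mob B z + of_int b) / (of_int c * mob B z + of_int d)"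
    by (simp add: A)
  also have "\<dots> = (of_int (a*a'+b*c') * z + of_int (a*b'+b*d')) / (of_int (c*a'+d*c') * z + of_int (c*b'+d*d'))"
    unfolding num den using nz by simp
  finally show ?thesis by (simp add: A B)
qed

lemma mob_scalar [simp]: "n \<noteq> 0 \<Longrightarrow> mob (n, 0, 0, n) z = z"
  by simp

lemma mob_madj_mob:
  assumes "Im z > 0" "mdet A > 0"
  shows "mob (madj A) (mob A z) = z"
  using mob_mmul[of z A "madj A"] assms by (simp add: mmul_madj_left)

lemma mob_mob_madj:
  assumes "Im z > 0" "mdet A > 0"
  shows "mob A (mob (madj A) z) = z"
  using mob_madj_mob[of z "madj A"] assms by simp

lemma cusp_form_transform:
  assumes "f \<in> cusp_forms k" "mdet A = 1" "Im z > 0"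
  shows "f (mob A z) = jac A z ^ k * f z"
  using assms by (cases A) (auto simp: cusp_forms_def upper_half_plane_def)

lemma cusp_form_expansionE:
  assumes "f \<in> cusp_forms k"
  obtains a where "cusp_expansion f a"
  using assms by (auto simp: cusp_forms_def)

lemma cusp_form_eqI:
  assumes "f \<in> cusp_forms k" "g \<in> cusp_forms l" "\<And>z. Im z > 0 \<Longrightarrow> f z = g z"
  shows "f = g"
proof
  fix z show "f z = g z"
    using assms by (cases "Im z > 0") (auto simp: cusp_forms_def upper_half_plane_def)
qed

lemma cusp_form_zero_offI:
  assumes "f \<in> cusp_forms k" "\<And>z. Im z > 0 \<Longrightarrow> f z = 0"
  shows "f = (\<lambda>z. 0)"
proof
  fix z show "f z = 0"
    using assms by (cases "Im z > 0") (auto simp: cusp_forms_def upper_half_plane_def)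
qed

text \<open>Dirichlet approximation of the real part to order \<open>1/sqrt y\<close> makes \<open>c z + d\<close> of size
  \<open>sqrt y\<close>.\<close>

lemma exists_Siegel_representative:
  assumes "Im z > 0"
  obtains A where "mdet A = 1" "Im (mob A z) \<ge> 1/5" "\<bar>Re (mob A z)\<bar> \<le> 1/2"
proof -
  obtain B where B: "mdet B = 1" "Im (mob B z) \<ge> 1/5"
  proof (cases "Im z \<ge> 1/5")
    case True
    then show ?thesis using that[of "(1,0,0,1)"] by simp
  next
    case False
    define y where "y = Im z"
    define s where "s = sqrt y"
    have y: "0 < y" "y < 1/5" and s: "s > 0" "s^2 = y" 
      using assms False by (auto simp: y_def s_def)
    have s1: "s < 1" using y by (simp add: s_def)
    define N where "N = nat \<lceil>1 / s\<rceil>"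
    have N0: "N > 0" using s by (simp add: N_def)
    have N1: "real N \<ge> 1 / s" unfolding N_def by linarith
    have N2: "real N \<le> 1 / s + 1" using s by (simp add: N_def)
    obtain h k where hk: "coprime h k" "0 < k" "k \<le> int N" "\<bar>of_int k * Re z - of_int h\<bar> < 1 / N"
      using Dirichlet_approx_coprime[OF N0] by metis
    obtain u v where uv: "u * h + v * k = 1"
      using bezout_int[of h k] hk(1) by auto
    \<comment> \<open>The bottom row makes the denominator \<open>k * z - h\<close>, whose real part
      is at most \<open>s\<close> and whose imaginary part is at most \<open>2 * s\<close> in
      absolute value, with \<open>s = sqrt y\<close>. Its squared modulus is thus at most 5 y, the
      origin of the height 1/5.\<close>
    define A where "A = (- u, - v, k, - h)"
    have "mdet A = 1" using uv by (simp add: A_def)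
    have i1: "1 / real N \<le> s" using N1 N0 s by (simp add: field_simps)
    have i2: "of_int k \<le> real N" using hk(3) by linarith
    have i3: "real N * s \<le> 2" using N2 s s1 by (simp add: field_simps)
    have "norm (jac A z) ^ 2 = (of_int k * Re z - of_int h)^2 + (of_int k * y)^2"
      by (simp add: A_def cmod_power2 y_def)
    also have "(of_int k * Re z - of_int h)^2 \<le> s^2"
      using hk(4) i1 power_mono[of "\<bar>of_int k * Re z - of_int h\<bar>" s 2] by simp
    also have "(of_int k * y)^2 \<le> 4 * s^2"
    proof -
      have "of_int k * y \<le> real N * s * s" using mult_right_mono[OF i2, of y] y s(2) by (simp add: power2_eq_square mult.assoc)
      also have "\<dots> \<le> 2 * s" using i3 s by simp
      finally have "(of_int k * y)^2 \<le> (2 * s)^2" using hk(2) y by (intro power_mono) auto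
      then show ?thesis by (simp add: power_mult_distrib)
    qed
    finally have "norm (jac A z) ^ 2 \<le> 5 * y" using s by simp
    moreover have "norm (jac A z) ^ 2 > 0" using jac_nonzero[of A z] \<open>mdet A = 1\<close> assms by simp
    ultimately have "y / norm (jac A z) ^ 2 \<ge> 1/5"
      by (subst pos_le_divide_eq) simp_all
    then have "Im (mob A z) \<ge> 1/5"
      using \<open>mdet A = 1\<close> by (simp add: Im_mob[OF assms] y_def)
    with \<open>mdet A = 1\<close> that show ?thesis by blast
  qed
  define n where "n = - round (Re (mob B z))"
  have *: "mob (mmul (1,n,0,1) B) z = mob B z + of_int n"
    using mob_mmul[OF assms, of B "(1,n,0,1)"] B by simp
  have "\<bar>Re (mob B z) + of_int n\<bar> \<le> 1/2"
    using of_int_round_abs_le[of "Re (mob B z)"] by (simp add: n_def abs_minus_commute)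
  then show ?thesis
    using B by (intro that[of "mmul (1,n,0,1) B"]) (simp_all add: mdet_mmul *)
qed

section \<open>Growth of cusp forms\<close>

definition qexp :: "complex \<Rightarrow> complex" where
  "qexp z = exp (2 * of_real pi * \<i> * z)"

lemma norm_qexp: "norm (qexp z) = exp (- 2 * pi * Im z)"
  by (simp add: qexp_def norm_exp_eq_Re)

lemma norm_qexp_less_1: "Im z > 0 \<Longrightarrow> norm (qexp z) < 1"
  by (simp add: norm_qexp)

lemma qexp_nonzero [simp]: "qexp z \<noteq> 0"
  by (simp add: qexp_def)

lemma qexp_surj:
  assumes "w \<noteq> 0" "norm w < 1"
  obtains z where "Im z > 0" "qexp z = w"
proof -
  define z where "z = Ln w / (2 * of_real pi * \<i>)"
  have q: "qexp z = w" using assms by (simp add: z_def qexp_def)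
  have "Im z > 0" using assms norm_qexp[of z] by (simp add: q zero_less_mult_iff)
  with q that show ?thesis by blast
qed

lemma cusp_expansion_sums:
  assumes "cusp_expansion f a" "Im z > 0"
  shows "(\<lambda>n. a n * qexp z ^ n) sums f z"
  using assms by (simp add: cusp_expansion_def upper_half_plane_def qexp_def)

lemma cusp_expansion_vertical:
  assumes "cusp_expansion f a" "Im z + t > 0"
  shows "(\<lambda>n. a n * qexp z ^ n * of_real (exp (- 2 * pi * real n * t))) sums f (z + \<i> * of_real t)"
proof -
  have "qexp (z + \<i> * of_real t) ^ n = qexp z ^ n * of_real (exp (- 2 * pi * real n * t))" for n
    by (simp add: qexp_def exp_of_nat_mult[symmetric] exp_of_real[symmetric] exp_add[symmetric] algebra_simps)
  then show ?thesis
    using cusp_expansion_sums[OF assms(1), of "z + \<i> * of_real t"] assms(2) by (simp add: mult.assoc)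
qed

lemma cusp_expansion_imaginary_axis:
  assumes "cusp_expansion f a" "t > 0"
  shows "(\<lambda>n. a n * of_real (exp (- 2 * pi * real n * t))) sums f (\<i> * of_real t)"
  using cusp_expansion_vertical[of f a 0 t] assms by (simp add: qexp_def)

lemma cusp_expansion_summable:
  assumes "cusp_expansion f a" "norm w < 1"
  shows "summable (\<lambda>n. norm (a n * w ^ n))"
proof -
  define r where "r = (1 + norm w) / 2"
  have r: "norm w < r" "r < 1" "r > 0" using assms(2) norm_ge_zero[of w] by (auto simp: r_def intro: add_pos_nonneg)
  obtain z where z: "Im z > 0" "qexp z = of_real r"
    using qexp_surj[of "of_real r"] r by auto
  have "summable (\<lambda>n. a n * of_real r ^ n)"
    using cusp_expansion_sums[OF assms(1) z(1)] z(2) by (auto simp: sums_iff)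
  then show ?thesis
    by (rule powser_insidea) (use r in auto)
qed

text \<open>Since the constant term vanishes, one factor q comes out of the series; what remains is
  majorized by the series of absolute values at height \<open>y0\<close>.\<close>

lemma cusp_form_decay:
  assumes "cusp_expansion f a" "y0 > 0"
  obtains C where "C \<ge> 0" "\<And>z. Im z \<ge> y0 \<Longrightarrow> norm (f z) \<le> C * exp (- 2 * pi * Im z)"
proof -
  define r where "r = exp (- 2 * pi * y0)"
  have r: "0 < r" "r < 1" using assms(2) by (auto simp: r_def)
  have "summable (\<lambda>n. norm (a n * of_real r ^ n))"
    using cusp_expansion_summable[OF assms(1), of "of_real r"] r by simp
  then have s1: "summable (\<lambda>n. norm (a (Suc n)) * r ^ Suc n)"
    using r by (subst (asm) summable_Suc_iff[symmetric]) (simp add: norm_mult norm_power)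
  define C where "C = (\<Sum>n. norm (a (Suc n)) * r ^ Suc n) / r"
  have "C \<ge> 0" unfolding C_def using r s1 by (intro divide_nonneg_pos suminf_nonneg) auto
  moreover have "norm (f z) \<le> C * exp (- 2 * pi * Im z)" if "Im z \<ge> y0" for z
  proof -
    define t where "t = norm (qexp z)"
    have t: "0 < t" "t \<le> r" using that by (auto simp: t_def r_def norm_qexp)
    have "Im z > 0" using that assms(2) by simp
    have "(\<lambda>n. a n * qexp z ^ n) sums f z" by (rule cusp_expansion_sums) fact+
    then have "(\<lambda>n. a (Suc n) * qexp z ^ Suc n) sums f z"
      using assms(1) by (subst sums_Suc_iff) (simp add: cusp_expansion_def)
    moreover have "summable (\<lambda>n. norm (a (Suc n)) * r ^ Suc n * (t / r))"
      by (intro summable_mult2 s1)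
    moreover have le: "norm (a (Suc n) * qexp z ^ Suc n) \<le> norm (a (Suc n)) * r ^ Suc n * (t / r)" for n
    proof -
      have "t ^ n \<le> r ^ n" using t by (intro power_mono) auto
      then have "t ^ Suc n \<le> r ^ Suc n * (t / r)" using t r by simp
      then show ?thesis by (simp only: norm_mult norm_power t_def[symmetric] mult.assoc) (intro mult_left_mono, auto)
    qed
    ultimately have "norm (f z) \<le> (\<Sum>n. norm (a (Suc n)) * r ^ Suc n * (t / r))"
      by (metis (no_types, lifting) norm_suminf_le sums_unique)
    also have "\<dots> = C * t" by (subst suminf_mult2[OF s1, symmetric]) (simp add: C_def)
    finally show ?thesis by (simp add: t_def norm_qexp)
  qed
  ultimately show ?thesis using that by blast
qed

text \<open>\<open>qexp\<close> maps the upper half plane onto the punctured unit disc, so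
  convergence at all its values is convergence on the whole disc.\<close>

lemma disc_power_series_holomorphic:
  assumes "\<And>z. Im z > 0 \<Longrightarrow> summable (\<lambda>n. c n * qexp z ^ n)"
  shows "(\<lambda>w. \<Sum>n. c n * w ^ n) holomorphic_on ball 0 1"
proof (rule power_series_holomorphic)
  fix w :: complex assume "w \<in> ball 0 1"
  then have w: "norm w < 1" by simp
  have "summable (\<lambda>n. c n * w ^ n)"
  proof (cases "w = 0")
    case True
    then show ?thesis by (intro summable_finite[of "{0}"]) auto
  next
    case False
    obtain z where "Im z > 0" "qexp z = w" using False w by (rule qexp_surj)
    then show ?thesis using assms[of z] by simp
  qed
  then show "(\<lambda>n. c n * (w - 0) ^ n) sums (\<Sum>n. c n * w ^ n)" by (simp add: summable_sums)
qed

section \<open>The invariant norm |f| y^(k/2) and its supremum\<close>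

definition pnorm :: "nat \<Rightarrow> (complex \<Rightarrow> complex) \<Rightarrow> complex \<Rightarrow> real" where
  "pnorm k f z = norm (f z) * sqrt (Im z) ^ k"

lemma pnorm_mob:
  assumes "f \<in> cusp_forms k" "mdet A = 1" "Im z > 0"
  shows "pnorm k f (mob A z) = pnorm k f z"
proof -
  have nz: "norm (jac A z) > 0" using jac_nonzero[of A z] assms by simp
  have "sqrt (Im (mob A z)) = sqrt (Im z) / norm (jac A z)"
    using assms nz by (simp add: Im_mob real_sqrt_divide)
  then show ?thesis using nz
    by (simp add: pnorm_def cusp_form_transform[OF assms] norm_mult norm_power power_divide)
qed

lemma power_le_fact_mult_exp:
  assumes "(x::real) \<ge> 0"
  shows "x ^ k \<le> fact k * exp x"
proof -
  have "sum (\<lambda>n. x ^ n /\<^sub>R fact n) {k} \<le> (\<Sum>n. x ^ n /\<^sub>R fact n)"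
    using assms by (intro sum_le_suminf summable_exp_generic) auto
  then show ?thesis by (simp add: exp_def field_simps)
qed

lemma sqrt_power_exp_bound:
  assumes "y > 0"
  shows "sqrt y ^ k * exp (- 2 * pi * y) \<le> fact k * exp 1"
proof -
  have "sqrt y \<le> 1 + y" using assms by (intro real_le_lsqrt) (auto simp: power2_eq_square algebra_simps)
  then have "sqrt y ^ k \<le> (1 + y) ^ k" using assms by (intro power_mono) auto
  also have "\<dots> \<le> fact k * exp (1 + y)"
    using assms by (intro power_le_fact_mult_exp) auto
  finally have "sqrt y ^ k * exp (- 2 * pi * y) \<le> fact k * exp (1 + y) * exp (- 2 * pi * y)"
    by (intro mult_right_mono) auto
  also have "\<dots> = fact k * exp (1 + (y - 2 * pi * y))" by (simp add: exp_add[symmetric])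
  also have "\<dots> \<le> fact k * exp 1"
    using mult_right_mono[of 1 "2 * pi" y] assms pi_ge_two by (intro mult_left_mono) auto
  finally show ?thesis .
qed

text \<open>By invariance it suffices to look at heights at least 1/5, where the decay at the cusp
  outweighs the power of y.\<close>

lemma pnorm_bounded:
  assumes "f \<in> cusp_forms k"
  obtains M where "M \<ge> 0" "\<And>z. Im z > 0 \<Longrightarrow> pnorm k f z \<le> M"
proof -
  obtain a where a: "cusp_expansion f a" using cusp_form_expansionE[OF assms] .
  obtain C where C: "C \<ge> 0" "\<And>z. Im z \<ge> 1/5 \<Longrightarrow> norm (f z) \<le> C * exp (- 2 * pi * Im z)"
    using cusp_form_decay[OF a, of "1/5"] by auto
  show ?thesis
  proof (rule that)
    show "C * (fact k * exp 1) \<ge> 0" using C by simp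
    fix z assume z: "Im z > 0"
    obtain A where A: "mdet A = 1" "Im (mob A z) \<ge> 1/5" "\<bar>Re (mob A z)\<bar> \<le> 1/2"
      by (rule exists_Siegel_representative[OF z])
    define w where "w = mob A z"
    have w: "Im w \<ge> 1/5" using A by (simp add: w_def)
    have "pnorm k f z = pnorm k f w" using pnorm_mob[OF assms A(1) z] by (simp add: w_def)
    also have "\<dots> \<le> C * exp (- 2 * pi * Im w) * sqrt (Im w) ^ k"
      unfolding pnorm_def using C(2)[OF w] w by (intro mult_right_mono) auto
    also have "\<dots> = C * (sqrt (Im w) ^ k * exp (- 2 * pi * Im w))" by simp
    also have "\<dots> \<le> C * (fact k * exp 1)"
      using C w by (intro mult_left_mono sqrt_power_exp_bound) auto
    finally show "pnorm k f z \<le> C * (fact k * exp 1)" .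
  qed
qed

definition psup :: "nat \<Rightarrow> (complex \<Rightarrow> complex) \<Rightarrow> real" where
  "psup k f = (SUP z\<in>{z. Im z > 0}. pnorm k f z)"

lemma pnorm_le_psup:
  assumes "f \<in> cusp_forms k" "Im z > 0"
  shows "pnorm k f z \<le> psup k f"
proof -
  obtain M where "\<And>z. Im z > 0 \<Longrightarrow> pnorm k f z \<le> M" using pnorm_bounded[OF assms(1)] by blast
  then have "bdd_above (pnorm k f ` {z. Im z > 0})" by (auto intro!: bdd_aboveI2)
  then show ?thesis unfolding psup_def using assms(2) by (intro cSUP_upper) auto
qed

lemma psup_le:
  assumes "\<And>z. Im z > 0 \<Longrightarrow> pnorm k f z \<le> C"
  shows "psup k f \<le> C"
  unfolding psup_def using assms by (intro cSUP_least) (auto intro: exI[of _ \<i>])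

section \<open>Hecke eigenvalues are Fourier coefficients\<close>

lemma qexp_of_nat: "qexp (of_nat n) = 1"
proof -
  have "qexp (of_nat n) = exp (2 * of_real pi * \<i>) ^ n"
    by (simp add: qexp_def exp_of_nat_mult[symmetric] mult_ac)
  then show ?thesis by (simp add: exp_two_pi_i mult_ac)
qed

lemma sum_roots_of_unity:
  assumes "d > 0"
  shows "(\<Sum>b<d. qexp (of_nat b / of_nat d) ^ m) = (if d dvd m then of_nat d else 0)"
proof -
  define \<zeta> where "\<zeta> = qexp (of_nat m / of_nat d)"
  have eq: "qexp (of_nat b / of_nat d) ^ m = \<zeta> ^ b" for b
    by (simp add: \<zeta>_def qexp_def exp_of_nat_mult[symmetric] mult_ac)
  have "\<zeta> ^ d = qexp (of_nat m)"
    using assms by (simp add: \<zeta>_def qexp_def exp_of_nat_mult[symmetric] mult_ac)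
  then have zd: "\<zeta> ^ d = 1" by (simp only: qexp_of_nat)
  have iff: "\<zeta> = 1 \<longleftrightarrow> d dvd m"
  proof
    assume "\<zeta> = 1"
    then obtain n :: int where "2 * pi * (of_nat m / of_nat d) = of_int (2 * n) * pi"
      by (auto simp: \<zeta>_def qexp_def exp_eq_1)
    then have "of_nat m = (of_int n * of_nat d :: real)" using assms by (simp add: field_simps)
    then have "int m = n * int d" by (metis of_int_eq_iff of_int_mult of_int_of_nat_eq)
    then show "d dvd m" by (metis dvd_triv_right int_dvd_int_iff)
  next
    assume "d dvd m"
    then obtain l where "m = d * l" by auto
    then have "\<zeta> = qexp (of_nat l)" using assms by (simp add: \<zeta>_def)
    then show "\<zeta> = 1" by (simp only: qexp_of_nat)
  qed
  show ?thesis
  proof (cases "d dvd m")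
    case True
    then show ?thesis by (simp add: eq iff[THEN iffD2])
  next
    case False
    then have "(\<Sum>b<d. \<zeta> ^ b) = (\<zeta> ^ d - 1) / (\<zeta> - 1)" by (intro geometric_sum) (simp add: iff)
    then show ?thesis using False by (simp add: eq zd)
  qed
qed

text \<open>This is the inner sum of the Hecke operator. Summing over b kills the exponents not
  divisible by d, and passing from z to z/d divides the surviving ones by d.\<close>

lemma cusp_expansion_average:
  assumes "cusp_expansion f a" "d > 0"
  shows "cusp_expansion (\<lambda>z. \<Sum>b<d. f ((z + of_nat b) / of_nat d)) (\<lambda>m. of_nat d * a (d * m))"
  unfolding cusp_expansion_def qexp_def[symmetric]
proof (intro conjI ballI)
  show "of_nat d * a (d * 0) = 0" using assms by (simp add: cusp_expansion_def)
  fix z assume "z \<in> upper_half_plane"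
  then have z: "Im z > 0" by (simp add: upper_half_plane_def)
  have "(\<lambda>m. \<Sum>b<d. a m * qexp ((z + of_nat b) / of_nat d) ^ m) sums (\<Sum>b<d. f ((z + of_nat b) / of_nat d))"
    using z assms(2) by (intro sums_sum cusp_expansion_sums[OF assms(1)]) (auto simp: Im_divide_of_nat)
  also have "(\<lambda>m. \<Sum>b<d. a m * qexp ((z + of_nat b) / of_nat d) ^ m) =
     (\<lambda>m. a m * qexp (z / of_nat d) ^ m * (if d dvd m then of_nat d else 0))"
  proof
    fix m
    have "qexp ((z + of_nat b) / of_nat d) = qexp (z / of_nat d) * qexp (of_nat b / of_nat d)" for b
      by (simp add: qexp_def exp_add[symmetric] add_divide_distrib ring_distribs)
    then show "(\<Sum>b<d. a m * qexp ((z + of_nat b) / of_nat d) ^ m) =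
       a m * qexp (z / of_nat d) ^ m * (if d dvd m then of_nat d else 0)"
      by (simp only: power_mult_distrib sum_distrib_left[symmetric] mult.assoc sum_roots_of_unity[OF assms(2)])
  qed
  finally have "(\<lambda>m. a m * qexp (z / of_nat d) ^ m * (if d dvd m then of_nat d else 0)) sums
     (\<Sum>b<d. f ((z + of_nat b) / of_nat d))" .
  then have "(\<lambda>m. a (d * m) * qexp (z / of_nat d) ^ (d * m) * (if d dvd d * m then of_nat d else 0)) sums
     (\<Sum>b<d. f ((z + of_nat b) / of_nat d))"
    using assms(2) by (subst sums_mono_reindex[where g = "\<lambda>m. d * m"]) (auto intro!: strict_monoI)
  moreover have "qexp (z / of_nat d) ^ (d * m) = qexp z ^ m" for m
    using assms(2) by (simp add: power_mult qexp_def exp_of_nat_mult[symmetric])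
  ultimately show "(\<lambda>m. of_nat d * a (d * m) * qexp z ^ m) sums (\<Sum>b<d. f ((z + of_nat b) / of_nat d))"
    by (simp add: mult_ac)
qed

text \<open>Removing the leading term and dividing by q gives again a series without constant term,
  so decay at the cusp yields the limit of f/q in
  \<open>tendsto_cusp_expansion_coeff1\<close>.\<close>

lemma cusp_expansion_shift:
  assumes "cusp_expansion f a"
  shows "cusp_expansion (\<lambda>z. f z / qexp z - a 1) (\<lambda>n. if n = 0 then 0 else a (Suc n))"
  unfolding cusp_expansion_def qexp_def[symmetric]
proof (intro conjI ballI)
  fix z assume "z \<in> upper_half_plane"
  then have "(\<lambda>n. a n * qexp z ^ n) sums f z"
    using cusp_expansion_sums[OF assms, of z] by (simp add: upper_half_plane_def)
  then have "(\<lambda>n. a (Suc n) * qexp z ^ Suc n) sums f z"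
    using assms by (subst sums_Suc_iff) (simp add: cusp_expansion_def)
  then have "(\<lambda>n. a (Suc n) * qexp z ^ Suc n / qexp z) sums (f z / qexp z)"
    by (rule sums_divide)
  then have "(\<lambda>n. a (Suc n) * qexp z ^ n) sums (f z / qexp z)" by simp
  then have "(\<lambda>n. a (Suc n) * qexp z ^ n - (if n = 0 then a 1 else 0)) sums (f z / qexp z - a 1)"
    by (intro sums_diff) (use sums_single[of 0 "\<lambda>_. a 1"] in simp_all)
  then show "(\<lambda>n. (if n = 0 then 0 else a (Suc n)) * qexp z ^ n) sums (f z / qexp z - a 1)"
    by (rule sums_cong[THEN iffD1, rotated]) auto
qed simp

lemma tendsto_cusp_expansion_zero:
  assumes "cusp_expansion f a" "filterlim (\<lambda>x. Im (g x)) at_top F"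
  shows "((\<lambda>x. f (g x)) \<longlongrightarrow> 0) F"
proof -
  obtain C where C: "C \<ge> 0" "\<And>z. Im z \<ge> 1 \<Longrightarrow> norm (f z) \<le> C * exp (- 2 * pi * Im z)"
    using cusp_form_decay[OF assms(1), of 1] by auto
  have "((\<lambda>y. C * exp (- 2 * pi * y)) \<longlongrightarrow> 0) at_top" by real_asymp
  then have *: "((\<lambda>x. C * exp (- 2 * pi * Im (g x))) \<longlongrightarrow> 0) F"
    using assms(2) by (rule filterlim_compose)
  have "eventually (\<lambda>x. Im (g x) \<ge> 1) F" using assms(2) by (simp add: filterlim_at_top)
  then show ?thesis
    by (intro Lim_null_comparison[OF _ *]) (use C(2) in \<open>auto elim!: eventually_mono\<close>)
qed

lemma tendsto_cusp_expansion_coeff1: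
  assumes "cusp_expansion f a"
  shows "((\<lambda>t. f (\<i> * of_real t) / qexp (\<i> * of_real t)) \<longlongrightarrow> a 1) at_top"
proof -
  have "((\<lambda>t. f (\<i> * of_real t) / qexp (\<i> * of_real t) - a 1) \<longlongrightarrow> 0) at_top"
    by (rule tendsto_cusp_expansion_zero[OF cusp_expansion_shift[OF assms]]) (simp add: filterlim_ident)
  then show ?thesis using LIM_zero_iff by blast
qed

text \<open>The quotient is f(n z) / q(n z), which converges to \<open>a 1\<close>, times
  q(z)^(n-1), which tends to 0.\<close>

lemma tendsto_cusp_expansion_scaled:
  assumes "cusp_expansion f a" "n > 1"
  shows "((\<lambda>t. f (of_nat n * (\<i> * of_real t)) / qexp (\<i> * of_real t)) \<longlongrightarrow> 0) at_top"
proof -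
  have n: "n \<ge> 2" using assms by simp
  have lim: "filterlim (\<lambda>t. real n * t) at_top at_top"
    using n by real_asymp
  have "((\<lambda>t. f (\<i> * of_real (real n * t)) / qexp (\<i> * of_real (real n * t))) \<longlongrightarrow> a 1) at_top"
    by (rule filterlim_compose[OF tendsto_cusp_expansion_coeff1[OF assms(1)] lim])
  moreover have "((\<lambda>t. of_real (exp (- 2 * pi * (real (n - 1) * t))) :: complex) \<longlongrightarrow> of_real 0) at_top"
  proof (rule tendsto_of_real)
    have "real (n - 1) > 0" using n by simp
    then show "((\<lambda>t. exp (- 2 * pi * (real (n - 1) * t))) \<longlongrightarrow> 0) at_top" by real_asymp
  qed
  ultimately have "((\<lambda>t. f (\<i> * of_real (real n * t)) / qexp (\<i> * of_real (real n * t)) *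
      of_real (exp (- 2 * pi * (real (n - 1) * t)))) \<longlongrightarrow> a 1 * of_real 0) at_top"
    by (rule tendsto_mult)
  moreover have "f (\<i> * of_real (real n * t)) / qexp (\<i> * of_real (real n * t)) *
      of_real (exp (- 2 * pi * (real (n - 1) * t))) = f (of_nat n * (\<i> * of_real t)) / qexp (\<i> * of_real t)" for t
  proof -
    have "of_real (exp (- 2 * pi * (real (n - 1) * t))) = qexp (\<i> * of_real (real n * t)) / qexp (\<i> * of_real t)"
      using n by (simp add: qexp_def exp_diff[symmetric] exp_of_real[symmetric] of_nat_diff algebra_simps)
    then show ?thesis by (simp add: mult_ac)
  qed
  ultimately show ?thesis by simp
qed

lemma powi_int_minus_one: "n > 0 \<Longrightarrow> (of_nat n :: complex) powi (int k - 1) = of_nat n ^ k / of_nat n"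
  by (simp add: power_int_diff)

text \<open>Divide the eigenvalue equation by q and go up the imaginary axis. The term of
  \<open>hecke_op\<close> with divisor d is a series in q^(n/d) without constant term, so only d = n
  survives; it contributes n times \<open>a n\<close>, and the powers of n cancel. Thus only the
  first coefficient of the image has to be computed.\<close>

lemma hecke_eigenvalue_eq_coeff:
  assumes a: "cusp_expansion f a" and n: "n \<ge> 1"
    and ev: "\<And>z. Im z > 0 \<Longrightarrow> hecke_op k n f z = ev * f z"
  shows "ev * a 1 = a n"
proof -
  define g where "g = (\<lambda>d z. \<Sum>b<d. f ((z + of_nat b) / of_nat d))"
  have g: "cusp_expansion (g d) (\<lambda>m. of_nat d * a (d * m))" if "d > 0" for d
    unfolding g_def by (rule cusp_expansion_average[OF a that])
  have fin: "finite {d. d dvd n}" using n by simp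
  have T: "hecke_op k n f z = of_nat n ^ k / of_nat n * (\<Sum>d | d dvd n. g d (of_nat (n div d) * z) / of_nat d ^ k)" for z
    using n by (simp add: hecke_op_def powi_int_minus_one g_def sum_divide_distrib)
  let ?z = "\<lambda>t. \<i> * of_real t :: complex"
  have "((\<lambda>t. \<Sum>d | d dvd n. (g d (of_nat (n div d) * ?z t) / qexp (?z t)) / of_nat d ^ k) \<longlongrightarrow>
      (\<Sum>d | d dvd n. (if d = n then of_nat n * a n else 0) / of_nat d ^ k)) at_top"
  proof (intro tendsto_sum tendsto_divide tendsto_const)
    fix d assume "d \<in> {d. d dvd n}"
    then have d: "d dvd n" "d > 0" using n by (auto intro: Nat.gr0I)
    show "((\<lambda>t. g d (of_nat (n div d) * ?z t) / qexp (?z t)) \<longlongrightarrow> (if d = n then of_nat n * a n else 0)) at_top"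
    proof (cases "d = n")
      case True
      then show ?thesis using tendsto_cusp_expansion_coeff1[OF g[OF d(2)]] n by simp
    next
      case False
      then have "n div d > 1" using d n by (metis One_nat_def Suc_lessI dvd_div_eq_0_iff dvd_mult_div_cancel gr0I mult.right_neutral not_one_le_zero)
      then show ?thesis using tendsto_cusp_expansion_scaled[OF g[OF d(2)]] False by simp
    qed
    show "of_nat d ^ k \<noteq> (0::complex)" using d by simp
  qed
  also have "(\<Sum>d | d dvd n. (if d = n then of_nat n * a n else 0) / of_nat d ^ k) =
     (\<Sum>d\<in>{n}. of_nat n * a n / of_nat d ^ k)"
    using fin by (intro sum.mono_neutral_cong_right) auto
  finally have "((\<lambda>t. of_nat n ^ k / of_nat n * (\<Sum>d | d dvd n. (g d (of_nat (n div d) * ?z t) / qexp (?z t)) / of_nat d ^ k)) \<longlongrightarrow>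
      of_nat n ^ k / of_nat n * (of_nat n * a n / of_nat n ^ k)) at_top"
    by (intro tendsto_mult tendsto_const) simp
  also have "of_nat n ^ k / of_nat n * (of_nat n * a n / of_nat n ^ k) = a n" using n by simp
  also have "(\<lambda>t. of_nat n ^ k / of_nat n * (\<Sum>d | d dvd n. (g d (of_nat (n div d) * ?z t) / qexp (?z t)) / of_nat d ^ k))
      = (\<lambda>t. hecke_op k n f (?z t) / qexp (?z t))"
    by (simp add: T sum_divide_distrib sum_distrib_left mult_ac)
  finally have lim1: "((\<lambda>t. hecke_op k n f (?z t) / qexp (?z t)) \<longlongrightarrow> a n) at_top" .
  have "((\<lambda>t. ev * (f (?z t) / qexp (?z t))) \<longlongrightarrow> ev * a 1) at_top"
    by (intro tendsto_mult tendsto_const tendsto_cusp_expansion_coeff1[OF a])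
  moreover have "eventually (\<lambda>t. ev * (f (?z t) / qexp (?z t)) = hecke_op k n f (?z t) / qexp (?z t)) at_top"
    using eventually_gt_at_top[of 0] by eventually_elim (simp add: ev)
  ultimately have "((\<lambda>t. hecke_op k n f (?z t) / qexp (?z t)) \<longlongrightarrow> ev * a 1) at_top"
    by (rule Lim_transform_eventually)
  then show ?thesis using lim1 by (intro tendsto_unique[OF _ _ lim1]) auto
qed

section \<open>Size of the Hecke eigenvalues\<close>

lemma norm_hecke_op_le:
  assumes M: "\<And>z. Im z > 0 \<Longrightarrow> pnorm k f z \<le> M" and n: "n \<ge> 1" and z: "Im z > 0"
  shows "norm (hecke_op k n f z) * sqrt (Im z) ^ k \<le> real n * sqrt n ^ k * M"
proof -
  define y where "y = Im z"
  have M0: "M \<ge> 0" using M[of \<i>] by (auto simp: pnorm_def intro: order_trans[OF _ M[of \<i>]])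
  let ?w = "\<lambda>d b. (of_nat (n div d) * z + of_nat b) / of_nat d :: complex"
  \<comment> \<open>The point \<open>?w d b\<close> has height n y / d^2, so its
    \<open>pnorm\<close> already contains the factor d^(-k), and all terms obey the same
    bound.\<close>
  have wle: "norm (f (?w d b) / of_nat d ^ k) * sqrt y ^ k \<le> M / sqrt n ^ k" if d: "d dvd n" for d b
  proof -
    have d0: "d > 0" using d n by (auto intro: Nat.gr0I)
    have y: "y > 0" using z by (simp add: y_def)
    have Imw: "Im (?w d b) = real n * y / real d ^ 2"
      using d0 d by (simp add: y_def Im_divide_of_nat real_of_nat_div power2_eq_square)
    then have Imw0: "Im (?w d b) > 0" using y n d0 by simp
    have "sqrt (Im (?w d b)) = sqrt n * sqrt y / d" using d0 by (simp only: Imw) (simp add: real_sqrt_divide real_sqrt_mult)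
    then have "pnorm k f (?w d b) = norm (f (?w d b)) / d ^ k * sqrt y ^ k * sqrt n ^ k"
      by (simp add: pnorm_def power_divide power_mult_distrib)
    then show ?thesis using M[OF Imw0] n by (simp add: norm_divide norm_power field_simps)
  qed
  have "norm (hecke_op k n f z) \<le> (real n ^ k / real n) * (\<Sum>d | d dvd n. \<Sum>b<d. norm (f (?w d b) / of_nat d ^ k))"
    using n unfolding hecke_op_def
    by (simp only: norm_mult powi_int_minus_one norm_divide norm_power norm_of_nat) (intro mult_left_mono sum_norm_le order_refl norm_sum order_trans[OF norm_sum] sum_mono, auto simp: norm_divide norm_power)
  then have "norm (hecke_op k n f z) * sqrt y ^ k \<le>
     (real n ^ k / real n) * (\<Sum>d | d dvd n. \<Sum>b<d. norm (f (?w d b) / of_nat d ^ k)) * sqrt y ^ k"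
    using z by (intro mult_right_mono) (auto simp: y_def)
  also have "\<dots> = (real n ^ k / real n) * (\<Sum>d | d dvd n. \<Sum>b<d. norm (f (?w d b) / of_nat d ^ k) * sqrt y ^ k)"
    by (simp only: sum_distrib_right mult.assoc)
  also have "\<dots> \<le> (real n ^ k / real n) * (\<Sum>d | d dvd n. \<Sum>b<d. M / sqrt n ^ k)"
    by (intro mult_left_mono sum_mono wle) auto
  also have "(\<Sum>d | d dvd n. \<Sum>b<d. M / sqrt n ^ k) = (\<Sum>d | d dvd n. real d) * (M / sqrt n ^ k)"
    by (simp add: sum_distrib_right sum_divide_distrib)
  also have "(\<Sum>d | d dvd n. real d) \<le> (\<Sum>d | d dvd n. real n)"
    using n by (intro sum_mono) (auto dest: dvd_imp_le)
  \<comment> \<open>At most n divisors, each at most n: this crude bound for sigma(n) produces the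
    exponent k/2 + 1.\<close>
  also have "(\<Sum>d | d dvd n. real n) \<le> real n * real n"
  proof -
    have "card {d. d dvd n} \<le> card {1..n}"
      using n by (intro card_mono) (auto dest: dvd_imp_le intro: Nat.gr0I simp: Suc_le_eq)
    then show ?thesis by (simp add: mult_right_mono)
  qed
  also have "(real n ^ k / real n) * (real n * real n * (M / sqrt n ^ k)) = real n * sqrt n ^ k * M"
  proof -
    have "real n ^ k = sqrt n ^ k * sqrt n ^ k" by (simp add: power_mult_distrib[symmetric])
    then show ?thesis using n by (simp add: field_simps)
  qed
  finally show ?thesis using M0 by (simp add: y_def mult_left_mono mult_right_mono divide_right_mono)
qed

lemma hecke_eigenvalue_bound:
  assumes f: "f \<in> cusp_forms k" and nz: "f \<noteq> (\<lambda>z. 0)" and n: "n \<ge> 1"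
    and ev: "\<And>z. Im z > 0 \<Longrightarrow> hecke_op k n f z = ev * f z"
  shows "norm ev \<le> real n * sqrt n ^ k"
proof -
  define M where "M = psup k f"
  have M: "pnorm k f z \<le> M" if "Im z > 0" for z
    unfolding M_def by (rule pnorm_le_psup[OF f that])
  obtain z0 where z0: "Im z0 > 0" "f z0 \<noteq> 0" using cusp_form_zero_offI[OF f] nz by blast
  have "M > 0" using M[OF z0(1)] z0 by (intro less_le_trans[OF _ M[OF z0(1)]]) (auto simp: pnorm_def)
  let ?K = "real n * sqrt n ^ k"
  have "norm ev * pnorm k f z \<le> ?K * M" if "Im z > 0" for z
    using norm_hecke_op_le[OF M n that] by (simp add: ev[OF that] norm_mult pnorm_def mult_ac)
  then have "pnorm k f z \<le> ?K * M / norm ev" if "Im z > 0" "ev \<noteq> 0" for z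
    using that by (simp add: field_simps)
  then have "M \<le> ?K * M / norm ev" if "ev \<noteq> 0"
    using that by (subst (1) M_def) (rule psup_le)
  with \<open>M > 0\<close> show ?thesis by (cases "ev = 0") (auto simp: field_simps)
qed

section \<open>Coset representatives for integer matrices of determinant \<open>n\<close>\<close>

definition Gam :: "imat set" where "Gam = {A. mdet A = 1}"

definition Del :: "nat \<Rightarrow> imat set" where "Del n = {A. mdet A = int n}"

text \<open>The Hermite normal forms of determinant n. They represent the left cosets of
  \<open>Gam\<close> in \<open>Del n\<close> and are the matrices occurring in
  \<open>hecke_op\<close>.\<close>

definition hecke_reps :: "nat \<Rightarrow> imat set" where
  "hecke_reps n = (\<lambda>(d, b). (int (n div d), int b, 0, int d)) ` (SIGMA d:{d. d dvd n}. {..<d})"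

lemma finite_hecke_reps: "n > 0 \<Longrightarrow> finite (hecke_reps n)"
  by (auto simp: hecke_reps_def)

lemma mdet_hecke_reps:
  assumes "\<alpha> \<in> hecke_reps n"
  shows "mdet \<alpha> = int n"
proof -
  obtain d b where "d dvd n" "\<alpha> = (int (n div d), int b, 0, int d)"
    using assms by (auto simp: hecke_reps_def)
  then show ?thesis by (simp flip: of_nat_mult)
qed

lemma inj_on_mmul_right:
  assumes "mdet B \<noteq> 0"
  shows "inj_on (\<lambda>A. mmul A B) X"
proof (rule inj_onI)
  fix A A' assume "mmul A B = mmul A' B"
  then have "mmul A (mmul B (madj B)) = mmul A' (mmul B (madj B))"
    by (simp flip: mmul_assoc)
  with assms show "A = A'" unfolding mmul_madj_right by (cases A; cases A') simp
qed

lemma Del_eq_UN_cosets: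
  assumes n: "n > 0"
  shows "Del n = (\<Union>\<alpha>\<in>hecke_reps n. (\<lambda>\<gamma>. mmul \<gamma> \<alpha>) ` Gam)"
proof (intro equalityI subsetI)
  fix A assume "A \<in> (\<Union>\<alpha>\<in>hecke_reps n. (\<lambda>\<gamma>. mmul \<gamma> \<alpha>) ` Gam)"
  then obtain \<alpha> \<gamma> where "\<alpha> \<in> hecke_reps n" "\<gamma> \<in> Gam" "A = mmul \<gamma> \<alpha>" by blast
  then show "A \<in> Del n" by (simp add: Del_def Gam_def mdet_mmul mdet_hecke_reps)
next
  fix A assume "A \<in> Del n"
  then obtain a b c d where A: "A = (a, b, c, d)" and det: "a * d - b * c = int n"
    by (cases A) (auto simp: Del_def)
  define g where "g = gcd a c"
  have "a \<noteq> 0 \<or> c \<noteq> 0" using det n by auto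
  then have g: "g > 0" by (auto simp: g_def)
  define a' c' where "a' = a div g" and "c' = c div g"
  have ac: "a = g * a'" "c = g * c'" by (simp_all add: a'_def c'_def g_def)
  have "coprime a' c'"
    unfolding a'_def c'_def g_def using \<open>a \<noteq> 0 \<or> c \<noteq> 0\<close> by (rule div_gcd_coprime)
  then obtain v u where vu: "v * a' + u * c' = 1"
    using bezout_int[of a' c'] by auto
  define B where "B = v * b + u * d"
  define D where "D = a' * d - c' * b"
  have gD: "g * D = int n" using det by (simp add: D_def ac algebra_simps)
  then have D: "D > 0" using g n by (metis of_nat_0_less_iff zero_less_mult_pos)
  define t where "t = B div D"
  have B: "B = t * D + B mod D" by (simp add: t_def)
  \<comment> \<open>The matrix with rows (v, u) and (-c', a') lies in \<open>Gam\<close> and brings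
    A to upper triangular form with rows (g, B) and (0, D). Here \<gamma> is its inverse followed by
    the shear by t, which reduces B modulo D.\<close>
  define \<gamma> where "\<gamma> = (a', a' * t - u, c', c' * t + v)"
  define \<alpha> where "\<alpha> = (g, B mod D, 0::int, D)"
  have \<gamma>: "\<gamma> \<in> Gam" using vu by (simp add: Gam_def \<gamma>_def algebra_simps)
  have "a' * B - u * D = b"
  proof -
    have "a' * B - u * D = (v * a' + u * c') * b" by (simp add: B_def D_def algebra_simps)
    then show ?thesis by (simp add: vu)
  qed
  moreover have "c' * B + v * D = d"
  proof -
    have "c' * B + v * D = (v * a' + u * c') * d" by (simp add: B_def D_def algebra_simps)
    then show ?thesis by (simp add: vu)
  qed
  moreover have "a' * (B mod D) + (a' * t - u) * D = a' * B - u * D"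
    "c' * (B mod D) + (c' * t + v) * D = c' * B + v * D"
    by (subst (2) B, simp only: algebra_simps)+
  ultimately have "A = mmul \<gamma> \<alpha>"
    by (simp add: A \<gamma>_def \<alpha>_def ac(1) ac(2) mult.commute[of g])
  moreover have "\<alpha> \<in> hecke_reps n"
  proof -
    have dvd: "nat D dvd n" using gD D by (metis dvd_triv_right int_dvd_int_iff int_nat_eq less_imp_le)
    have "g = int (n div nat D)" using gD D by (metis int_nat_eq less_imp_le mult.commute nonzero_mult_div_cancel_left of_nat_div order_less_irrefl)
    moreover have "B mod D = int (nat (B mod D))" "nat (B mod D) < nat D" using D by auto
    ultimately show ?thesis
      using D dvd unfolding hecke_reps_def \<alpha>_def
      by (intro image_eqI[where x = "(nat D, nat (B mod D))"]) auto
  qed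
  ultimately show "A \<in> (\<Union>\<alpha>\<in>hecke_reps n. (\<lambda>\<gamma>. mmul \<gamma> \<alpha>) ` Gam)" using \<gamma> by blast
qed

lemma hecke_reps_cosets_disjoint:
  assumes n: "n > 0" and "\<alpha> \<in> hecke_reps n" "\<beta> \<in> hecke_reps n" "\<alpha> \<noteq> \<beta>"
  shows "(\<lambda>\<gamma>. mmul \<gamma> \<alpha>) ` Gam \<inter> (\<lambda>\<gamma>. mmul \<gamma> \<beta>) ` Gam = {}"
proof (rule ccontr)
  assume "\<not> ?thesis"
  then obtain \<gamma> \<delta> where gd: "\<gamma> \<in> Gam" "\<delta> \<in> Gam" "mmul \<gamma> \<alpha> = mmul \<delta> \<beta>" by blast
  \<comment> \<open>\<epsilon> carries \<alpha> to \<beta>. Both are upper triangular with positive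
    diagonal, so \<epsilon> turns out to be a shear, and a shear changes the upper right entry only
    by a multiple of d.\<close>
  define \<epsilon> where "\<epsilon> = mmul (madj \<delta>) \<gamma>"
  have "mmul \<epsilon> \<alpha> = mmul (madj \<delta>) (mmul \<delta> \<beta>)" by (simp add: \<epsilon>_def mmul_assoc gd(3))
  also have "\<dots> = \<beta>" using gd(2) by (simp flip: mmul_assoc add: mmul_madj_left Gam_def)
  finally have eq: "mmul \<epsilon> \<alpha> = \<beta>" .
  obtain d b where d: "d dvd n" "b < d" "\<alpha> = (int (n div d), int b, 0, int d)"
    using assms by (auto simp: hecke_reps_def)
  obtain d' b' where d': "d' dvd n" "b' < d'" "\<beta> = (int (n div d'), int b', 0, int d')"
    using assms by (auto simp: hecke_reps_def)
  obtain p q r s where e: "\<epsilon> = (p, q, r, s)" by (cases \<epsilon>) auto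
  have pos: "n div d > 0" "n div d' > 0" using d d' n by (auto simp: dvd_div_eq_0_iff intro: Nat.gr0I)
  have r: "r = 0" using eq pos by (auto simp: e d d')
  have "mdet \<epsilon> = 1" using gd by (simp add: \<epsilon>_def mdet_mmul Gam_def)
  then have ps: "p * s = 1" by (simp add: e r)
  have "p * int (n div d) = int (n div d')" using eq by (simp add: e d d' r)
  then have "p > 0" using pos by (metis of_nat_0_less_iff zero_less_mult_pos2)
  then have p: "p = 1" "s = 1" using ps by (auto simp: zmult_eq_1_iff)
  have dd: "d = d'" using eq by (simp add: e d d' p r)
  then have "int b' = int b + q * int d" using eq by (simp add: e d d' p)
  then have "int b' mod int d = int b mod int d" by simp
  then have "b = b'" using d(2) d'(2) dd by (simp add: zmod_int[symmetric])
  with dd d d' assms(4) show False by simp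
qed

lemma hecke_op_eq_sum_reps:
  assumes "n > 0"
  shows "hecke_op k n f z = of_nat n ^ k / of_nat n * (\<Sum>\<alpha>\<in>hecke_reps n. f (mob \<alpha> z) / jac \<alpha> z ^ k)"
proof -
  have inj: "inj_on (\<lambda>(d, b). (int (n div d), int b, 0 :: int, int d)) (SIGMA d:{d. d dvd n}. {..<d})"
    by (auto simp: inj_on_def)
  have "(\<Sum>\<alpha>\<in>hecke_reps n. f (mob \<alpha> z) / jac \<alpha> z ^ k) =
     (\<Sum>(d, b)\<in>(SIGMA d:{d. d dvd n}. {..<d}). f ((of_nat (n div d) * z + of_nat b) / of_nat d) / of_nat d ^ k)"
    unfolding hecke_reps_def by (subst sum.reindex[OF inj]) (auto simp: case_prod_unfold)
  also have "\<dots> = (\<Sum>d | d dvd n. \<Sum>b<d. f ((of_nat (n div d) * z + of_nat b) / of_nat d) / of_nat d ^ k)"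
    using assms by (subst sum.Sigma) auto
  finally show ?thesis using assms by (simp add: hecke_op_def powi_int_minus_one)
qed

section \<open>The hyperbolic measure\<close>

abbreviation vcx :: "real ^ 2 \<Rightarrow> complex" where "vcx x \<equiv> Complex (x $ 1) (x $ 2)"

definition hyp_density :: "real ^ 2 \<Rightarrow> real" where
  "hyp_density x = (if x $ 2 > 0 then 1 / (x $ 2) ^ 2 else 0)"

text \<open>The library's change of variables theorem lives on \<open>real ^ n\<close>, hence the detour through
  \<open>real ^ 2\<close>.\<close>

definition hyp_measure :: "complex measure" where
  "hyp_measure = distr (density lborel (\<lambda>x. ennreal (hyp_density x))) borel vcx"

lemma continuous_on_vcx: "continuous_on A (\<lambda>x::real^2. vcx x)"
proof -
  have eq: "vcx x = of_real (x $ 1) + \<i> * of_real (x $ 2)" for x :: "real ^ 2"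
    by (simp add: complex_eq_iff)
  show ?thesis unfolding eq by (intro continuous_intros)
qed

lemma measurable_vcx [measurable]: "(\<lambda>x::real^2. vcx x) \<in> borel_measurable borel"
  by (rule borel_measurable_continuous_onI) (rule continuous_on_vcx)

lemma measurable_hyp_density [measurable]: "hyp_density \<in> borel_measurable borel"
  unfolding hyp_density_def by measurable

lemma hyp_density_nonneg: "hyp_density x \<ge> 0"
  by (simp add: hyp_density_def)

lemma sets_hyp_measure [measurable_cong, simp]: "sets hyp_measure = sets borel"
  by (simp add: hyp_measure_def)

lemma space_hyp_measure [simp]: "space hyp_measure = UNIV"
  by (simp add: hyp_measure_def)

lemma AE_hyp_measure:
  assumes [measurable]: "Measurable.pred borel P"
  shows "(AE z in hyp_measure. P z) \<longleftrightarrow> (AE x in lborel. x $ 2 > 0 \<longrightarrow> P (vcx x))"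
proof -
  have "(AE z in hyp_measure. P z) \<longleftrightarrow> (AE x in density lborel (\<lambda>x. ennreal (hyp_density x)). P (vcx x))"
    unfolding hyp_measure_def by (rule AE_distr_iff) simp_all
  also have "\<dots> \<longleftrightarrow> (AE x in lborel. 0 < ennreal (hyp_density x) \<longrightarrow> P (vcx x))"
    by (rule AE_density) simp
  finally show ?thesis by (simp add: hyp_density_def)
qed

lemma AE_hyp_measure_Im_pos: "AE z in hyp_measure. Im z > 0"
  by (subst AE_hyp_measure) auto

lemma integrable_hyp_measure_iff:
  fixes h :: "complex \<Rightarrow> real"
  assumes [measurable]: "h \<in> borel_measurable borel"
  shows "integrable hyp_measure h \<longleftrightarrow> (\<lambda>x. h (vcx x) / (x $ 2) ^ 2) absolutely_integrable_on {x. x $ 2 > 0}" (is "_ \<longleftrightarrow> ?R")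
    and "integral\<^sup>L hyp_measure h = (\<integral>x. indicator {x. x $ 2 > 0} x *\<^sub>R (h (vcx x) / (x $ 2) ^ 2) \<partial>lebesgue)"
proof -
  have eq: "hyp_density x *\<^sub>R h (vcx x) = indicator {x. x $ 2 > 0} x *\<^sub>R (h (vcx x) / (x $ 2) ^ 2)" for x
    by (simp add: hyp_density_def)
  have m: "(\<lambda>x. indicator {x. x $ 2 > 0} x *\<^sub>R (h (vcx x) / (x $ 2) ^ 2)) \<in> borel_measurable lborel"
    unfolding eq[symmetric] by measurable
  show "integrable hyp_measure h \<longleftrightarrow> ?R"
    unfolding hyp_measure_def set_integrable_def using m hyp_density_nonneg
    by (subst integrable_distr_eq, simp, simp, subst integrable_density, simp, simp, simp)
       (simp only: eq integrable_completion)
  show "integral\<^sup>L hyp_measure h = (\<integral>x. indicator {x. x $ 2 > 0} x *\<^sub>R (h (vcx x) / (x $ 2) ^ 2) \<partial>lebesgue)"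
    unfolding hyp_measure_def using m hyp_density_nonneg
    by (subst integral_distr, simp, simp, subst integral_density, simp, simp, simp)
       (simp only: eq integral_completion)
qed

lemma measurable_mob [measurable]: "mob A \<in> borel_measurable borel"
proof (cases A)
  case (fields a b c d)
  have "mob A = (\<lambda>z. (of_int a * z + of_int b) / (of_int c * z + of_int d))"
    by (simp add: fields fun_eq_iff)
  then show ?thesis by simp
qed

lemma measurable_jac [measurable]: "jac A \<in> borel_measurable borel"
proof (cases A)
  case (fields a b c d)
  have "jac A = (\<lambda>z. of_int c * z + of_int d)"
    by (simp add: fields fun_eq_iff)
  then show ?thesis by simp
qed

definition cvec :: "complex \<Rightarrow> real ^ 2" where
  "cvec z = (\<chi> i. if i = 1 then Re z else Im z)"

lemma vcx_cvec [simp]: "vcx (cvec z) = z"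
  by (simp add: cvec_def complex_eq_iff)

lemma cvec_vcx [simp]: "cvec (vcx x) = x"
  by (simp add: cvec_def vec_eq_iff forall_2)

lemma cvec_nth [simp]: "cvec z $ 1 = Re z" "cvec z $ 2 = Im z"
  by (simp_all add: cvec_def)

lemma bounded_linear_vcx: "bounded_linear (\<lambda>x::real^2. vcx x)"
  by (intro linear_conv_bounded_linear[THEN iffD1] linearI) (auto simp: complex_eq_iff)

lemma bounded_linear_cvec: "bounded_linear cvec"
  by (intro linear_conv_bounded_linear[THEN iffD1] linearI) (auto simp: vec_eq_iff forall_2)

lemma mob_has_field_derivative:
  assumes "mdet A > 0" "Im z > 0"
  shows "(mob A has_field_derivative (of_int (mdet A) / jac A z ^ 2)) (at z)"
proof (cases A)
  case (fields a b c d)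
  have eq: "mob A = (\<lambda>z. (of_int a * z + of_int b) / (of_int c * z + of_int d))"
    by (simp add: fields fun_eq_iff)
  have nz: "of_int c * z + of_int d \<noteq> 0" using jac_nonzero[of A z] assms by (simp add: fields)
  have num: "of_int a * (of_int c * z + of_int d) - (of_int a * z + of_int b) * of_int c = (of_int (mdet A) :: complex)"
    by (simp add: fields algebra_simps)
  have "((\<lambda>z. (of_int a * z + of_int b) / (of_int c * z + of_int d)) has_field_derivative
      (of_int a * (of_int c * z + of_int d) - (of_int a * z + of_int b) * of_int c) /
      ((of_int c * z + of_int d) * (of_int c * z + of_int d))) (at z)"
    using nz by (auto intro!: derivative_eq_intros)
  then show ?thesis by (simp add: eq num) (simp add: fields power2_eq_square)
qed

text \<open>The derivative of \<open>mob A\<close> has modulus det A / |c z + d|^2, the same factor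
  by which the imaginary part scales. The real Jacobian is its square, which cancels against the
  density y^(-2).\<close>

lemma hyp_measure_invariant:
  fixes h :: "complex \<Rightarrow> real"
  assumes [measurable]: "h \<in> borel_measurable borel" and A: "mdet A > 0"
    and int: "integrable hyp_measure h"
  shows "integrable hyp_measure (\<lambda>z. h (mob A z))"
    and "(\<integral>z. h (mob A z) \<partial>hyp_measure) = integral\<^sup>L hyp_measure h"
proof -
  define h' where "h' = (\<lambda>z. h (mob A z))"
  define U where "U = {x::real^2. x $ 2 > 0}"
  define g where "g = (\<lambda>x. cvec (mob A (vcx x)))"
  define D where "D = (\<lambda>x. of_int (mdet A) / jac A (vcx x) ^ 2)"
  define g' where "g' = (\<lambda>x y. cvec (D x * vcx y))"
  define F where "F = (\<lambda>h x. (h (vcx x) / (x $ 2) ^ 2) :: real)"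
  \<comment> \<open>The change of variables theorem takes integrands with values in
    \<open>real ^ n\<close>; real values are wrapped as \<open>real ^ 1\<close>.\<close>
  define V where "V = (\<lambda>h x. (vec (F h x)) :: real ^ 1)"
  have "open U" unfolding U_def by (intro open_Collect_less continuous_intros)
  then have Ul: "U \<in> sets lebesgue" by (simp add: borel_open sets_completionI_sets)
  have der: "(g has_derivative g' x) (at x within U)" if "x \<in> U" for x
  proof -
    have "(mob A has_derivative (*) (D x)) (at (vcx x))"
      using mob_has_field_derivative[OF A, of "vcx x"] that
      by (simp add: U_def D_def has_field_derivative_def)
    then have "((\<lambda>x. mob A (vcx x)) has_derivative (\<lambda>y. D x * vcx y)) (at x within U)"
      by (rule has_derivative_compose[rotated]) (rule bounded_linear_imp_has_derivative[OF bounded_linear_vcx])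
    then show ?thesis unfolding g_def g'_def by (rule bounded_linear.has_derivative[OF bounded_linear_cvec])
  qed
  have U_iff: "x \<in> U \<longleftrightarrow> Im (vcx x) > 0" for x by (simp add: U_def)
  have gU: "g x \<in> U" if "x \<in> U" for x
    unfolding U_iff g_def vcx_cvec by (rule Im_mob_pos[OF that[unfolded U_iff] A])
  have inj: "inj_on g U"
  proof (rule inj_onI)
    fix x y assume xy: "x \<in> U" "y \<in> U" "g x = g y"
    have "vcx (g x) = vcx (g y)" by (simp only: xy(3))
    then have "mob A (vcx x) = mob A (vcx y)" by (simp only: g_def vcx_cvec)
    then have "mob (madj A) (mob A (vcx x)) = mob (madj A) (mob A (vcx y))" by (rule arg_cong)
    then have "vcx x = vcx y"
      by (simp only: mob_madj_mob[OF xy(1)[unfolded U_iff] A] mob_madj_mob[OF xy(2)[unfolded U_iff] A])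
    then have "cvec (vcx x) = cvec (vcx y)" by (rule arg_cong)
    then show "x = y" by (simp only: cvec_vcx)
  qed
  have img: "g ` U = U"
  proof
    show "g ` U \<subseteq> U" using gU by blast
    show "U \<subseteq> g ` U"
    proof
      fix x assume x: "x \<in> U"
      have A': "mdet (madj A) > 0" using A by simp
      have "cvec (mob (madj A) (vcx x)) \<in> U"
        unfolding U_iff vcx_cvec by (rule Im_mob_pos[OF x[unfolded U_iff] A'])
      moreover have "x = g (cvec (mob (madj A) (vcx x)))"
        unfolding g_def vcx_cvec mob_mob_madj[OF x[unfolded U_iff] A] by (rule cvec_vcx[symmetric])
      ultimately show "x \<in> g ` U" by (rule rev_image_eqI)
    qed
  qed
  have det: "det (matrix (g' x)) = norm (D x) ^ 2" for x
    unfolding cmod_power2 by (simp add: det_2 matrix_def g'_def axis_def power2_eq_square)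
  have eq: "\<bar>det (matrix (g' x))\<bar> *\<^sub>R V h (g x) = V h' x" if "x \<in> U" for x
  proof -
    have x: "x $ 2 > 0" using that by (simp add: U_def)
    have nz: "norm (jac A (vcx x)) > 0" using jac_nonzero[of A "vcx x"] A x by simp
    have I: "Im (mob A (vcx x)) = of_int (mdet A) * x $ 2 / norm (jac A (vcx x)) ^ 2"
      using Im_mob[of "vcx x" A] x by simp
    moreover have r: "norm (D x) = of_int (mdet A) / norm (jac A (vcx x)) ^ 2"
      using A by (simp add: D_def norm_divide norm_power)
    ultimately have "Im (mob A (vcx x)) = norm (D x) * x $ 2" by simp
    moreover have "norm (D x) > 0" unfolding r using A nz by simp
    ultimately have "norm (D x) ^ 2 * F h (g x) = F h' x"
      using x by (simp only: F_def g_def vcx_cvec h'_def) (simp add: power_mult_distrib)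
    then show ?thesis by (simp add: V_def det vec_eq_iff)
  qed
  have VF: "V h absolutely_integrable_on U \<longleftrightarrow> F h absolutely_integrable_on U" for h
    by (simp add: absolutely_integrable_on_1_iff V_def)
  have abs: "F h absolutely_integrable_on U"
    using int integrable_hyp_measure_iff(1)[of h] by (simp add: U_def F_def)
  let ?T = "\<lambda>x. \<bar>det (matrix (g' x))\<bar> *\<^sub>R V h (g x)"
  have key: "?T absolutely_integrable_on U \<and>
      integral U ?T = integral U (V h)"
    using has_absolute_integral_change_of_variables[OF Ul der inj, of "V h" "integral U (V h)"] abs
    by (simp add: img VF)
  have "V h' absolutely_integrable_on U \<longleftrightarrow>
      ?T absolutely_integrable_on U"
    by (rule set_integrable_cong[OF refl refl]) (rule eq[symmetric])
  with key have abs': "F h' absolutely_integrable_on U" by (simp add: VF)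
  have "integral U (V h') = integral U ?T"
    by (rule integral_cong) (rule eq[symmetric])
  also have "\<dots> = integral U (V h)" using key by blast
  finally have "integral U (F h') = integral U (F h)"
    using abs abs' by (simp add: integral_on_1_eq V_def)
  then have "(LINT x:U|lebesgue. F h' x) = (LINT x:U|lebesgue. F h x)"
    using abs abs' by (simp add: set_lebesgue_integral_eq_integral(2))
  then show "(\<integral>z. h (mob A z) \<partial>hyp_measure) = integral\<^sup>L hyp_measure h"
    by (simp add: integrable_hyp_measure_iff(2) set_lebesgue_integral_def U_def F_def h'_def)
  show "integrable hyp_measure (\<lambda>z. h (mob A z))"
    using abs' by (subst integrable_hyp_measure_iff(1)) (simp_all add: U_def F_def h'_def)
qed

text \<open>Exchange of sum and integral for the unfolding step. As the weights sum to 1, every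
  partial sum of |p_i G| is dominated by |G|, which gives absolute summability and hence an
  unordered sum.\<close>

lemma has_sum_integral_weights:
  fixes p :: "'i \<Rightarrow> 'a \<Rightarrow> real"
  assumes I: "countable I" "infinite I"
    and meas [measurable]: "\<And>i. i \<in> I \<Longrightarrow> p i \<in> borel_measurable M"
    and G: "integrable M G"
    and nonneg: "\<And>i x. i \<in> I \<Longrightarrow> p i x \<ge> 0"
    and sum1: "AE x in M. ((\<lambda>i. p i x) has_sum 1) I"
  shows "((\<lambda>i. \<integral>x. p i x * G x \<partial>M) has_sum (\<integral>x. G x \<partial>M)) I"
proof -
  define e where "e = from_nat_into I"
  have e: "bij_betw e UNIV I" unfolding e_def by (rule bij_betw_from_nat_into[OF I])
  have eI: "e n \<in> I" for n using e by (auto simp: bij_betw_def)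
  define F where "F = (\<lambda>n x. p (e n) x * G x)"
  have sums1: "AE x in M. (\<lambda>n. p (e n) x) sums 1"
    using sum1
  proof eventually_elim
    case (elim x)
    then have "((\<lambda>n. p (e n) x) has_sum 1) UNIV" by (subst has_sum_reindex_bij_betw[OF e])
    then show ?case by (rule has_sum_imp_sums)
  qed
  have [measurable]: "G \<in> borel_measurable M" using G by auto
  have [measurable]: "p (e n) \<in> borel_measurable M" for n by (rule meas[OF eI])
  have part: "AE x in M. (\<Sum>n<N. p (e n) x) \<le> 1" for N
    using sums1
  proof eventually_elim
    case (elim x)
    have "(\<Sum>n<N. p (e n) x) \<le> (\<Sum>n. p (e n) x)"
      using sums_summable[OF elim] nonneg[OF eI] by (intro sum_le_suminf) auto
    then show ?case using sums_unique[OF elim] by simp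
  qed
  have le1: "AE x in M. p (e n) x \<le> 1" for n
    using part[of "Suc n"]
  proof eventually_elim
    case (elim x)
    have "(\<Sum>n<n. p (e n) x) \<ge> 0" by (intro sum_nonneg nonneg eI)
    with elim show ?case by simp
  qed
  have int: "integrable M (F n)" for n
  proof (rule Bochner_Integration.integrable_bound[OF G])
    show "AE x in M. norm (F n x) \<le> norm (G x)"
      using le1[of n]
    proof eventually_elim
      case (elim x)
      then show ?case
        using nonneg[OF eI, of n x] mult_right_mono[OF elim, of "\<bar>G x\<bar>"] by (simp add: F_def abs_mult)
    qed
  qed (simp add: F_def)
  have bound: "(\<Sum>n<N. \<integral>x. norm (F n x) \<partial>M) \<le> (\<integral>x. norm (G x) \<partial>M)" for N
  proof -
    have "(\<Sum>n<N. \<integral>x. norm (F n x) \<partial>M) = (\<integral>x. (\<Sum>n<N. norm (F n x)) \<partial>M)"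
      using int by (subst Bochner_Integration.integral_sum) auto
    also have "\<dots> \<le> (\<integral>x. norm (G x) \<partial>M)"
    proof (rule integral_mono_AE)
      show "AE x in M. (\<Sum>n<N. norm (F n x)) \<le> norm (G x)"
        using part[of N]
      proof eventually_elim
        case (elim x)
        have "(\<Sum>n<N. norm (F n x)) = (\<Sum>n<N. p (e n) x) * norm (G x)"
          using nonneg[OF eI] by (simp add: F_def abs_mult sum_distrib_right)
        also have "\<dots> \<le> 1 * norm (G x)" using elim by (intro mult_right_mono) auto
        finally show ?case by simp
      qed
    qed (use int G in auto)
    finally show ?thesis .
  qed
  have summ: "summable (\<lambda>n. \<integral>x. norm (F n x) \<partial>M)"
    by (rule summableI_nonneg_bounded[OF _ bound]) auto
  have "(\<lambda>n. integral\<^sup>L M (F n)) sums (\<integral>x. (\<Sum>n. F n x) \<partial>M)"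
  proof (rule sums_integral[OF int _ summ])
    show "AE x in M. summable (\<lambda>n. norm (F n x))"
      using sums1
    proof eventually_elim
      case (elim x)
      have "norm (F n x) = p (e n) x * \<bar>G x\<bar>" for n
        using nonneg[OF eI] by (simp add: F_def abs_mult)
      then show ?case using sums_summable[OF elim] by (simp add: summable_mult2)
    qed
  qed
  also have "(\<integral>x. (\<Sum>n. F n x) \<partial>M) = (\<integral>x. G x \<partial>M)"
  proof (rule integral_cong_AE)
    show "AE x in M. (\<Sum>n. F n x) = G x"
      using sums1
    proof eventually_elim
      case (elim x)
      show ?case using sums_unique[OF sums_mult2[OF elim, of "G x"]] by (simp add: F_def)
    qed
  qed (auto simp: F_def)
  finally have "(\<lambda>n. integral\<^sup>L M (F n)) sums (\<integral>x. G x \<partial>M)" .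
  moreover have "summable (\<lambda>n. norm (integral\<^sup>L M (F n)))"
    by (rule summable_comparison_test'[OF summ, of 0]) (simp add: integral_norm_bound)
  ultimately have "((\<lambda>n. integral\<^sup>L M (F n)) has_sum (\<integral>x. G x \<partial>M)) UNIV"
    by (intro norm_summable_imp_has_sum)
  then show ?thesis unfolding F_def by (subst has_sum_reindex_bij_betw[OF e, symmetric])
qed

section \<open>A partition of unity for the modular group\<close>

text \<open>A Siegel set, with the constants of \<open>exists_Siegel_representative\<close>. It
  meets every orbit, possibly more than once; the multiplicity is divided out in
  \<open>pou\<close>.\<close>

definition Sieg :: "complex set" where "Sieg = {z. Im z \<ge> 1/5 \<and> \<bar>Re z\<bar> \<le> 1/2}"

lemma measurable_Sieg [measurable]: "Sieg \<in> sets borel"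
proof -
  have "closed {z. Im z \<ge> 1/5}" "closed {z. \<bar>Re z\<bar> \<le> 1/2}"
    by (intro closed_Collect_le continuous_intros)+
  moreover have "Sieg = {z. Im z \<ge> 1/5} \<inter> {z. \<bar>Re z\<bar> \<le> 1/2}" by (auto simp: Sieg_def)
  ultimately show ?thesis by (metis borel_closed closed_Int)
qed

lemma int_linear_form_bound:
  assumes z: "Im z > 0" and le: "norm (of_int c * z + of_int d) \<le> K"
  shows "\<bar>of_int c\<bar> \<le> K / Im z" "\<bar>of_int d\<bar> \<le> K + K / Im z * norm z"
proof -
  have "\<bar>of_int c\<bar> * Im z \<le> K"
    using abs_Im_le_cmod[of "of_int c * z + of_int d"] le z by (simp add: abs_mult)
  then show c: "\<bar>of_int c\<bar> \<le> K / Im z" using z by (simp add: field_simps)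
  have "\<bar>real_of_int d\<bar> = norm ((of_int c * z + of_int d) - of_int c * z)" by simp
  also have "\<dots> \<le> norm (of_int c * z + of_int d) + norm (of_int c * z)" by (rule norm_triangle_ineq4)
  also have "norm (of_int c * z) \<le> K / Im z * norm z"
    using mult_right_mono[OF c, of "norm z"] by (simp add: norm_mult)
  finally show "\<bar>of_int d\<bar> \<le> K + K / Im z * norm z" using le by simp
qed

text \<open>A height of at least 1/5 for the image bounds |c z + d| from above, hence c and d. Since
  (c, d) is a nonzero integer vector, |c z + d| is also at least min y 1, so the image has bounded
  height and bounded modulus; multiplying by |c z + d| bounds |a z + b|, hence a and b.\<close>

lemma finite_Gam_Sieg:
  assumes z: "Im z > 0"
  shows "finite {A \<in> Gam. mob A z \<in> Sieg}"
proof -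
  define y where "y = Im z"
  have y: "y > 0" using z by (simp add: y_def)
  define m where "m = min y 1"
  have m: "m > 0" "m \<le> y" "m \<le> 1" using y by (auto simp: m_def)
  define J where "J = sqrt (5 * y)"
  define K where "K = (1/2 + y / m ^ 2) * J"
  define L where "L = max (J + J / y * norm z + J / y) (K + K / y * norm z + K / y)"
  define B where "B = \<lceil>L\<rceil>"
  have J: "J > 0" using y by (simp add: J_def)
  have K: "K > 0" using y J by (simp add: K_def add_pos_nonneg)
  have in_B: "t \<in> {-B..B}" if "\<bar>real_of_int t\<bar> \<le> L" for t
    using that unfolding B_def by (simp add: abs_le_iff le_ceiling_iff) linarith
  have "{A \<in> Gam. mob A z \<in> Sieg} \<subseteq> {-B..B} \<times> {-B..B} \<times> {-B..B} \<times> {-B..B}"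
  proof
    fix A assume "A \<in> {A \<in> Gam. mob A z \<in> Sieg}"
    then have det: "mdet A = 1" and S: "mob A z \<in> Sieg" by (auto simp: Gam_def)
    obtain a b c d where A: "A = (a, b, c, d)" by (cases A) auto
    have nz: "jac A z \<noteq> 0" using jac_nonzero[of A z] det z by simp
    have Im: "Im (mob A z) = y / norm (jac A z) ^ 2" using Im_mob[OF z, of A] det by (simp add: y_def)
    have "1 / 5 \<le> y / norm (jac A z) ^ 2" using S by (simp add: Sieg_def Im[symmetric])
    then have "norm (jac A z) ^ 2 \<le> 5 * y" using nz by (simp add: field_simps)
    then have jJ: "norm (jac A z) \<le> J" unfolding J_def by (rule real_le_rsqrt)
    then have "norm (of_int c * z + of_int d) \<le> J" by (simp add: A)
    note cd = int_linear_form_bound[OF z this]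
    have jm: "m \<le> norm (jac A z)"
    proof (cases "c = 0")
      case True
      then have "d \<noteq> 0" using det by (auto simp: A)
      then have "1 \<le> \<bar>real_of_int d\<bar>" by linarith
      then show ?thesis using True m by (simp add: A)
    next
      case False
      then have "1 \<le> \<bar>real_of_int c\<bar>" by linarith
      then have "1 * y \<le> \<bar>real_of_int c\<bar> * y" using y by (intro mult_right_mono) auto
      also have "\<dots> \<le> norm (jac A z)"
        using abs_Im_le_cmod[of "jac A z"] y by (simp add: A abs_mult y_def)
      finally show ?thesis using m by simp
    qed
    have "y / norm (jac A z) ^ 2 \<le> y / m ^ 2"
      using jm m y nz by (intro divide_left_mono power_mono mult_pos_pos zero_less_power) auto
    then have "norm (mob A z) \<le> 1/2 + y / m ^ 2"
      using S cmod_le[of "mob A z"] y nz by (simp add: Sieg_def Im)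
    then have "norm (mob A z) * norm (jac A z) \<le> K"
      unfolding K_def using jJ y by (intro mult_mono) auto
    moreover have "mob A z * jac A z = of_int a * z + of_int b" using nz by (simp add: A)
    ultimately have "norm (of_int a * z + of_int b) \<le> K" by (metis norm_mult)
    note ab = int_linear_form_bound[OF z this]
    have "J / y \<ge> 0" "K / y \<ge> 0" "J / y * norm z \<ge> 0" "K / y * norm z \<ge> 0" using J K y by simp_all
    then have "\<bar>of_int a\<bar> \<le> L" "\<bar>of_int b\<bar> \<le> L" "\<bar>of_int c\<bar> \<le> L" "\<bar>of_int d\<bar> \<le> L"
      using ab cd J K unfolding L_def y_def[symmetric] le_max_iff_disj by linarith+
    then show "A \<in> {-B..B} \<times> {-B..B} \<times> {-B..B} \<times> {-B..B}"
      unfolding A by (intro SigmaI in_B)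
  qed
  then show ?thesis by (rule finite_subset) auto
qed

definition orbit_count :: "complex \<Rightarrow> real" where
  "orbit_count z = (\<Sum>\<^sub>\<infinity>A\<in>Gam. indicator Sieg (mob A z))"

lemma orbit_count:
  assumes "Im z > 0"
  shows "((\<lambda>A. indicator Sieg (mob A z)) has_sum orbit_count z) Gam" "orbit_count z \<ge> 1"
proof -
  define F where "F = {A \<in> Gam. mob A z \<in> Sieg}"
  have F: "finite F" unfolding F_def by (rule finite_Gam_Sieg[OF assms])
  have hs: "((\<lambda>A. indicator Sieg (mob A z)) has_sum (\<Sum>A\<in>F. indicator Sieg (mob A z) :: real)) Gam"
    by (rule has_sum_finite_neutralI[OF F]) (auto simp: F_def indicator_def)
  then have eq: "orbit_count z = (\<Sum>A\<in>F. indicator Sieg (mob A z))"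
    unfolding orbit_count_def by (rule infsumI)
  with hs show "((\<lambda>A. indicator Sieg (mob A z)) has_sum orbit_count z) Gam" by simp
  obtain A where "mdet A = 1" "Im (mob A z) \<ge> 1/5" "\<bar>Re (mob A z)\<bar> \<le> 1/2"
    by (rule exists_Siegel_representative[OF assms])
  then have "A \<in> F" by (simp add: F_def Gam_def Sieg_def)
  then have "card F \<noteq> 0" using F by auto
  moreover have "orbit_count z = card F" unfolding eq by (simp add: F_def indicator_def)
  ultimately show "orbit_count z \<ge> 1" by linarith
qed

lemma bij_betw_Gam_mmul:
  assumes "B \<in> Gam"
  shows "bij_betw (\<lambda>A. mmul A B) Gam Gam"
proof (rule bij_betw_byWitness[where f' = "\<lambda>A. mmul A (madj B)"])
  have B: "mdet B = 1" using assms by (simp add: Gam_def)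
  show "\<forall>A\<in>Gam. mmul (mmul A B) (madj B) = A"
    by (simp add: mmul_assoc mmul_madj_right B)
  show "\<forall>A\<in>Gam. mmul (mmul A (madj B)) B = A"
    by (simp add: mmul_assoc mmul_madj_left B)
  show "(\<lambda>A. mmul A B) ` Gam \<subseteq> Gam" "(\<lambda>A. mmul A (madj B)) ` Gam \<subseteq> Gam"
    using B by (auto simp: Gam_def mdet_mmul simp del: mmul.simps madj.simps mdet.simps split_paired_All)
qed

lemma orbit_count_mob:
  assumes z: "Im z > 0" and B: "B \<in> Gam"
  shows "orbit_count (mob B z) = orbit_count z"
proof -
  have eq: "mob (mmul A B) z = mob A (mob B z)" for A
    using mob_mmul[OF z] B by (simp add: Gam_def)
  have "orbit_count (mob B z) = (\<Sum>\<^sub>\<infinity>A\<in>Gam. indicator Sieg (mob (mmul A B) z))"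
    by (simp add: orbit_count_def eq)
  also have "\<dots> = orbit_count z"
    unfolding orbit_count_def by (rule infsum_reindex_bij_betw[OF bij_betw_Gam_mmul[OF B]])
  finally show ?thesis .
qed

text \<open>The orbit count is at least 1 on the upper half plane and invariant under
  \<open>Gam\<close>, so the translates of this function sum to 1. Both A and -A are counted, here
  and in every later sum over \<open>Gam\<close>.\<close>

definition pou :: "complex \<Rightarrow> real" where
  "pou z = (if Im z > 0 then indicator Sieg z / orbit_count z else 0)"

lemma infinite_Gam: "infinite Gam"
proof -
  have "infinite (range (\<lambda>n::nat. (1::int, int n, 0::int, 1::int)))"
    by (intro range_inj_infinite injI) simp
  moreover have "range (\<lambda>n::nat. (1::int, int n, 0::int, 1::int)) \<subseteq> Gam" by (auto simp: Gam_def)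
  ultimately show ?thesis using finite_subset by blast
qed

text \<open>Enumerating \<open>Gam\<close> turns the orbit count into a countable series of
  measurable functions.\<close>

lemma measurable_pou [measurable]: "pou \<in> borel_measurable borel"
proof -
  define e where "e = from_nat_into Gam"
  have e: "bij_betw e UNIV Gam"
    unfolding e_def by (rule bij_betw_from_nat_into) (use infinite_Gam in auto)
  have "pou = (\<lambda>z. if Im z > 0 then indicator Sieg z / (\<Sum>n. indicator Sieg (mob (e n) z)) else 0)"
  proof
    fix z
    have "orbit_count z = (\<Sum>n. indicator Sieg (mob (e n) z))" if "Im z > 0"
    proof -
      have "((\<lambda>n. indicator Sieg (mob (e n) z)) has_sum orbit_count z) UNIV"
        using orbit_count(1)[OF that] by (subst has_sum_reindex_bij_betw[OF e])
      then show ?thesis using has_sum_imp_sums sums_unique by blast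
    qed
    then show "pou z = (if Im z > 0 then indicator Sieg z / (\<Sum>n. indicator Sieg (mob (e n) z)) else 0)"
      by (simp add: pou_def)
  qed
  moreover have "(\<lambda>z. if Im z > 0 then indicator Sieg z / (\<Sum>n. indicator Sieg (mob (e n) z)) else 0 :: real) \<in> borel_measurable borel"
    by measurable
  ultimately show ?thesis by simp
qed

lemma pou_nonneg: "pou z \<ge> 0"
  using orbit_count(2)[of z] by (auto simp: pou_def indicator_def)

lemma pou_le: "pou z \<le> indicator Sieg z"
  using orbit_count(2)[of z] by (auto simp: pou_def indicator_def)

lemma pou_le_1: "pou z \<le> 1"
  using pou_le[of z] by (cases "z \<in> Sieg") auto

lemma pou_pos: "z \<in> Sieg \<Longrightarrow> pou z > 0"
  using orbit_count(2)[of z] by (auto simp: pou_def Sieg_def)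

lemma has_sum_pou:
  assumes z: "Im z > 0"
  shows "((\<lambda>A. pou (mob A z)) has_sum 1) Gam"
proof -
  have "((\<lambda>A. indicator Sieg (mob A z) * (1 / orbit_count z)) has_sum (orbit_count z * (1 / orbit_count z))) Gam"
    by (rule has_sum_cmult_left) (rule orbit_count(1)[OF z])
  also have "orbit_count z * (1 / orbit_count z) = 1" using orbit_count(2)[OF z] by simp
  also have "((\<lambda>A. indicator Sieg (mob A z) * (1 / orbit_count z)) has_sum 1) Gam \<longleftrightarrow> ?thesis"
  proof (rule has_sum_cong)
    fix A assume "A \<in> Gam"
    then show "indicator Sieg (mob A z) * (1 / orbit_count z) = pou (mob A z)"
      using Im_mob_pos[OF z, of A] orbit_count_mob[OF z, of A] by (simp add: pou_def Gam_def)
  qed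
  finally show ?thesis .
qed

text \<open>The strip is cut into boxes of width 1 and height 1/5. The n-th box starts at height
  (n+1)/5, where the density is at most 25/(n+1)^2, so the total is a convergent series.\<close>

lemma integrable_Sieg: "integrable hyp_measure (indicator Sieg :: complex \<Rightarrow> real)"
proof -
  define Bx where "Bx = (\<lambda>n. cbox (cvec (Complex (-1/2) (real (Suc n) / 5))) (cvec (Complex (1/2) (real (Suc (Suc n)) / 5))))"
  have Bx: "emeasure lborel (Bx n) = ennreal (1 / 5)" for n
  proof -
    have "Bx n \<noteq> {}" unfolding Bx_def by (auto simp: interval_ne_empty_cart forall_2 cvec_def)
    then have "measure lborel (Bx n) = 1 / 5"
      unfolding Bx_def by (subst content_cbox_cart) (simp_all add: UNIV_2 cvec_def add_divide_distrib)
    moreover have "emeasure lborel (Bx n) \<noteq> \<infinity>"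
      unfolding Bx_def using emeasure_lborel_cbox_finite less_irrefl by metis
    ultimately show ?thesis by (simp add: emeasure_eq_ennreal_measure)
  qed
  have "(\<integral>\<^sup>+z. ennreal (norm (indicator Sieg z :: real)) \<partial>hyp_measure) =
      (\<integral>\<^sup>+x. ennreal (hyp_density x) * indicator Sieg (vcx x) \<partial>lborel)"
    unfolding hyp_measure_def
    by (subst nn_integral_distr, simp, simp, subst nn_integral_density, simp, simp)
       (simp add: ennreal_indicator)
  also have "\<dots> \<le> (\<integral>\<^sup>+x. (\<Sum>n. ennreal (25 / real (Suc n) ^ 2) * indicator (Bx n) x) \<partial>lborel)"
  proof (rule nn_integral_mono)
    fix x :: "real ^ 2"
    show "ennreal (hyp_density x) * indicator Sieg (vcx x) \<le> (\<Sum>n. ennreal (25 / real (Suc n) ^ 2) * indicator (Bx n) x)"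
    proof (cases "vcx x \<in> Sieg")
      case True
      define n where "n = nat \<lfloor>5 * x $ 2\<rfloor> - 1"
      have x2: "5 * x $ 2 \<ge> 1" "\<bar>x $ 1\<bar> \<le> 1/2" using True by (simp_all add: Sieg_def)
      then have fl: "\<lfloor>5 * x $ 2\<rfloor> \<ge> 1" by simp
      have n: "real (Suc n) \<le> 5 * x $ 2" "5 * x $ 2 \<le> real (Suc (Suc n))"
        using fl unfolding n_def by linarith+
      have "x \<in> Bx n"
        using n x2 by (auto simp: Bx_def mem_box_cart forall_2 cvec_def abs_le_iff)
      have "hyp_density x \<le> 25 / real (Suc n) ^ 2"
      proof -
        have "1 / (x $ 2) ^ 2 \<le> 1 / (real (Suc n) / 5) ^ 2"
          using n x2 by (intro divide_left_mono power_mono) auto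
        then show ?thesis using x2 by (simp add: hyp_density_def power_divide)
      qed
      then have "ennreal (hyp_density x) * indicator Sieg (vcx x) \<le> ennreal (25 / real (Suc n) ^ 2) * indicator (Bx n) x"
        using True \<open>x \<in> Bx n\<close> by (simp add: ennreal_leI)
      also have "\<dots> = (\<Sum>n\<in>{n}. ennreal (25 / real (Suc n) ^ 2) * indicator (Bx n) x)"
        by (subst sum.insert) simp_all
      also have "\<dots> \<le> (\<Sum>n. ennreal (25 / real (Suc n) ^ 2) * indicator (Bx n) x)"
        by (rule sum_le_suminf) auto
      finally show ?thesis .
    qed simp
  qed
  also have "\<dots> = (\<Sum>n. \<integral>\<^sup>+x. ennreal (25 / real (Suc n) ^ 2) * indicator (Bx n) x \<partial>lborel)"
    by (rule nn_integral_suminf) (simp add: Bx_def)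
  also have "\<dots> = (\<Sum>n. ennreal (25 / real (Suc n) ^ 2 * (1/5)))"
    by (intro suminf_cong, subst nn_integral_cmult_indicator) (simp_all add: Bx Bx_def[symmetric] ennreal_mult'[symmetric], simp add: Bx_def)
  also have "\<dots> < \<infinity>"
  proof -
    have "summable (\<lambda>n. 1 / real (Suc n) ^ 2)"
      using inverse_power_summable[of 2, where 'a = real] by (subst summable_Suc_iff) (simp add: field_simps)
    then have "summable (\<lambda>n. 25 / real (Suc n) ^ 2 * (1/5))"
      using summable_mult[of "\<lambda>n. 1 / real (Suc n) ^ 2" 5] by simp
    then show ?thesis by (subst suminf_ennreal2) auto
  qed
  finally show ?thesis by (intro integrableI_bounded) auto
qed

lemma integrable_pou_bounded:
  assumes [measurable]: "g \<in> borel_measurable borel" and "\<And>z. Im z > 0 \<Longrightarrow> \<bar>g z\<bar> \<le> C"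
  shows "integrable hyp_measure (\<lambda>z. pou z * g z)"
proof (rule Bochner_Integration.integrable_bound)
  show "integrable hyp_measure (\<lambda>z. C * indicator Sieg z)"
    by (intro integrable_mult_right integrable_Sieg)
  show "AE z in hyp_measure. norm (pou z * g z) \<le> norm (C * indicator Sieg z)"
  proof (rule AE_I2)
    fix z
    show "norm (pou z * g z) \<le> norm (C * indicator Sieg z)"
    proof (cases "Im z > 0")
      case True
      have "\<bar>pou z\<bar> * \<bar>g z\<bar> \<le> indicator Sieg z * C"
        using pou_nonneg[of z] pou_le[of z] assms(2)[OF True] by (intro mult_mono) auto
      also have "\<dots> \<le> norm (C * indicator Sieg z)" by (simp add: mult.commute)
      finally show ?thesis by (simp add: abs_mult)
    qed (simp add: pou_def)
  qed
qed simp

section \<open>Hecke eigenvalues are real\<close>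

lemma open_upper_half_plane: "open upper_half_plane"
  unfolding upper_half_plane_def by (intro open_Collect_less continuous_intros)

lemma connected_upper_half_plane: "connected upper_half_plane"
  unfolding upper_half_plane_def by (intro convex_connected convex_halfspace_Im_gt)

lemma cusp_form_holomorphic: "f \<in> cusp_forms k \<Longrightarrow> f holomorphic_on upper_half_plane"
  by (simp add: cusp_forms_def)

lemma measurable_cusp_form:
  assumes "f \<in> cusp_forms k"
  shows "f \<in> borel_measurable borel"
proof -
  have "continuous_on upper_half_plane f"
    using assms cusp_form_holomorphic holomorphic_on_imp_continuous_on by blast
  then have "(\<lambda>z. indicator upper_half_plane z *\<^sub>R f z) \<in> borel_measurable borel"
    by (intro borel_measurable_continuous_on_indicator) (use open_upper_half_plane in auto)
  also have "(\<lambda>z. indicator upper_half_plane z *\<^sub>R f z) = f"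
    using assms by (auto simp: cusp_forms_def indicator_def)
  finally show ?thesis .
qed

section \<open>The weighted Petersson pairing of a form with its translates\<close>

definition twist :: "nat \<Rightarrow> (complex \<Rightarrow> complex) \<Rightarrow> imat \<Rightarrow> complex \<Rightarrow> complex" where
  "twist k f A z = f (mob A z) / jac A z ^ k"

text \<open>Only the imaginary part of the pairing is recorded, because reality of the eigenvalue is
  all that is to be extracted.\<close>

definition pair_density :: "nat \<Rightarrow> (complex \<Rightarrow> complex) \<Rightarrow> imat \<Rightarrow> complex \<Rightarrow> real" where
  "pair_density k f A z = Im (twist k f A z * cnj (f z)) * Im z ^ k"

text \<open>The two weights are interchanged by z -> A z, which makes this integral antisymmetric
  under the adjugate. Summed over a coset of \<open>Gam\<close>, the second weight
  disappears.\<close>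

definition pair_int :: "nat \<Rightarrow> (complex \<Rightarrow> complex) \<Rightarrow> imat \<Rightarrow> real" where
  "pair_int k f A = (\<integral>z. pou z * (pou (mob A z) * pair_density k f A z) \<partial>hyp_measure)"

abbreviation pair_avg :: "nat \<Rightarrow> (complex \<Rightarrow> complex) \<Rightarrow> imat \<Rightarrow> real" where
  "pair_avg k f A \<equiv> \<integral>z. pou z * pair_density k f A z \<partial>hyp_measure"

lemma measurable_pair_density:
  assumes "f \<in> cusp_forms k"
  shows "pair_density k f A \<in> borel_measurable borel"
proof -
  have [measurable]: "f \<in> borel_measurable borel" by (rule measurable_cusp_form[OF assms])
  have [measurable]: "cnj \<in> borel_measurable borel" "Im \<in> borel_measurable borel"
    by (intro borel_measurable_continuous_onI continuous_intros)+
  have [measurable]: "(\<lambda>z. cnj (f z)) \<in> borel_measurable borel"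
    by (rule measurable_compose[where g = cnj]) measurable
  show ?thesis unfolding pair_density_def twist_def by measurable
qed

lemma norm_twist:
  assumes z: "Im z > 0" and A: "mdet A > 0"
  shows "norm (twist k f A z) * sqrt (Im z) ^ k = pnorm k f (mob A z) / sqrt (of_int (mdet A)) ^ k"
proof -
  have j: "norm (jac A z) > 0" using jac_nonzero[of A z] A z by simp
  have "sqrt (Im (mob A z)) = sqrt (of_int (mdet A)) * sqrt (Im z) / norm (jac A z)"
    using j by (simp add: Im_mob[OF z] real_sqrt_divide real_sqrt_mult)
  then have "pnorm k f (mob A z) = norm (f (mob A z)) * (sqrt (of_int (mdet A)) ^ k * sqrt (Im z) ^ k / norm (jac A z) ^ k)"
    by (simp add: pnorm_def power_divide power_mult_distrib)
  then show ?thesis using A j by (simp add: twist_def norm_divide norm_power)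
qed

lemma abs_pair_density_le:
  assumes f: "f \<in> cusp_forms k" and z: "Im z > 0" and A: "mdet A > 0"
  shows "\<bar>pair_density k f A z\<bar> \<le> psup k f ^ 2"
proof -
  have det1: "1 \<le> sqrt (of_int (mdet A)) ^ k" using A by (intro one_le_power) simp
  have p0: "pnorm k f w \<ge> 0" if "Im w > 0" for w using that by (simp add: pnorm_def)
  note M = pnorm_le_psup[OF f]
  have M0: "psup k f \<ge> 0" using M[OF z] p0[OF z] by linarith
  have y: "Im z ^ k = sqrt (Im z) ^ k * sqrt (Im z) ^ k" using z by (simp add: power_mult_distrib[symmetric])
  have "\<bar>pair_density k f A z\<bar> \<le> norm (twist k f A z * cnj (f z)) * Im z ^ k"
    unfolding pair_density_def abs_mult using z by (intro mult_mono abs_Im_le_cmod) auto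
  also have "\<dots> = (norm (twist k f A z) * sqrt (Im z) ^ k) * pnorm k f z"
    by (simp add: norm_mult y pnorm_def)
  also have "\<dots> = pnorm k f (mob A z) / sqrt (of_int (mdet A)) ^ k * pnorm k f z"
    by (simp only: norm_twist[OF z A])
  also have "\<dots> \<le> (psup k f / 1) * psup k f"
    using M[OF z] M[OF Im_mob_pos[OF z A]] p0[OF z] p0[OF Im_mob_pos[OF z A]] det1 M0
    by (intro mult_mono frac_le) auto
  finally show ?thesis by (simp add: power2_eq_square)
qed

lemma mult_of_real_Im: "Im (w * of_real r) = Im w * r"
  by simp

text \<open>The automorphy factors of A and of its adjugate multiply to n = det A, and Im (A z) = n
  Im z / |j|^2. All powers of n cancel, so the two pairings are complex conjugates and their
  imaginary parts are opposite.\<close>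

lemma pair_density_madj:
  assumes z: "Im z > 0" and A: "mdet A > 0"
  shows "pair_density k f (madj A) (mob A z) = - pair_density k f A z"
proof -
  define n where "n = (of_int (mdet A) :: complex)"
  define j where "j = jac A z"
  define j' where "j' = jac (madj A) (mob A z)"
  have j0: "j \<noteq> 0" using jac_nonzero[of A z] A z by (simp add: j_def)
  have n0: "n \<noteq> 0" using A by (simp add: n_def)
  have jj: "j' * j = n"
    using jac_mmul[OF z, of A "madj A"] A by (simp add: mmul_madj_left j_def j'_def n_def)
  have bk: "mob (madj A) (mob A z) = z" by (rule mob_madj_mob[OF z A])
  have Im: "of_real (Im (mob A z)) = n * of_real (Im z) / (j * cnj j)"
    unfolding Im_mob[OF z] complex_norm_square[symmetric] j_def n_def by simp
  have "f z / j' ^ k * cnj (f (mob A z)) * of_real (Im (mob A z)) ^ k =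
      f z * cnj (f (mob A z)) * of_real (Im z) ^ k / cnj j ^ k"
  proof -
    have j'0: "j' \<noteq> 0" using jj n0 by auto
    have nk: "n ^ k = j' ^ k * j ^ k" by (simp add: jj power_mult_distrib[symmetric])
    show ?thesis using j0 j'0 by (simp add: Im nk power_divide power_mult_distrib)
  qed
  also have "\<dots> = cnj (f (mob A z) / j ^ k * cnj (f z) * of_real (Im z) ^ k)" by simp
  finally have "Im (f z / j' ^ k * cnj (f (mob A z)) * of_real (Im (mob A z) ^ k)) =
      Im (cnj (f (mob A z) / j ^ k * cnj (f z) * of_real (Im z ^ k)))"
    by (simp only: of_real_power)
  then have "Im (f z / j' ^ k * cnj (f (mob A z))) * Im (mob A z) ^ k = - (Im (f (mob A z) / j ^ k * cnj (f z)) * Im z ^ k)"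
    by (simp only: mult_of_real_Im cnj.sel(2))
  then show ?thesis by (simp only: pair_density_def twist_def bk j_def j'_def)
qed

text \<open>Substituting A z in the integral for the adjugate swaps the weights, and the density
  changes sign.\<close>

lemma pair_int_madj:
  assumes f: "f \<in> cusp_forms k" and A: "mdet A > 0"
  shows "pair_int k f (madj A) = - pair_int k f A"
proof -
  have [measurable]: "pair_density k f B \<in> borel_measurable borel" for B by (rule measurable_pair_density[OF f])
  let ?h = "\<lambda>z. pou z * (pou (mob (madj A) z) * pair_density k f (madj A) z)"
  have A': "mdet (madj A) > 0" using A by simp
  have int: "integrable hyp_measure ?h"
  proof (rule integrable_pou_bounded)
    fix z assume z: "Im z > 0"
    have "\<bar>pou (mob (madj A) z)\<bar> * \<bar>pair_density k f (madj A) z\<bar> \<le> 1 * (psup k f ^ 2)"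
      using pou_nonneg pou_le_1 by (intro mult_mono abs_pair_density_le[OF f z A']) auto
    then show "\<bar>pou (mob (madj A) z) * pair_density k f (madj A) z\<bar> \<le> psup k f ^ 2"
      by (simp add: abs_mult)
  qed simp
  have "pair_int k f (madj A) = (\<integral>z. ?h (mob A z) \<partial>hyp_measure)"
    unfolding pair_int_def by (rule hyp_measure_invariant(2)[OF _ A int, symmetric]) simp
  also have "\<dots> = (\<integral>z. - (pou z * (pou (mob A z) * pair_density k f A z)) \<partial>hyp_measure)"
  proof (rule integral_cong_AE)
    show "AE z in hyp_measure. ?h (mob A z) = - (pou z * (pou (mob A z) * pair_density k f A z))"
      using AE_hyp_measure_Im_pos
    proof eventually_elim
      case (elim z)
      show ?case unfolding pair_density_madj[OF elim A] mob_madj_mob[OF elim A] by simp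
    qed
  qed simp_all
  also have "\<dots> = - pair_int k f A" by (simp add: pair_int_def)
  finally show ?thesis .
qed

text \<open>The adjugate permutes the matrices of determinant n, so the sum equals its own
  negative.\<close>

lemma infsum_pair_int_Del:
  assumes f: "f \<in> cusp_forms k" and n: "n > 0"
  shows "(\<Sum>\<^sub>\<infinity>A\<in>Del n. pair_int k f A) = 0"
proof -
  have "bij_betw madj (Del n) (Del n)"
    by (rule bij_betw_byWitness[where f' = madj]) (auto simp: Del_def simp del: mdet.simps madj.simps)
  then have "(\<Sum>\<^sub>\<infinity>A\<in>Del n. pair_int k f A) = (\<Sum>\<^sub>\<infinity>A\<in>Del n. pair_int k f (madj A))"
    by (rule infsum_reindex_bij_betw[symmetric])
  also have "\<dots> = (\<Sum>\<^sub>\<infinity>A\<in>Del n. - pair_int k f A)"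
    by (rule infsum_cong) (use n in \<open>simp add: Del_def pair_int_madj[OF f]\<close>)
  also have "\<dots> = - (\<Sum>\<^sub>\<infinity>A\<in>Del n. pair_int k f A)" by (rule infsum_uminus)
  finally show ?thesis by simp
qed

lemma twist_mmul:
  assumes f: "f \<in> cusp_forms k" and z: "Im z > 0" and A: "mdet A > 0" and \<gamma>: "\<gamma> \<in> Gam"
  shows "twist k f (mmul \<gamma> A) z = twist k f A z"
proof -
  have g1: "mdet \<gamma> = 1" using \<gamma> by (simp add: Gam_def)
  have A0: "mdet A \<noteq> 0" using A by simp
  have w: "Im (mob A z) > 0" by (rule Im_mob_pos[OF z A])
  have "jac \<gamma> (mob A z) \<noteq> 0" using g1 by (intro jac_nonzero w) simp
  then show ?thesis
    unfolding twist_def mob_mmul[OF z A0] jac_mmul[OF z A0] cusp_form_transform[OF f g1 w]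
    by (simp add: power_mult_distrib)
qed

text \<open>Unfolding: summing over the left coset of \<open>A\<close> removes the inner weight.\<close>

lemma has_sum_pair_int_coset:
  assumes f: "f \<in> cusp_forms k" and A: "mdet A > 0"
  shows "(pair_int k f has_sum pair_avg k f A) ((\<lambda>\<gamma>. mmul \<gamma> A) ` Gam)"
proof -
  have [measurable]: "pair_density k f B \<in> borel_measurable borel" for B by (rule measurable_pair_density[OF f])
  have A0: "mdet A \<noteq> 0" using A by simp
  have int: "integrable hyp_measure (\<lambda>z. pou z * pair_density k f A z)"
    by (rule integrable_pou_bounded[where C = "psup k f ^ 2"]) (auto intro: abs_pair_density_le[OF f _ A])
  have "((\<lambda>\<gamma>. \<integral>z. pou (mob \<gamma> (mob A z)) * (pou z * pair_density k f A z) \<partial>hyp_measure)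
      has_sum pair_avg k f A) Gam"
  proof (rule has_sum_integral_weights[OF _ infinite_Gam _ int])
    show "AE z in hyp_measure. ((\<lambda>\<gamma>. pou (mob \<gamma> (mob A z))) has_sum 1) Gam"
      using AE_hyp_measure_Im_pos
    proof eventually_elim
      case (elim z)
      show ?case by (rule has_sum_pou[OF Im_mob_pos[OF elim A]])
    qed
  qed (auto simp: pou_nonneg)
  also have "?this \<longleftrightarrow> ((\<lambda>\<gamma>. pair_int k f (mmul \<gamma> A)) has_sum pair_avg k f A) Gam"
  proof (rule has_sum_cong)
    fix \<gamma> assume \<gamma>: "\<gamma> \<in> Gam"
    show "(\<integral>z. pou (mob \<gamma> (mob A z)) * (pou z * pair_density k f A z) \<partial>hyp_measure) = pair_int k f (mmul \<gamma> A)"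
      unfolding pair_int_def
    proof (rule integral_cong_AE)
      show "AE z in hyp_measure. pou (mob \<gamma> (mob A z)) * (pou z * pair_density k f A z) =
         pou z * (pou (mob (mmul \<gamma> A) z) * pair_density k f (mmul \<gamma> A) z)"
        using AE_hyp_measure_Im_pos
      proof eventually_elim
        case (elim z)
        show ?case
          unfolding pair_density_def twist_mmul[OF f elim A \<gamma>] mob_mmul[OF elim A0] by simp
      qed
    qed simp_all
  qed
  finally have "((pair_int k f \<circ> (\<lambda>\<gamma>. mmul \<gamma> A)) has_sum pair_avg k f A) Gam"
    by (simp add: o_def)
  then show ?thesis by (subst has_sum_reindex[OF inj_on_mmul_right[OF A0]])
qed

text \<open>If the integral were 0, f would vanish almost everywhere on the interior of
  \<open>Sieg\<close>, where the weight is positive. By continuity it would vanish there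
  identically, and then on the half plane by the identity theorem.\<close>

lemma Petersson_norm_pos:
  assumes f: "f \<in> cusp_forms k" and nz: "f \<noteq> (\<lambda>z. 0)"
  shows "(\<integral>z. pou z * (norm (f z) ^ 2 * Im z ^ k) \<partial>hyp_measure) > 0"
proof -
  have [measurable]: "f \<in> borel_measurable borel" by (rule measurable_cusp_form[OF f])
  let ?g = "\<lambda>z. pou z * (norm (f z) ^ 2 * Im z ^ k)"
  have int: "integrable hyp_measure ?g"
  proof (rule integrable_pou_bounded)
    fix z assume z: "Im z > 0"
    have "norm (f z) ^ 2 * Im z ^ k = pnorm k f z ^ 2"
      using z by (simp add: pnorm_def power_mult_distrib power_mult[symmetric] mult.commute[of k])
         (simp add: power_mult)
    also have "\<dots> \<le> psup k f ^ 2" using z by (intro power_mono pnorm_le_psup f) (auto simp: pnorm_def)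
    finally show "\<bar>norm (f z) ^ 2 * Im z ^ k\<bar> \<le> psup k f ^ 2" using z by simp
  qed simp
  have nonneg: "?g z \<ge> 0" for z
  proof (cases "Im z > 0")
    case True
    then show ?thesis by (intro mult_nonneg_nonneg pou_nonneg) auto
  qed (simp add: pou_def)
  have "integral\<^sup>L hyp_measure ?g \<noteq> 0"
  proof
    assume "integral\<^sup>L hyp_measure ?g = 0"
    then have "AE z in hyp_measure. ?g z = 0"
      using integral_nonneg_eq_0_iff_AE[OF int] nonneg by simp
    then have AE: "AE x in lborel. x $ 2 > 0 \<longrightarrow> ?g (vcx x) = 0"
      by (subst (asm) AE_hyp_measure) simp_all
    define S where "S = {z. Im z > 1/5 \<and> Re z < 1/2 \<and> Re z > -1/2}"
    have "S = {z. Im z > 1/5} \<inter> {z. Re z < 1/2} \<inter> {z. Re z > -1/2}" by (auto simp: S_def)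
    then have S: "open S" by (simp only:) (intro open_Int open_Collect_less continuous_intros)
    have "Complex 0 1 \<in> S" by (simp add: S_def)
    have "\<exists>z\<in>S. f z \<noteq> 0"
    proof (rule ccontr)
      assume "\<not> ?thesis"
      then have z0: "f z = 0" if "z \<in> S" for z using that by blast
      have "f z = 0" if "Im z > 0" for z
      proof (rule analytic_continuation_open[where g = "\<lambda>_. 0" and f = f, OF S open_upper_half_plane])
        show "S \<noteq> {}" using \<open>Complex 0 1 \<in> S\<close> by blast
        show "connected upper_half_plane" by (rule connected_upper_half_plane)
        show "S \<subseteq> upper_half_plane" by (auto simp: S_def upper_half_plane_def)
        show "f holomorphic_on upper_half_plane" by (rule cusp_form_holomorphic[OF f])
        show "z \<in> upper_half_plane" using that by (simp add: upper_half_plane_def)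
      qed (use z0 in auto)
      with cusp_form_zero_offI[OF f] nz show False by blast
    qed
    then obtain z1 where z1: "z1 \<in> S" "f z1 \<noteq> 0" by blast
    have "continuous_on S f"
      using cusp_form_holomorphic[OF f, THEN holomorphic_on_imp_continuous_on]
      by (rule continuous_on_subset) (auto simp: S_def upper_half_plane_def)
    then have opn: "open (S \<inter> f -` (- {0}))"
      by (intro continuous_open_preimage S) auto
    define V where "V = (\<lambda>x::real^2. vcx x) -` (S \<inter> f -` (- {0}))"
    have "open V" unfolding V_def using continuous_on_vcx opn by (intro open_vimage) auto
    have "cvec z1 \<in> V" using z1 unfolding V_def vimage_eq vcx_cvec by simp
    have "AE x in lborel. x \<notin> V"
      using AE
    proof eventually_elim
      case (elim x)
      show ?case
      proof
        assume "x \<in> V"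
        then have xS: "vcx x \<in> S" and fx: "f (vcx x) \<noteq> 0" by (auto simp: V_def)
        have "vcx x \<in> Sieg" using xS by (auto simp: S_def Sieg_def)
        then have "pou (vcx x) > 0" by (rule pou_pos)
        moreover have "x $ 2 > 0" using xS by (simp add: S_def)
        ultimately show False using elim fx by simp
      qed
    qed
    moreover have "{x. \<not> x \<notin> V} = V" by simp
    ultimately have "V \<in> null_sets lborel"
      using AE_iff_null_sets[of V lborel] \<open>open V\<close> by simp
    then have "negligible V" by (simp add: negligible_iff_null_sets null_sets_completionI)
    with open_not_negligible[OF \<open>open V\<close>] \<open>cvec z1 \<in> V\<close> show False by blast
  qed
  moreover have "integral\<^sup>L hyp_measure ?g \<ge> 0" by (rule Bochner_Integration.integral_nonneg) (rule nonneg)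
  ultimately show ?thesis by linarith
qed

text \<open>The sum of \<open>pair_int\<close> over \<open>Del n\<close> is computed twice. It is 0
  by antisymmetry; unfolded coset by coset it is Im ev times the Petersson norm of f times c, where
  c is the inverse of the factor n^(k-1) in \<open>hecke_op\<close>.\<close>

lemma hecke_eigenvalue_real:
  assumes f: "f \<in> cusp_forms k" and nz: "f \<noteq> (\<lambda>z. 0)" and n: "n > 0"
    and ev: "\<And>z. Im z > 0 \<Longrightarrow> hecke_op k n f z = ev * f z"
  shows "Im ev = 0"
proof -
  have [measurable]: "f \<in> borel_measurable borel" by (rule measurable_cusp_form[OF f])
  have [measurable]: "pair_density k f B \<in> borel_measurable borel" for B by (rule measurable_pair_density[OF f])
  have det: "mdet \<alpha> > 0" if "\<alpha> \<in> hecke_reps n" for \<alpha>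
    using mdet_hecke_reps[OF that] n by simp
  define c where "c = real n / real n ^ k"
  have c: "c > 0" using n by (simp add: c_def)
  define P where "P = (\<integral>z. pou z * (norm (f z) ^ 2 * Im z ^ k) \<partial>hyp_measure)"
  have "(pair_int k f has_sum (\<Sum>\<alpha>\<in>hecke_reps n. pair_avg k f \<alpha>))
      (\<Union>\<alpha>\<in>hecke_reps n. (\<lambda>\<gamma>. mmul \<gamma> \<alpha>) ` Gam)"
    by (intro sum_has_sum finite_hecke_reps[OF n] has_sum_pair_int_coset f det hecke_reps_cosets_disjoint[OF n])
  then have "(\<Sum>\<alpha>\<in>hecke_reps n. pair_avg k f \<alpha>) = 0"
    using infsum_pair_int_Del[OF f n] infsumI unfolding Del_eq_UN_cosets[OF n, symmetric] by metis
  also have "(\<Sum>\<alpha>\<in>hecke_reps n. pair_avg k f \<alpha>) =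
      (\<integral>z. (\<Sum>\<alpha>\<in>hecke_reps n. pou z * pair_density k f \<alpha> z) \<partial>hyp_measure)"
    by (intro Bochner_Integration.integral_sum[symmetric] integrable_pou_bounded[where C = "psup k f ^ 2"])
       (auto intro: abs_pair_density_le[OF f _ det])
  also have "\<dots> = (\<integral>z. (Im ev * c) * (pou z * (norm (f z) ^ 2 * Im z ^ k)) \<partial>hyp_measure)"
  proof (rule integral_cong_AE)
    show "AE z in hyp_measure. (\<Sum>\<alpha>\<in>hecke_reps n. pou z * pair_density k f \<alpha> z) =
        (Im ev * c) * (pou z * (norm (f z) ^ 2 * Im z ^ k))"
      using AE_hyp_measure_Im_pos
    proof eventually_elim
      case (elim z)
      have "(\<Sum>\<alpha>\<in>hecke_reps n. twist k f \<alpha> z) = of_real c * (ev * f z)"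
        using ev[OF elim] n by (simp add: hecke_op_eq_sum_reps twist_def c_def field_simps)
      then have "(\<Sum>\<alpha>\<in>hecke_reps n. twist k f \<alpha> z * cnj (f z)) = of_real c * ev * (f z * cnj (f z))"
        by (simp flip: sum_distrib_right)
      also have "f z * cnj (f z) = of_real (norm (f z) ^ 2)" by (rule complex_norm_square[symmetric])
      finally have "Im (\<Sum>\<alpha>\<in>hecke_reps n. twist k f \<alpha> z * cnj (f z)) = c * Im ev * norm (f z) ^ 2"
        by simp
      moreover have "(\<Sum>\<alpha>\<in>hecke_reps n. pou z * pair_density k f \<alpha> z) =
          pou z * (Im (\<Sum>\<alpha>\<in>hecke_reps n. twist k f \<alpha> z * cnj (f z)) * Im z ^ k)"
        by (simp only: pair_density_def Im_sum sum_distrib_left sum_distrib_right)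
      ultimately show ?case by (simp only: mult_ac)
    qed
  qed simp_all
  also have "\<dots> = Im ev * c * P" by (simp add: P_def)
  finally show ?thesis using c Petersson_norm_pos[OF f nz] by (simp add: P_def)
qed

section \<open>Finiteness of the set of normalized eigenforms\<close>

lemma cusp_expansion_factor:
  assumes a: "cusp_expansion f a" and zero: "\<And>n. n < N \<Longrightarrow> a n = 0" and z: "Im z > 0"
  shows "f z = qexp z ^ N * (\<Sum>n. a (n + N) * qexp z ^ n)"
proof -
  have "(\<lambda>n. a n * qexp z ^ n) sums f z" by (rule cusp_expansion_sums[OF a z])
  then have "(\<lambda>n. a (n + N) * qexp z ^ (n + N)) sums f z"
    using sums_iff_shift[of "\<lambda>n. a n * qexp z ^ n" N "f z"] zero by simp
  then have "(\<lambda>n. qexp z ^ N * (a (n + N) * qexp z ^ n)) sums f z"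
    by (simp add: power_add mult_ac)
  moreover have "summable (\<lambda>n. a (n + N) * qexp z ^ n)"
    using sums_summable[OF calculation] by (subst (asm) summable_cmult_iff) simp
  ultimately show ?thesis by (simp add: sums_iff suminf_mult)
qed

lemma shifted_expansion_holomorphic:
  assumes a: "cusp_expansion f a"
  shows "(\<lambda>w. \<Sum>n. a (n + N) * w ^ n) holomorphic_on ball 0 1"
proof (rule disc_power_series_holomorphic)
  fix z :: complex assume "Im z > 0"
  then have "summable (\<lambda>n. a n * qexp z ^ n)" using cusp_expansion_sums[OF a] by (auto simp: sums_iff)
  then have "summable (\<lambda>n. a (n + N) * qexp z ^ (n + N))" by (subst summable_iff_shift)
  then have "summable (\<lambda>n. qexp z ^ N * (a (n + N) * qexp z ^ n))" by (simp add: power_add mult_ac)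
  then show "summable (\<lambda>n. a (n + N) * qexp z ^ n)" by (subst (asm) summable_cmult_iff) simp
qed

text \<open>Siegel's argument: a zero of high order at the cusp makes the supremum of \<open>pnorm\<close> over
  \<open>Im z \<ge> 1/5\<close>, which is the supremum over the whole half plane, at most half of itself.\<close>

lemma cusp_form_eq_0I:
  assumes f: "f \<in> cusp_forms k" and a: "cusp_expansion f a" and zero: "\<And>n. n < 2 * k + 2 \<Longrightarrow> a n = 0"
  shows "f = (\<lambda>z. 0)"
proof -
  \<comment> \<open>The order of vanishing has to beat the growth of y^(k/2): with pi > 3, pi N / 5
    is at least 6 (k + 1) / 5, so k - pi N / 5 <= -1 in the final estimate.\<close>
  define N where "N = 2 * k + 2"
  define M where "M = psup k f"
  have M: "pnorm k f z \<le> M" if "Im z > 0" for z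
    unfolding M_def by (rule pnorm_le_psup[OF f that])
  have M_nonneg: "M \<ge> 0" using M[of \<i>] by (simp add: pnorm_def order_trans[OF norm_ge_zero])
  \<comment> \<open>The circle of radius r is the image of the line Im z = 1/10, below the height
    1/5. The maximum principle for f / q^N on this disc gains a factor (|q| / r)^N at heights at
    least 1/5, where y is at least twice as large as on the line.\<close>
  define r where "r = exp (- 2 * pi / 10)"
  have r: "0 < r" "r < 1" by (auto simp: r_def)
  define h where "h = (\<lambda>w. \<Sum>n. a (n + N) * w ^ n)"
  have hf: "f z = qexp z ^ N * h (qexp z)" if "Im z > 0" for z
    unfolding h_def by (rule cusp_expansion_factor[OF a _ that]) (use zero in \<open>simp add: N_def\<close>)
  have hol: "h holomorphic_on ball 0 1" unfolding h_def by (rule shifted_expansion_holomorphic[OF a])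
  define B where "B = M * sqrt 10 ^ k / r ^ N"
  have bd: "norm (h w) \<le> B" if "norm w \<le> r" for w
  proof (rule maximum_modulus_frontier[where S = "cball 0 r" and f = h])
    show "h holomorphic_on interior (cball 0 r)"
      by (rule holomorphic_on_subset[OF hol]) (use r in auto)
    show "continuous_on (closure (cball 0 r)) h"
      by (rule continuous_on_subset[OF holomorphic_on_imp_continuous_on[OF hol]]) (use r in auto)
    show "w \<in> cball 0 r" using that by simp
    fix u assume "u \<in> frontier (cball (0::complex) r)"
    then have u: "norm u = r" using r by (simp add: frontier_cball)
    have "u \<noteq> 0" "norm u < 1" using u r by auto
    then obtain z where z: "Im z > 0" "qexp z = u" by (rule qexp_surj)
    have "exp (- 2 * pi * Im z) = exp (- 2 * pi / 10)" using norm_qexp[of z] u by (simp add: z r_def)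
    then have y: "Im z = 1 / 10" by simp
    have "norm (f z) = r ^ N * norm (h u)" using hf[OF z(1)] u by (simp add: z norm_mult norm_power)
    moreover have "norm (f z) * sqrt (1/10) ^ k \<le> M" using M[OF z(1)] by (simp add: pnorm_def y)
    ultimately have "r ^ N * norm (h u) * sqrt (1/10) ^ k \<le> M" by simp
    then show "norm (h u) \<le> B" using r by (simp add: B_def real_sqrt_divide power_divide field_simps)
  qed simp
  have half: "pnorm k f z \<le> M / 2" if y: "Im z \<ge> 1/5" for z
  proof -
    have z: "Im z > 0" using y by simp
    define x where "x = 10 * Im z"
    have x: "x \<ge> 2" using y by (simp add: x_def)
    have q: "norm (qexp z) = r * exp (- 2 * pi / 10 * (x - 1))"
      by (simp add: norm_qexp r_def x_def exp_add[symmetric] field_simps)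
    have "norm (qexp z) \<le> r" unfolding q using r x by (intro mult_left_le) auto
    then have "pnorm k f z \<le> norm (qexp z) ^ N * B * sqrt (Im z) ^ k"
      unfolding pnorm_def hf[OF z] norm_mult norm_power using z by (intro mult_right_mono mult_left_mono bd) auto
    also have "\<dots> = M * (sqrt x ^ k * exp (- 2 * pi / 10 * (x - 1)) ^ N)"
      using r by (simp add: q B_def x_def real_sqrt_mult power_mult_distrib)
    also have "sqrt x ^ k * exp (- 2 * pi / 10 * (x - 1)) ^ N \<le> 1 / 2"
    proof -
      have "sqrt x \<le> x" using x by (intro real_le_lsqrt) (auto simp: power2_eq_square)
      also have "\<dots> \<le> exp (x - 1)" using exp_ge_add_one_self[of "x - 1"] by simp
      finally have "sqrt x ^ k \<le> exp (x - 1) ^ k" using x by (intro power_mono) auto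
      then have "sqrt x ^ k * exp (- 2 * pi / 10 * (x - 1)) ^ N \<le> exp (x - 1) ^ k * exp (- 2 * pi / 10 * (x - 1)) ^ N"
        by (intro mult_right_mono) auto
      also have "\<dots> = exp ((x - 1) * (real k - pi / 5 * real N))"
        by (simp add: exp_of_nat_mult[symmetric] exp_add[symmetric] algebra_simps)
      also have "\<dots> \<le> exp ((x - 1) * (-1))"
      proof -
        have "3 / 5 * real N \<le> pi / 5 * real N" using pi_gt3 by (intro mult_right_mono) auto
        then have "real k - pi / 5 * real N \<le> -1" by (simp add: N_def algebra_simps)
        then show ?thesis using x by (subst exp_le_cancel_iff) (intro mult_left_mono, auto)
      qed
      also have "\<dots> \<le> exp (-1)" using x by simp
      also have "exp (-1) \<le> (1 / 2 :: real)"
        using exp_ge_add_one_self[of 1] by (simp add: exp_minus field_simps)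
      finally show ?thesis .
    qed
    finally show ?thesis using M_nonneg by (simp add: mult_left_mono)
  qed
  have "pnorm k f z \<le> M / 2" if z: "Im z > 0" for z
  proof -
    obtain A where A: "mdet A = 1" "Im (mob A z) \<ge> 1/5" "\<bar>Re (mob A z)\<bar> \<le> 1/2"
      by (rule exists_Siegel_representative[OF z])
    show ?thesis using half[OF A(2)] pnorm_mob[OF f A(1) z] by simp
  qed
  then have "M \<le> M / 2"
    by (subst (1) M_def) (rule psup_le)
  then have "M = 0" using M_nonneg by simp
  then have "f z = 0" if z: "Im z > 0" for z
  proof -
    have "\<not> norm (f z) * sqrt (Im z) ^ k > 0" using M[OF z] \<open>M = 0\<close> by (simp add: pnorm_def)
    then show ?thesis using z by (metis mult_pos_pos real_sqrt_gt_0_iff zero_less_norm_iff zero_less_power)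
  qed
  then show ?thesis by (rule cusp_form_zero_offI[OF f])
qed

text \<open>Gaussian elimination on the coordinates: a vector with nonzero last coordinate is used
  as pivot to clear that coordinate in all others, and its coefficient in the relation is solved for
  at the end.\<close>

lemma exists_linear_relation:
  fixes v :: "'a \<Rightarrow> nat \<Rightarrow> complex"
  assumes "finite S" "card S > N"
  shows "\<exists>x. (\<exists>s\<in>S. x s \<noteq> 0) \<and> (\<forall>n<N. (\<Sum>s\<in>S. x s * v s n) = 0)"
  using assms
proof (induction N arbitrary: S v)
  case 0
  then have "S \<noteq> {}" by auto
  then show ?case by (intro exI[of _ "\<lambda>_. 1"]) auto
next
  case (Suc N)
  show ?case
  proof (cases "\<forall>s\<in>S. v s N = 0")
    case True
    obtain x where "\<exists>s\<in>S. x s \<noteq> 0" "\<forall>n<N. (\<Sum>s\<in>S. x s * v s n) = 0"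
      using Suc.IH[of S v] Suc.prems by auto
    then show ?thesis using True by (intro exI[of _ x]) (auto simp: less_Suc_eq)
  next
    case False
    then obtain j where j: "j \<in> S" "v j N \<noteq> 0" by blast
    define T where "T = S - {j}"
    have T: "finite T" "card T > N" "S = insert j T" "j \<notin> T" using Suc.prems j by (auto simp: T_def)
    define v' where "v' = (\<lambda>s n. v s n - v s N / v j N * v j n)"
    obtain x where x: "\<exists>s\<in>T. x s \<noteq> 0" "\<forall>n<N. (\<Sum>s\<in>T. x s * v' s n) = 0"
      using Suc.IH[OF T(1,2), of v'] by auto
    define x' where "x' = (\<lambda>s. if s = j then - (\<Sum>s\<in>T. x s * v s N) / v j N else x s)"
    have eq: "(\<Sum>s\<in>S. x' s * v s n) = (\<Sum>s\<in>T. x s * v' s n)" for n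
    proof -
      have "(\<Sum>s\<in>T. x' s * v s n) = (\<Sum>s\<in>T. x s * v s n)"
        using T by (intro sum.cong) (auto simp: x'_def)
      then have "(\<Sum>s\<in>S. x' s * v s n) = x' j * v j n + (\<Sum>s\<in>T. x s * v s n)"
        using T by simp
      also have "x' j * v j n = - (\<Sum>s\<in>T. x s * (v s N / v j N * v j n))"
        by (simp add: x'_def sum_distrib_left sum_divide_distrib mult_ac)
      finally show ?thesis by (simp add: v'_def right_diff_distrib sum_subtractf)
    qed
    have "\<exists>s\<in>S. x' s \<noteq> 0" using x(1) T by (auto simp: x'_def)
    moreover have "(\<Sum>s\<in>S. x' s * v s n) = 0" if "n < Suc N" for n
    proof (cases "n = N")
      case True
      then show ?thesis unfolding eq using j by (simp add: v'_def)
    next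
      case False
      then show ?thesis unfolding eq using x(2) that by simp
    qed
    ultimately show ?thesis by blast
  qed
qed

lemma cusp_expansion_sum:
  assumes "\<And>i. i \<in> I \<Longrightarrow> cusp_expansion (F i) (A i)"
  shows "cusp_expansion (\<lambda>z. \<Sum>i\<in>I. x i * F i z) (\<lambda>n. \<Sum>i\<in>I. x i * A i n)"
  unfolding cusp_expansion_def
proof (intro conjI ballI)
  show "(\<Sum>i\<in>I. x i * A i 0) = 0"
    using assms by (intro sum.neutral) (auto simp: cusp_expansion_def)
  fix z assume z: "z \<in> upper_half_plane"
  have "(\<lambda>n. \<Sum>i\<in>I. x i * (A i n * exp (2 * of_real pi * \<i> * z) ^ n)) sums (\<Sum>i\<in>I. x i * F i z)"
    using assms z by (intro sums_sum sums_mult) (auto simp: cusp_expansion_def)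
  then show "(\<lambda>n. (\<Sum>i\<in>I. x i * A i n) * exp (2 * of_real pi * \<i> * z) ^ n) sums (\<Sum>i\<in>I. x i * F i z)"
    by (simp add: sum_distrib_right mult.assoc)
qed

lemma cusp_forms_sum:
  assumes F: "\<And>i. i \<in> I \<Longrightarrow> F i \<in> cusp_forms k"
  shows "(\<lambda>z. \<Sum>i\<in>I. x i * F i z) \<in> cusp_forms k"
proof -
  have "\<forall>i. \<exists>a. i \<in> I \<longrightarrow> cusp_expansion (F i) a"
    using cusp_form_expansionE[OF F] by metis
  then obtain A where "\<And>i. i \<in> I \<Longrightarrow> cusp_expansion (F i) (A i)" by metis
  then have "cusp_expansion (\<lambda>z. \<Sum>i\<in>I. x i * F i z) (\<lambda>n. \<Sum>i\<in>I. x i * A i n)"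
    by (rule cusp_expansion_sum)
  then have "\<exists>a. cusp_expansion (\<lambda>z. \<Sum>i\<in>I. x i * F i z) a" by blast
  then show ?thesis
    using F unfolding cusp_forms_def
    by (auto intro!: holomorphic_intros sum.neutral sum.cong simp: sum_distrib_left)
qed

lemma hecke_op_sum:
  "hecke_op k n (\<lambda>z. \<Sum>i\<in>I. x i * F i z) z = (\<Sum>i\<in>I. x i * hecke_op k n (F i) z)"
proof -
  have "(\<Sum>d | d dvd n. \<Sum>b<d. (\<Sum>i\<in>I. x i * F i ((of_nat (n div d) * z + of_nat b) / of_nat d)) / of_nat d ^ k) =
     (\<Sum>d | d dvd n. \<Sum>i\<in>I. \<Sum>b<d. x i * (F i ((of_nat (n div d) * z + of_nat b) / of_nat d) / of_nat d ^ k))"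
    by (intro sum.cong refl, subst sum.swap) (simp add: sum_divide_distrib)
  also have "\<dots> = (\<Sum>i\<in>I. x i * (\<Sum>d | d dvd n. \<Sum>b<d. F i ((of_nat (n div d) * z + of_nat b) / of_nat d) / of_nat d ^ k))"
    by (subst sum.swap) (simp add: sum_distrib_left)
  finally show ?thesis
    by (simp add: hecke_op_def sum_distrib_left mult_ac)
qed

section \<open>Coefficients and linear independence of normalized eigenforms\<close>

definition fcoeff :: "(complex \<Rightarrow> complex) \<Rightarrow> nat \<Rightarrow> complex" where
  "fcoeff f = (SOME a. cusp_expansion f a \<and> a 1 = 1)"

lemma normalized_eigenform:
  assumes "f \<in> normalized_eigenforms k"
  shows "f \<in> cusp_forms k" "f \<noteq> (\<lambda>z. 0)" "cusp_expansion f (fcoeff f)" "fcoeff f 1 = 1"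
    "\<And>n z. n \<ge> 1 \<Longrightarrow> Im z > 0 \<Longrightarrow> hecke_op k n f z = fcoeff f n * f z"
    "\<And>n. Im (fcoeff f n) = 0"
    "\<And>n. norm (fcoeff f n) \<le> real n * sqrt n ^ k"
proof -
  have eig: "hecke_eigenform k f" and ex: "\<exists>a. cusp_expansion f a \<and> a 1 = 1"
    using assms by (auto simp: normalized_eigenforms_def)
  show f: "f \<in> cusp_forms k" and nz: "f \<noteq> (\<lambda>z. 0)" using eig by (auto simp: hecke_eigenform_def)
  have "cusp_expansion f (fcoeff f) \<and> fcoeff f 1 = 1"
    unfolding fcoeff_def by (rule someI_ex[OF ex])
  then show a: "cusp_expansion f (fcoeff f)" and a1: "fcoeff f 1 = 1" by auto
  show ev: "hecke_op k n f z = fcoeff f n * f z" if n: "n \<ge> 1" and z: "Im z > 0" for n z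
  proof -
    obtain ev where ev: "\<And>z. Im z > 0 \<Longrightarrow> hecke_op k n f z = ev * f z"
      using eig n by (auto simp: hecke_eigenform_def upper_half_plane_def)
    have "ev * fcoeff f 1 = fcoeff f n" by (rule hecke_eigenvalue_eq_coeff[OF a n ev])
    with ev[OF z] a1 show ?thesis by simp
  qed
  show "Im (fcoeff f n) = 0" for n
  proof (cases "n = 0")
    case True
    then show ?thesis using a by (simp add: cusp_expansion_def)
  next
    case False
    then show ?thesis using ev[of n] by (intro hecke_eigenvalue_real[OF f nz, of n]) auto
  qed
  show "norm (fcoeff f n) \<le> real n * sqrt n ^ k" for n
  proof (cases "n = 0")
    case True
    then show ?thesis using a by (simp add: cusp_expansion_def)
  next
    case False
    then show ?thesis using ev[of n] by (intro hecke_eigenvalue_bound[OF f nz, of n]) auto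
  qed
qed

lemma fcoeff_separates:
  assumes f: "f \<in> normalized_eigenforms k" and g: "g \<in> normalized_eigenforms k" and "f \<noteq> g"
  obtains n where "n \<ge> 1" "fcoeff f n \<noteq> fcoeff g n"
proof -
  have "fcoeff f \<noteq> fcoeff g"
  proof
    assume eq: "fcoeff f = fcoeff g"
    have "f z = g z" if "Im z > 0" for z
      using cusp_expansion_sums[OF normalized_eigenform(3)[OF f] that]
        cusp_expansion_sums[OF normalized_eigenform(3)[OF g] that] by (simp add: eq sums_iff)
    with cusp_form_eqI[OF normalized_eigenform(1)[OF f] normalized_eigenform(1)[OF g]] assms(3)
    show False by blast
  qed
  then obtain n where n: "fcoeff f n \<noteq> fcoeff g n" by blast
  have "fcoeff f 0 = fcoeff g 0"
    using normalized_eigenform(3)[OF f] normalized_eigenform(3)[OF g] by (simp add: cusp_expansion_def)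
  then have "n \<ge> 1" using n by (metis One_nat_def Suc_leI gr0I)
  with n that show ?thesis by blast
qed

text \<open>Applying T_n and subtracting a_n(f0) times the relation eliminates f0 and multiplies the
  other coefficients by a_n(f) - a_n(f0). The index n may be chosen separately for each f, so that
  this factor is nonzero.\<close>

lemma normalized_eigenforms_independent:
  assumes "finite S" "S \<subseteq> normalized_eigenforms k" "\<And>z. Im z > 0 \<Longrightarrow> (\<Sum>f\<in>S. x f * f z) = 0" "f \<in> S"
  shows "x f = 0"
  using assms
proof (induction S arbitrary: x f rule: finite_induct)
  case (insert f0 S)
  have f0: "f0 \<in> normalized_eigenforms k" and S: "S \<subseteq> normalized_eigenforms k" using insert.prems by auto
  have rel: "x f0 * f0 z + (\<Sum>f\<in>S. x f * f z) = 0" if "Im z > 0" for z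
    using insert.prems(2)[OF that] insert.hyps by simp
  have rel': "(\<Sum>f\<in>S. (x f * (fcoeff f n - fcoeff f0 n)) * f z) = 0" if n: "n \<ge> 1" and z: "Im z > 0" for n z
  proof -
    have "(\<lambda>z. \<Sum>f\<in>insert f0 S. x f * f z) = (\<lambda>z. 0)"
    proof (rule cusp_form_zero_offI)
      show "(\<lambda>z. \<Sum>f\<in>insert f0 S. x f * f z) \<in> cusp_forms k"
        using insert.prems(1) normalized_eigenform(1) by (intro cusp_forms_sum) auto
    qed (rule insert.prems(2))
    then have "hecke_op k n (\<lambda>z. \<Sum>f\<in>insert f0 S. x f * f z) z = 0" by (simp add: hecke_op_def)
    then have "(\<Sum>f\<in>insert f0 S. x f * hecke_op k n f z) = 0" by (simp only: hecke_op_sum)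
    moreover have "(\<Sum>f\<in>S. x f * hecke_op k n f z) = (\<Sum>f\<in>S. x f * (fcoeff f n * f z))"
      using S n z by (intro sum.cong refl) (auto simp: normalized_eigenform(5))
    ultimately have "x f0 * (fcoeff f0 n * f0 z) + (\<Sum>f\<in>S. x f * (fcoeff f n * f z)) = 0"
      using insert.hyps by (simp add: normalized_eigenform(5)[OF f0 n z])
    moreover have "fcoeff f0 n * (x f0 * f0 z) + (\<Sum>f\<in>S. fcoeff f0 n * (x f * f z)) = 0"
      using arg_cong[OF rel[OF z], of "\<lambda>t. fcoeff f0 n * t"] by (simp add: ring_distribs sum_distrib_left)
    ultimately have "(\<Sum>f\<in>S. x f * (fcoeff f n * f z)) - (\<Sum>f\<in>S. fcoeff f0 n * (x f * f z)) = 0"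
      by (simp add: mult_ac add_eq_0_iff)
    then show ?thesis by (simp add: sum_subtractf[symmetric] algebra_simps)
  qed
  have x0: "x f = 0" if fS: "f \<in> S" for f
  proof -
    have "f \<noteq> f0" using fS insert.hyps by auto
    then obtain n where n: "n \<ge> 1" "fcoeff f n \<noteq> fcoeff f0 n"
      using fcoeff_separates[of f k f0] S fS f0 by blast
    have "x f * (fcoeff f n - fcoeff f0 n) = 0"
      by (rule insert.IH[OF S rel'[OF n(1)] fS])
    then show ?thesis using n by simp
  qed
  moreover have "x f0 = 0"
  proof -
    obtain z where z: "Im z > 0" "f0 z \<noteq> 0"
      using cusp_form_zero_offI[OF normalized_eigenform(1)[OF f0]] normalized_eigenform(2)[OF f0] by blast
    then show ?thesis using rel[OF z(1)] x0 by simp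
  qed
  ultimately show ?case using insert.prems(3) by auto
qed simp

lemma finite_normalized_eigenforms: "finite (normalized_eigenforms k)"
proof (rule ccontr)
  assume "infinite (normalized_eigenforms k)"
  then obtain S where S: "finite S" "card S = 2 * k + 3" "S \<subseteq> normalized_eigenforms k"
    using infinite_arbitrarily_large by blast
  obtain x where x: "\<exists>f\<in>S. x f \<noteq> 0" "\<forall>n<2 * k + 2. (\<Sum>f\<in>S. x f * fcoeff f n) = 0"
    using exists_linear_relation[of S "2 * k + 2" fcoeff] S by auto
  let ?g = "\<lambda>z. \<Sum>f\<in>S. x f * f z"
  have "?g = (\<lambda>z. 0)"
  proof (rule cusp_form_eq_0I)
    show "?g \<in> cusp_forms k" using S normalized_eigenform(1) by (intro cusp_forms_sum) auto
    show "cusp_expansion ?g (\<lambda>n. \<Sum>f\<in>S. x f * fcoeff f n)"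
      using S normalized_eigenform(3) by (intro cusp_expansion_sum) auto
  qed (use x in auto)
  then have "(\<Sum>f\<in>S. x f * f z) = 0" for z by meson
  then have "x f = 0" if "f \<in> S" for f
    using normalized_eigenforms_independent[OF S(1,3) _ that] by blast
  with x(1) show False by blast
qed

lemma finite_comb_forms: "finite (comb_forms k c a)"
proof -
  let ?L = "\<lambda>n. {xs. set xs \<subseteq> normalized_eigenforms k \<and> length xs = n}"
  have "comb_forms k c a \<subseteq> (\<lambda>(fs, gs) z. (\<Sum>l<length c. of_real (c ! l) * (fs ! l) z) - (\<Sum>j<length a. of_real (a ! j) * (gs ! j) z)) `
      (?L (length c) \<times> ?L (length a))"
    unfolding comb_forms_def by auto
  moreover have "finite (?L n)" for n
    by (rule finite_lists_length_eq[OF finite_normalized_eigenforms])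
  ultimately show ?thesis by (meson finite_SigmaI finite_imageI finite_subset)
qed

section \<open>Integrals over the positive half line\<close>

text \<open>The same detour through \<open>real ^ 2\<close> as for \<open>hyp_measure\<close>, here
  for the values rather than for the domain.\<close>

lemma change_of_variables_1_complex:
  fixes F :: "real \<Rightarrow> complex" and g :: "real \<Rightarrow> real"
  assumes S: "S \<in> sets lebesgue" and der: "\<And>x. x \<in> S \<Longrightarrow> (g has_field_derivative g' x) (at x within S)"
    and inj: "inj_on g S" and F: "F absolutely_integrable_on (g ` S)"
  shows "(\<lambda>x. \<bar>g' x\<bar> *\<^sub>R F (g x)) absolutely_integrable_on S"
    and "integral S (\<lambda>x. \<bar>g' x\<bar> *\<^sub>R F (g x)) = integral (g ` S) F"
proof -
  have der': "(g has_vector_derivative g' x) (at x within S)" if "x \<in> S" for x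
    using der[OF that] by (simp add: has_real_derivative_iff_has_vector_derivative)
  define H where "H = cvec \<circ> F"
  have H: "H absolutely_integrable_on (g ` S)"
    unfolding H_def by (rule absolutely_integrable_linear[OF F bounded_linear_cvec])
  have Hi: "integral (g ` S) H = cvec (integral (g ` S) F)"
    unfolding H_def by (rule integral_linear[OF _ bounded_linear_cvec]) (use F in \<open>simp add: absolutely_integrable_on_def\<close>)
  have *: "(\<lambda>x. \<bar>g' x\<bar> *\<^sub>R H (g x)) absolutely_integrable_on S"
    "integral S (\<lambda>x. \<bar>g' x\<bar> *\<^sub>R H (g x)) = integral (g ` S) H"
    using has_absolute_integral_change_of_variables_1[OF S der' inj, of H "integral (g ` S) H"] H by blast+
  have eq: "(\<lambda>x::real^2. vcx x) \<circ> (\<lambda>x. \<bar>g' x\<bar> *\<^sub>R H (g x)) = (\<lambda>x. \<bar>g' x\<bar> *\<^sub>R F (g x))"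
    by (rule ext) (simp add: H_def bounded_linear.linear[OF bounded_linear_vcx] linear_scale complex_eq_iff)
  show "(\<lambda>x. \<bar>g' x\<bar> *\<^sub>R F (g x)) absolutely_integrable_on S"
    using absolutely_integrable_linear[OF *(1) bounded_linear_vcx] unfolding eq .
  have "integral S (\<lambda>x. \<bar>g' x\<bar> *\<^sub>R F (g x)) = vcx (integral S (\<lambda>x. \<bar>g' x\<bar> *\<^sub>R H (g x)))"
    unfolding eq[symmetric]
    by (rule integral_linear[OF _ bounded_linear_vcx]) (use *(1) in \<open>simp add: absolutely_integrable_on_def\<close>)
  also have "\<dots> = integral (g ` S) F" unfolding *(2) Hi by (rule vcx_cvec)
  finally show "integral S (\<lambda>x. \<bar>g' x\<bar> *\<^sub>R F (g x)) = integral (g ` S) F" .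
qed

lemma integral_inversion:
  fixes F :: "real \<Rightarrow> complex"
  assumes s: "s > 0" and F: "F absolutely_integrable_on {1/s..}"
  shows "(\<lambda>x. F (1 / x) / of_real x ^ 2) absolutely_integrable_on {0<..s}"
    and "integral {0<..s} (\<lambda>x. F (1 / x) / of_real x ^ 2) = integral {1/s..} F"
proof -
  have img: "(\<lambda>x. 1 / x) ` {0<..s} = {1/s..}"
  proof (intro equalityI subsetI)
    fix y assume "y \<in> {1/s..}"
    then have y: "y \<ge> 1 / s" by simp
    then have "y > 0" using s by (meson divide_pos_pos less_le_trans zero_less_one)
    with y s have "1 / y \<in> {0<..s}" by (simp add: field_simps)
    then show "y \<in> (\<lambda>x. 1 / x) ` {0<..s}" by (intro image_eqI[of _ _ "1 / y"]) auto
  qed (use s in \<open>auto simp: field_simps\<close>)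
  have der: "((\<lambda>x. 1 / x) has_field_derivative (- (1 / x ^ 2))) (at x within {0<..s})" if "x \<in> {0<..s}" for x
    using that by (auto intro!: derivative_eq_intros simp: power2_eq_square)
  have inj: "inj_on (\<lambda>x::real. 1 / x) {0<..s}" by (auto simp: inj_on_def)
  have S: "{0<..s} \<in> sets lebesgue" by simp
  have cv: "(\<lambda>x. \<bar>- (1 / x ^ 2)\<bar> *\<^sub>R F (1 / x)) absolutely_integrable_on {0<..s}"
    "integral {0<..s} (\<lambda>x. \<bar>- (1 / x ^ 2)\<bar> *\<^sub>R F (1 / x)) = integral {1/s..} F"
    using change_of_variables_1_complex[OF S der inj, of F] F unfolding img by blast+
  have eq: "\<bar>- (1 / x ^ 2)\<bar> *\<^sub>R F (1 / x) = F (1 / x) / of_real x ^ 2" for x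
    by (simp add: scaleR_conv_of_real)
  show "(\<lambda>x. F (1 / x) / of_real x ^ 2) absolutely_integrable_on {0<..s}"
    "integral {0<..s} (\<lambda>x. F (1 / x) / of_real x ^ 2) = integral {1/s..} F"
    using cv unfolding eq by blast+
qed

lemma integral_atLeast_greaterThan:
  fixes F :: "real \<Rightarrow> complex"
  shows "integral {c..} F = integral {c<..} F"
proof (rule integral_spike_set)
  show "negligible {x \<in> {c..} - {c<..}. F x \<noteq> 0}" "negligible {x \<in> {c<..} - {c..}. F x \<noteq> 0}"
    by (rule negligible_subset[of "{c}"], auto)+
qed

lemma integral_translate:
  fixes F :: "real \<Rightarrow> complex"
  assumes F: "F absolutely_integrable_on {c..}"
  shows "integral {0..} (\<lambda>t. F (c + t)) = integral {c..} F"
proof -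
  have img: "(\<lambda>t. c + t) ` {0..} = {c..}"
    using image_add_atLeast[of c 0] by simp
  have der: "((\<lambda>t. c + t) has_field_derivative 1) (at x within {0..})" for x
    by (auto intro!: derivative_eq_intros)
  have inj: "inj_on (\<lambda>t. c + t) {0..}" by (auto simp: inj_on_def)
  have S: "{0::real..} \<in> sets lebesgue" by simp
  show ?thesis
    using change_of_variables_1_complex(2)[OF S der inj, of F] F unfolding img by simp
qed

lemma power_exp_integral:
  assumes c: "c > 0"
  shows "(\<lambda>t. t ^ j * exp (- c * t)) absolutely_integrable_on {0<..}"
    and "integral {0<..} (\<lambda>t::real. t ^ j * exp (- c * t)) = fact j / c ^ Suc j"
proof -
  let ?f = "\<lambda>t::real. t ^ j * exp (- t)"
  have "((\<lambda>t. t powr (real (Suc j) - 1) / exp t) has_integral Gamma (real (Suc j))) {0..}"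
    by (rule Gamma_integral_real) simp
  also have "?this \<longleftrightarrow> ((\<lambda>t. t powr (real (Suc j) - 1) / exp t) has_integral Gamma (real (Suc j))) {0<..}"
    by (rule has_integral_spike_set_eq) (rule negligible_subset[of "{0}"], auto)+
  finally have hi: "(?f has_integral fact j) {0<..}"
    by (subst (asm) has_integral_cong[where g = ?f])
       (auto simp: powr_realpow exp_minus divide_inverse Gamma_fact)
  have abs: "?f absolutely_integrable_on {0<..}"
    using hi by (intro nonnegative_absolutely_integrable_1) (auto simp: integrable_on_def)
  have img: "(\<lambda>t. c * t) ` {0<..} = {0<..}"
  proof (intro equalityI subsetI)
    fix y :: real assume "y \<in> {0<..}"
    then show "y \<in> (\<lambda>t. c * t) ` {0<..}" using c by (intro image_eqI[of _ _ "y / c"]) auto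
  qed (use c in auto)
  have der: "((\<lambda>t. c * t) has_field_derivative c) (at x within {0<..})" for x
    by (auto intro!: derivative_eq_intros)
  have inj: "inj_on (\<lambda>t. c * t) {0<..}" using c by (auto simp: inj_on_def)
  have S: "{0::real<..} \<in> sets lebesgue" by simp
  have cv: "(\<lambda>t. \<bar>c\<bar> * ?f (c * t)) absolutely_integrable_on {0<..} \<and>
      integral {0<..} (\<lambda>t. \<bar>c\<bar> * ?f (c * t)) = fact j"
    using has_absolute_integral_change_of_variables_1'[OF S der inj, of ?f "fact j"] abs hi
    unfolding img by (simp add: integral_unique)
  have eq: "t ^ j * exp (- c * t) = (1 / c ^ Suc j) * (\<bar>c\<bar> * ?f (c * t))" for t
    using c by (simp add: power_mult_distrib field_simps)
  show "(\<lambda>t. t ^ j * exp (- c * t)) absolutely_integrable_on {0<..}"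
    unfolding eq by (rule set_integrable_mult_right) (rule conjunct1[OF cv])
  show "integral {0<..} (\<lambda>t::real. t ^ j * exp (- c * t)) = fact j / c ^ Suc j"
    unfolding eq by (subst integral_mult_right) (use cv in simp)
qed

abbreviation mellin_factor :: "nat \<Rightarrow> nat \<Rightarrow> real" where
  "mellin_factor j l \<equiv> fact j / (2 * pi * real l) ^ Suc j"

lemma norm_mellin_term:
  fixes x :: complex
  shows "norm (x * of_real (mellin_factor j l)) = norm x / real l ^ Suc j * (fact j / (2 * pi) ^ Suc j)"
  by (simp add: norm_mult norm_divide norm_power power_mult_distrib abs_mult del: power_Suc)

text \<open>Term-by-term integration of an exponential series, with the Gamma integral
  \<open>power_exp_integral\<close> for each term. It serves the Eichler integral (with
  \<open>a l * qexp z ^ l\<close>), the moments (with \<open>a l\<close>) and a majorant (with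
  absolute values).\<close>

lemma mellin_transform_sums:
  fixes b :: "nat \<Rightarrow> complex"
  assumes b0: "b 0 = 0" and b: "summable (\<lambda>l. norm (b l) / real l ^ Suc j)"
    and G: "\<And>t. t > 0 \<Longrightarrow> (\<lambda>l. b l * of_real (exp (- 2 * pi * real l * t))) sums G t"
  shows "(\<lambda>t. G t * of_real (t ^ j)) absolutely_integrable_on {0<..}"
    and "(\<lambda>l. b l * of_real (mellin_factor j l)) sums integral {0<..} (\<lambda>t. G t * of_real (t ^ j))"
proof -
  define e where "e = (\<lambda>l t. t ^ j * exp (- (2 * pi * real l) * t))"
  define F where "F = (\<lambda>l t. indicator {0<..} t *\<^sub>R (b l * of_real (e l t)))"
  have e: "e l absolutely_integrable_on {0<..}" "integral {0<..} (e l) = mellin_factor j l"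
    if "l > 0" for l
    unfolding e_def using power_exp_integral[of "2 * pi * real l" j] that by simp_all
  have e_nonneg: "t > 0 \<Longrightarrow> e l t \<ge> 0" for l t by (simp add: e_def)
  have bF: "(\<lambda>t. b l * of_real (e l t)) absolutely_integrable_on {0<..}" for l
  proof (cases "l = 0")
    case False
    have "(of_real \<circ> e l :: real \<Rightarrow> complex) absolutely_integrable_on {0<..}"
      using e(1)[of l] False by (intro absolutely_integrable_linear bounded_linear_of_real) auto
    then show ?thesis by (intro set_integrable_mult_right) (simp add: o_def)
  qed (simp add: b0)
  have F_int: "integrable lebesgue (F l)" for l
    using bF[of l] unfolding F_def set_integrable_def .
  have F_integral: "integral\<^sup>L lebesgue (F l) = b l * of_real (mellin_factor j l)" for l
  proof (cases "l = 0")
    case False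
    have "integral\<^sup>L lebesgue (F l) = integral {0<..} (\<lambda>t. b l * of_real (e l t))"
      using set_lebesgue_integral_eq_integral(2)[OF bF[of l]] unfolding F_def set_lebesgue_integral_def .
    also have "\<dots> = b l * integral {0<..} (of_real \<circ> e l)" by (simp add: o_def)
    also have "integral {0<..} (of_real \<circ> e l :: real \<Rightarrow> complex) = of_real (integral {0<..} (e l))"
      using e(1)[of l] False by (intro integral_linear bounded_linear_of_real) (auto simp: absolutely_integrable_on_def)
    finally show ?thesis using False by (simp add: e(2))
  qed (simp add: F_def b0)
  have normF: "(\<integral>t. norm (F l t) \<partial>lebesgue) = (fact j / (2 * pi) ^ Suc j) * (norm (b l) / real l ^ Suc j)" for l
  proof (cases "l = 0")
    case False
    have "norm (F l t) = norm (b l) * (indicator {0<..} t *\<^sub>R e l t)" for t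
      using e_nonneg[of t l] by (auto simp: F_def norm_mult indicator_def)
    then have "(\<integral>t. norm (F l t) \<partial>lebesgue) = norm (b l) * (\<integral>t. indicator {0<..} t *\<^sub>R e l t \<partial>lebesgue)"
      by simp
    also have "(\<integral>t. indicator {0<..} t *\<^sub>R e l t \<partial>lebesgue) = mellin_factor j l"
      using set_lebesgue_integral_eq_integral(2)[OF e(1)[of l]] e(2)[of l] False
      unfolding set_lebesgue_integral_def by simp
    finally show ?thesis by (simp add: power_mult_distrib mult_ac del: power_Suc)
  qed (simp add: F_def b0)
  have summ: "summable (\<lambda>l. \<integral>t. norm (F l t) \<partial>lebesgue)"
    unfolding normF by (intro summable_mult b)
  \<comment> \<open>Pointwise convergence follows from the same hypothesis, because exp (-x) is at
    most (j+1)! / x^(j+1) for x > 0.\<close>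
  have ptw: "summable (\<lambda>l. norm (F l t))" for t
  proof (cases "t > 0")
    case True
    define K where "K = t ^ j * (fact (Suc j) / (2 * pi * t) ^ Suc j)"
    have "norm (F l t) \<le> K * (norm (b l) / real l ^ Suc j)" for l
    proof (cases "l = 0")
      case False
      have "(2 * pi * real l * t) ^ Suc j \<le> fact (Suc j) * exp (2 * pi * real l * t)"
        using True by (intro power_le_fact_mult_exp) simp
      then have "exp (- (2 * pi * real l) * t) \<le> fact (Suc j) / (2 * pi * real l * t) ^ Suc j"
        using True False by (simp add: exp_minus field_simps del: power_Suc)
      then have "norm (b l) * (t ^ j * exp (- (2 * pi * real l) * t)) \<le> norm (b l) * (t ^ j * (fact (Suc j) / (2 * pi * real l * t) ^ Suc j))"
        using True by (intro mult_left_mono) auto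
      also have "\<dots> = K * (norm (b l) / real l ^ Suc j)"
        by (simp add: K_def power_mult_distrib mult_ac del: power_Suc fact_Suc)
      finally show ?thesis using True by (simp add: F_def e_def norm_mult norm_power del: power_Suc)
    qed (simp add: F_def b0)
    then show ?thesis
      by (intro summable_comparison_test'[OF summable_mult[OF b, of K], of 0]) simp
  qed (simp add: F_def)
  have sumF: "(\<Sum>l. F l t) = indicator {0<..} t *\<^sub>R (G t * of_real (t ^ j))" for t
  proof (cases "t > 0")
    case True
    have "(\<lambda>l. (b l * of_real (exp (- 2 * pi * real l * t))) * of_real (t ^ j)) sums (G t * of_real (t ^ j))"
      by (intro sums_mult2 G True)
    then show ?thesis using True by (simp add: F_def e_def sums_iff mult_ac)
  qed (simp add: F_def)
  have "integrable lebesgue (\<lambda>t. \<Sum>l. F l t)"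
    by (rule integrable_suminf[OF F_int _ summ]) (simp add: ptw)
  then show abs: "(\<lambda>t. G t * of_real (t ^ j)) absolutely_integrable_on {0<..}"
    unfolding sumF set_integrable_def .
  have "(\<lambda>l. integral\<^sup>L lebesgue (F l)) sums (\<integral>t. (\<Sum>l. F l t) \<partial>lebesgue)"
    by (rule sums_integral[OF F_int _ summ]) (simp add: ptw)
  also have "(\<integral>t. (\<Sum>l. F l t) \<partial>lebesgue) = integral {0<..} (\<lambda>t. G t * of_real (t ^ j))"
    using set_lebesgue_integral_eq_integral(2)[OF abs] unfolding sumF set_lebesgue_integral_def .
  finally show "(\<lambda>l. b l * of_real (mellin_factor j l)) sums integral {0<..} (\<lambda>t. G t * of_real (t ^ j))"
    unfolding F_integral .
qed

section \<open>The period polynomial in terms of moments\<close>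

text \<open>Integrating term by term shows the Eichler integral to be a power series in q, namely
  the original coefficients times \<open>mellin_factor\<close>. Holomorphy is what lets
  \<open>period_poly_eq\<close> be checked on the imaginary axis only.\<close>

lemma eichler_integral_holomorphic:
  assumes a: "cusp_expansion f a"
  shows "eichler_integral k f holomorphic_on upper_half_plane"
proof -
  define N where "N = k - 2"
  define c where "c = (\<lambda>l. a l * of_real (mellin_factor N l))"
  have sums: "(\<lambda>l. c l * qexp z ^ l) sums (eichler_integral k f z / \<i> ^ Suc N)" if z: "Im z > 0" for z
  proof -
    have abs: "summable (\<lambda>l. norm (a l * qexp z ^ l))"
      by (rule cusp_expansion_summable[OF a norm_qexp_less_1[OF z]])
    have 1: "summable (\<lambda>l. norm (a l * qexp z ^ l) / real l ^ Suc N)"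
    proof (rule summable_comparison_test'[OF abs, of 0])
      fix l :: nat
      show "norm (norm (a l * qexp z ^ l) / real l ^ Suc N) \<le> norm (a l * qexp z ^ l)"
      proof (cases "l = 0")
        case False
        then have "1 \<le> real l ^ Suc N" by (intro one_le_power) simp
        then show ?thesis by (simp add: divide_le_eq mult_le_cancel_left1 del: power_Suc)
      qed simp
    qed
    have 2: "(\<lambda>l. (a l * qexp z ^ l) * of_real (exp (- 2 * pi * real l * t))) sums f (z + \<i> * of_real t)"
      if "t > 0" for t
      using z that by (intro cusp_expansion_vertical[OF a]) simp
    have "(\<lambda>l. (a l * qexp z ^ l) * of_real (mellin_factor N l)) sums
        integral {0<..} (\<lambda>t. f (z + \<i> * of_real t) * of_real (t ^ N))"
      by (rule mellin_transform_sums(2)[OF _ 1 2]) (use a in \<open>simp_all add: cusp_expansion_def\<close>)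
    moreover have "eichler_integral k f z = integral {0<..} (\<lambda>t. f (z + \<i> * of_real t) * of_real (t ^ N) * \<i> ^ Suc N)"
      unfolding eichler_integral_def integral_atLeast_greaterThan
      by (rule integral_cong) (simp add: N_def power_mult_distrib mult_ac)
    ultimately show ?thesis by (simp add: c_def mult_ac del: power_Suc of_real_divide)
  qed
  have hol: "(\<lambda>w. \<Sum>l. c l * w ^ l) holomorphic_on ball 0 1"
    by (rule disc_power_series_holomorphic) (rule sums_summable[OF sums])
  have "(\<lambda>z. \<i> ^ Suc N * (\<Sum>l. c l * qexp z ^ l)) holomorphic_on upper_half_plane"
  proof (intro holomorphic_intros)
    have "((\<lambda>w. \<Sum>l. c l * w ^ l) \<circ> qexp) holomorphic_on upper_half_plane"
    proof (rule holomorphic_on_compose_gen[OF _ hol])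
      show "qexp holomorphic_on upper_half_plane" unfolding qexp_def by (intro holomorphic_intros)
      show "qexp ` upper_half_plane \<subseteq> ball 0 1" using norm_qexp_less_1 by (auto simp: upper_half_plane_def)
    qed
    then show "(\<lambda>z. \<Sum>l. c l * qexp z ^ l) holomorphic_on upper_half_plane" by (simp add: o_def)
  qed
  then show ?thesis
    by (rule holomorphic_transform) (use sums in \<open>auto simp: upper_half_plane_def sums_iff\<close>)
qed

section \<open>Moments on the imaginary axis and their functional equation\<close>

abbreviation axis_moment :: "(complex \<Rightarrow> complex) \<Rightarrow> nat \<Rightarrow> real \<Rightarrow> complex" where
  "axis_moment f j \<equiv> \<lambda>v. f (\<i> * of_real v) * of_real (v ^ j)"

text \<open>The Mellin transform of f, that is the completed L-value j! (2 pi)^(-j-1) L(f, j+1), for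
  0 <= j <= k - 2 in the applications.\<close>

definition moment :: "(complex \<Rightarrow> complex) \<Rightarrow> nat \<Rightarrow> complex" where
  "moment f j = integral {0<..} (axis_moment f j)"

lemma cusp_form_inversion:
  assumes f: "f \<in> cusp_forms k" and v: "v > 0"
  shows "f (\<i> * of_real (1 / v)) = \<i> ^ k * of_real (v ^ k) * f (\<i> * of_real v)"
proof -
  have "mob (0, -1, 1, 0) (\<i> * of_real v) = \<i> * of_real (1 / v)"
    using v by (simp add: field_simps)
  then show ?thesis
    using cusp_form_transform[OF f, of "(0, -1, 1, 0)" "\<i> * of_real v"] v
    by (simp add: power_mult_distrib)
qed

lemma cusp_form_tail_integrable:
  assumes f: "f \<in> cusp_forms k" and s: "s > 0"
  shows "(axis_moment f j) absolutely_integrable_on {s..}"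
proof -
  obtain a where a: "cusp_expansion f a" using cusp_form_expansionE[OF f] .
  obtain C where C: "C \<ge> 0" "\<And>z. Im z \<ge> s \<Longrightarrow> norm (f z) \<le> C * exp (- 2 * pi * Im z)"
    using cusp_form_decay[OF a s] by blast
  show ?thesis
  proof (rule measurable_bounded_by_integrable_imp_absolutely_integrable)
    have "continuous_on {s..} (\<lambda>v. f (\<i> * of_real v))"
      by (rule continuous_on_compose2[OF holomorphic_on_imp_continuous_on[OF cusp_form_holomorphic[OF f]]])
         (use s in \<open>auto intro!: continuous_intros simp: upper_half_plane_def\<close>)
    then have "continuous_on {s..} (axis_moment f j)"
      by (intro continuous_intros)
    then show "(axis_moment f j) \<in> borel_measurable (lebesgue_on {s..})"
      by (rule continuous_imp_measurable_on_sets_lebesgue) simp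
    show "(\<lambda>v. C * fact j * exp (- 1 * v)) integrable_on {s..}"
      by (intro integrable_on_mult_right integrable_on_exp_minus_to_infinity) simp
    fix v assume "v \<in> {s..}"
    then have v: "v \<ge> s" "v > 0" using s by auto
    have "norm (f (\<i> * of_real v) * of_real (v ^ j)) \<le> (C * exp (- 2 * pi * v)) * (fact j * exp v)"
      unfolding norm_mult using C(2)[of "\<i> * of_real v"] v power_le_fact_mult_exp[of v j]
      by (intro mult_mono) (use C(1) in \<open>auto simp: norm_power\<close>)
    also have "\<dots> = C * fact j * exp (v - 2 * pi * v)"
      by (simp add: exp_diff exp_minus field_simps)
    also have "\<dots> \<le> C * fact j * exp (- 1 * v)"
      using mult_right_mono[of 1 pi v] v pi_ge_two C by (intro mult_left_mono) auto
    finally show "norm (f (\<i> * of_real v) * of_real (v ^ j)) \<le> C * fact j * exp (- 1 * v)" .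
  qed simp
qed

text \<open>The q-expansion shows no decay towards 0; the inversion v -> 1/v moves the head of the
  integral to the cusp, changing the exponent j into k - 2 - j.\<close>

lemma cusp_form_head:
  assumes f: "f \<in> cusp_forms k" and k: "k = N + 2" and j: "j \<le> N" and s: "s > 0"
  shows "(axis_moment f j) absolutely_integrable_on {0<..s}"
    and "\<i> ^ k * integral {0<..s} (axis_moment f j) =
      integral {1/s..} (axis_moment f (N - j))"
proof -
  let ?F = "\<lambda>v. f (\<i> * of_real v) * of_real (v ^ (N - j)) :: complex"
  let ?G = "\<lambda>v. f (\<i> * of_real v) * of_real (v ^ j) :: complex"
  have F: "?F absolutely_integrable_on {1/s..}"
    using s by (intro cusp_form_tail_integrable[OF f]) simp
  have eq: "?F (1 / x) / of_real x ^ 2 = \<i> ^ k * ?G x" if "x \<in> {0<..s}" for x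
  proof -
    have x: "x > 0" using that by simp
    have "x ^ k = x ^ j * x ^ (N - j) * x ^ 2" using j by (simp add: k flip: power_add)
    then have "x ^ k * (1 / x) ^ (N - j) / x ^ 2 = x ^ j" using x by (simp add: power_divide)
    then have *: "of_real (x ^ k * (1 / x) ^ (N - j) / x ^ 2) = (of_real (x ^ j) :: complex)"
      by (simp only:)
    have "?F (1 / x) / of_real x ^ 2 = \<i> ^ k * f (\<i> * of_real x) * of_real (x ^ k * (1 / x) ^ (N - j) / x ^ 2)"
      unfolding cusp_form_inversion[OF f x] by simp
    then show ?thesis unfolding * by simp
  qed
  have "(\<lambda>v. \<i> ^ k * ?G v) absolutely_integrable_on {0<..s} \<longleftrightarrow> (\<lambda>x. ?F (1 / x) / of_real x ^ 2) absolutely_integrable_on {0<..s}"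
    by (rule set_integrable_cong[OF refl refl]) (rule eq[symmetric])
  with integral_inversion(1)[OF s F] have "(\<lambda>v. \<i> ^ k * ?G v) absolutely_integrable_on {0<..s}" by blast
  then show "?G absolutely_integrable_on {0<..s}" by (subst (asm) set_integrable_mult_right_iff) simp_all
  have "\<i> ^ k * integral {0<..s} ?G = integral {0<..s} (\<lambda>v. \<i> ^ k * ?G v)" by simp
  also have "\<dots> = integral {0<..s} (\<lambda>x. ?F (1 / x) / of_real x ^ 2)"
    by (rule integral_cong) (rule eq[symmetric])
  also have "\<dots> = integral {1/s..} ?F" by (rule integral_inversion(2)[OF s F])
  finally show "\<i> ^ k * integral {0<..s} ?G = integral {1/s..} ?F" .
qed

lemma integral_split_half_line:
  fixes F :: "real \<Rightarrow> complex"
  assumes s: "s > 0" and "F absolutely_integrable_on {0<..s}" "F absolutely_integrable_on {s..}"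
  shows "F absolutely_integrable_on {0<..}" "integral {0<..} F = integral {0<..s} F + integral {s..} F"
proof -
  have un: "{0<..} = {0<..s} \<union> {s..}" "{0<..} = {0<..s} \<union> {s<..}" using s by auto
  show "F absolutely_integrable_on {0<..}" unfolding un(1) using assms by (intro set_integrable_Un) auto
  have "F absolutely_integrable_on {s<..}" by (rule set_integrable_subset[OF assms(3)]) auto
  then have "F integrable_on {s<..}" "F integrable_on {0<..s}" using assms by (auto simp: absolutely_integrable_on_def)
  moreover have "{0<..s} \<inter> {s<..} = {}" by auto
  ultimately show "integral {0<..} F = integral {0<..s} F + integral {s..} F"
    unfolding un(2) integral_atLeast_greaterThan by (intro integral_Un) auto
qed

lemma cusp_form_moment_integrable:
  assumes f: "f \<in> cusp_forms k" and k: "k = N + 2" and j: "j \<le> N"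
  shows "(axis_moment f j) absolutely_integrable_on {0<..}"
  by (rule integral_split_half_line(1)[of 1, OF _ cusp_form_head(1)[OF f k j] cusp_form_tail_integrable[OF f]]) simp_all

lemma ii_power_even_square: "even k \<Longrightarrow> (\<i> ^ k) * (\<i> ^ k) = 1"
  by (elim evenE) (simp add: power_mult power_mult_distrib[symmetric])

text \<open>Both integrals start at 1, where f decays exponentially. This representation gives the
  functional equation at once and still yields bounds for the middle moments, to which the Dirichlet
  series estimate does not reach.\<close>

lemma moment_split:
  assumes f: "f \<in> cusp_forms k" and k: "k = N + 2" and j: "j \<le> N" and ev: "even k"
  shows "moment f j = integral {1..} (axis_moment f j) +
      \<i> ^ k * integral {1..} (axis_moment f (N - j))"
proof -
  let ?G = "\<lambda>j v. f (\<i> * of_real v) * of_real (v ^ j) :: complex"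
  have "\<i> ^ k * integral {0<..1} (?G j) = integral {1..} (?G (N - j))"
    using cusp_form_head(2)[OF f k j, of 1] by simp
  from this[symmetric] have "integral {0<..1} (?G j) = \<i> ^ k * integral {1..} (?G (N - j))"
    using ii_power_even_square[OF ev] by (simp flip: mult.assoc)
  moreover have "moment f j = integral {0<..1} (?G j) + integral {1..} (?G j)"
    unfolding moment_def
    by (rule integral_split_half_line(2)[of 1, OF _ cusp_form_head(1)[OF f k j] cusp_form_tail_integrable[OF f]]) simp_all
  ultimately show ?thesis by simp
qed

lemma moment_reflect:
  assumes f: "f \<in> cusp_forms k" and k: "k = N + 2" and j: "j \<le> N" and ev: "even k"
  shows "moment f j = \<i> ^ k * moment f (N - j)"
proof -
  have "moment f (N - j) = integral {1..} (axis_moment f (N - j)) +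
      \<i> ^ k * integral {1..} (axis_moment f j)"
    using moment_split[OF f k _ ev, of "N - j"] j by simp
  moreover have "x = \<i> ^ k * (\<i> ^ k * x)" for x :: complex
    using ii_power_even_square[OF ev] by (simp flip: mult.assoc)
  ultimately show ?thesis unfolding moment_split[OF f k j ev] by (simp add: ring_distribs)
qed

lemma moment_real:
  assumes f: "f \<in> cusp_forms k" and k: "k = N + 2" and j: "j \<le> N"
    and a: "cusp_expansion f a" and real: "\<And>n. Im (a n) = 0"
  shows "Im (moment f j) = 0"
proof -
  let ?G = "\<lambda>v. f (\<i> * of_real v) * of_real (v ^ j) :: complex"
  have int: "?G integrable_on {0<..}"
    using cusp_form_moment_integrable[OF f k j] by (simp add: absolutely_integrable_on_def)
  have "Im (moment f j) = integral {0<..} (Im \<circ> ?G)"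
    unfolding moment_def by (rule integral_linear[OF int bounded_linear_Im, symmetric])
  also have "\<dots> = integral {0<..} (\<lambda>v::real. 0)"
  proof (rule integral_cong)
    fix v :: real assume v: "v \<in> {0<..}"
    have "(\<lambda>n. Im (a n * of_real (exp (- 2 * pi * real n * v)))) sums Im (f (\<i> * of_real v))"
      using v by (intro sums_Im cusp_expansion_imaginary_axis[OF a]) simp
    then have "(\<lambda>n. 0) sums Im (f (\<i> * of_real v))" by (simp only: mult_of_real_Im real mult_zero_left)
    then have "Im (f (\<i> * of_real v)) = 0" using sums_unique2 sums_zero by blast
    then show "(Im \<circ> ?G) v = 0" by (simp del: of_real_power)
  qed
  finally show ?thesis by simp
qed

text \<open>On the imaginary axis the substitution \<open>v \<mapsto> 1/v\<close> turns the second Eichler integral into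
  the missing piece \<open>(0, y)\<close> of the moment integral.\<close>

lemma period_on_imaginary_axis:
  assumes f: "f \<in> cusp_forms k" and k: "k = N + 2" and ev: "even k" and y: "y > 0"
  shows "eichler_integral k f (\<i> * of_real y) - (\<i> * of_real y) ^ N * eichler_integral k f (- 1 / (\<i> * of_real y)) =
     \<i> ^ Suc N * (\<Sum>n\<le>N. of_nat (N choose n) * (\<i> * (\<i> * of_real y)) ^ n * moment f (N - n))"
proof -
  let ?\<phi> = "\<lambda>v. f (\<i> * of_real v) :: complex"
  let ?G = "\<lambda>n v. ?\<phi> v * of_real (v ^ (N - n)) :: complex"
  let ?c = "\<lambda>y n. of_nat (N choose n) * (- of_real y) ^ n :: complex"
  let ?I = "\<lambda>S y. integral S (\<lambda>v. ?\<phi> v * of_real ((v - y) ^ N))"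
  have expand: "?\<phi> v * of_real ((v - y) ^ N) = (\<Sum>n\<le>N. ?c y n * ?G n v)" for v y :: real
  proof -
    have "(of_real (v - y) :: complex) = - of_real y + of_real v" by simp
    then have "of_real ((v - y) ^ N) = (- of_real y + of_real v :: complex) ^ N"
      by (simp only: of_real_power)
    also have "\<dots> = (\<Sum>n\<le>N. ?c y n * of_real v ^ (N - n))" by (rule binomial_ring)
    finally show ?thesis by (simp add: sum_distrib_left mult_ac)
  qed
  have tail: "(\<lambda>v. ?\<phi> v * of_real ((v - y) ^ N)) absolutely_integrable_on {s..}" if "s > 0" for s y :: real
    unfolding expand using cusp_form_tail_integrable[OF f that]
    by (intro absolutely_integrable_sum set_integrable_mult_right) auto
  have head: "(\<lambda>v. ?\<phi> v * of_real ((v - y) ^ N)) absolutely_integrable_on {0<..s}" if "s > 0" for s y :: real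
    unfolding expand using cusp_form_head(1)[OF f k _ that]
    by (intro absolutely_integrable_sum set_integrable_mult_right) auto
  have E: "eichler_integral k f (\<i> * of_real y) = \<i> ^ Suc N * ?I {y..} y"
    if y: "y > 0" for y
  proof -
    have "eichler_integral k f (\<i> * of_real y) = integral {0..} (\<lambda>t. \<i> ^ Suc N * (?\<phi> (y + t) * of_real ((y + t - y) ^ N)))"
      unfolding eichler_integral_def
      by (rule integral_cong) (simp add: k power_mult_distrib mult_ac ring_distribs)
    also have "\<dots> = \<i> ^ Suc N * integral {0..} (\<lambda>t. ?\<phi> (y + t) * of_real ((y + t - y) ^ N))" by (rule integral_mult_right)
    also have "integral {0..} (\<lambda>t. ?\<phi> (y + t) * of_real ((y + t - y) ^ N)) = ?I {y..} y"
      by (rule integral_translate[OF tail[OF y]])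
    finally show ?thesis .
  qed
  have evN: "even N" using ev k by simp
  have inv: "of_real y ^ N * ?I {1/y..} (1 / y) =
      \<i> ^ k * ?I {0<..y} y"
  proof -
    let ?F = "\<lambda>v. ?\<phi> v * of_real ((v - 1 / y) ^ N) :: complex"
    have F: "?F absolutely_integrable_on {1/y..}" using y by (intro tail) simp
    have "integral {1/y..} ?F = integral {0<..y} (\<lambda>x. ?F (1 / x) / of_real x ^ 2)"
      by (rule integral_inversion(2)[OF y F, symmetric])
    also have "\<dots> = integral {0<..y} (\<lambda>x. (\<i> ^ k / of_real y ^ N) * (?\<phi> x * of_real ((x - y) ^ N)))"
    proof (rule integral_cong)
      fix x assume "x \<in> {0<..y}"
      then have x: "x > 0" by simp
      have "x ^ k * (1 / x - 1 / y) ^ N / x ^ 2 = (x * (1 / x - 1 / y)) ^ N"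
        using x by (simp add: k power_mult_distrib power_add power2_eq_square)
      also have "x * (1 / x - 1 / y) = (- (x - y)) / y" using x y by (simp add: field_simps)
      also have "\<dots> ^ N = (x - y) ^ N / y ^ N"
        using evN by (simp only: power_divide power_minus_even)
      finally have *: "of_real (x ^ k * (1 / x - 1 / y) ^ N / x ^ 2) = (of_real ((x - y) ^ N / y ^ N) :: complex)"
        by (simp only:)
      have "?F (1 / x) / of_real x ^ 2 = \<i> ^ k * ?\<phi> x * of_real (x ^ k * (1 / x - 1 / y) ^ N / x ^ 2)"
        unfolding cusp_form_inversion[OF f x] by simp
      also have "\<dots> = (\<i> ^ k / of_real y ^ N) * (?\<phi> x * of_real ((x - y) ^ N))"
        unfolding * by simp
      finally show "?F (1 / x) / of_real x ^ 2 = (\<i> ^ k / of_real y ^ N) * (?\<phi> x * of_real ((x - y) ^ N))" .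
    qed
    also have "\<dots> = (\<i> ^ k / of_real y ^ N) * ?I {0<..y} y"
      by (rule integral_mult_right)
    finally show ?thesis using y by simp
  qed
  \<comment> \<open>The exponent is 2 N + 2 with N even. This sign turns the difference of the two
    Eichler integrals into a sum over adjacent intervals.\<close>
  have neg: "\<i> ^ N * \<i> ^ k = -1"
  proof -
    obtain m where "N = 2 * m" using evN by blast
    then show ?thesis by (simp add: k power_add power_mult power_mult_distrib[symmetric])
  qed
  have "- 1 / (\<i> * of_real y) = \<i> * of_real (1 / y)" using y by (simp add: field_simps)
  then have "(\<i> * of_real y) ^ N * eichler_integral k f (- 1 / (\<i> * of_real y)) =
      \<i> ^ Suc N * \<i> ^ N * (of_real y ^ N * ?I {1/y..} (1 / y))"
    using E[of "1 / y"] y by (simp only: power_mult_distrib) (simp add: mult_ac)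
  also have "\<dots> = \<i> ^ Suc N * (\<i> ^ N * \<i> ^ k) * ?I {0<..y} y"
    unfolding inv by (simp only: mult.assoc)
  finally have "eichler_integral k f (\<i> * of_real y) - (\<i> * of_real y) ^ N * eichler_integral k f (- 1 / (\<i> * of_real y)) =
      \<i> ^ Suc N * (?I {0<..y} y + ?I {y..} y)"
    unfolding neg E[OF y] by (simp add: algebra_simps)
  also have "?I {0<..y} y + ?I {y..} y =
      ?I {0<..} y"
    by (rule integral_split_half_line(2)[OF y head[OF y] tail[OF y], symmetric])
  also have "\<dots> = (\<Sum>n\<le>N. integral {0<..} (\<lambda>v. ?c y n * ?G n v))"
    unfolding expand
    by (intro integral_sum integrable_on_mult_right set_lebesgue_integral_eq_integral(1)[OF cusp_form_moment_integrable[OF f k]]) auto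
  \<comment> \<open>Here -y is rewritten as \<open>\<i> * (\<i> * y)\<close> to obtain a polynomial
    in the point z = i y.\<close>
  also have "\<dots> = (\<Sum>n\<le>N. of_nat (N choose n) * (\<i> * (\<i> * of_real y)) ^ n * moment f (N - n))"
    by (intro sum.cong refl, subst integral_mult_right) (simp add: moment_def)
  finally show ?thesis .
qed

text \<open>Both sides are holomorphic on the upper half plane and agree on the imaginary axis,
  which accumulates at \<open>\<i>\<close>.\<close>

lemma period_poly_eq:
  assumes f: "f \<in> cusp_forms k" and k: "k = N + 2" and ev: "even k"
  shows "period_poly k f = (\<Sum>n\<le>N. monom (\<i> ^ Suc N * (of_nat (N choose n) * \<i> ^ n * moment f (N - n))) n)"
    (is "_ = ?p")
proof (rule period_poly_eqI)
  fix z assume z: "z \<in> upper_half_plane"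
  obtain a where a: "cusp_expansion f a" using cusp_form_expansionE[OF f] .
  let ?E = "eichler_integral k f"
  define D where "D = (\<lambda>z. poly ?p z - (?E z - z ^ (k - 2) * ?E (- 1 / z)))"
  have E: "?E holomorphic_on upper_half_plane" by (rule eichler_integral_holomorphic[OF a])
  have "(?E \<circ> (\<lambda>z. - 1 / z)) holomorphic_on upper_half_plane"
  proof (rule holomorphic_on_compose_gen[OF _ E])
    show "(\<lambda>z. - 1 / z) holomorphic_on upper_half_plane"
      by (intro holomorphic_intros) (auto simp: upper_half_plane_def)
    show "(\<lambda>z. - 1 / z) ` upper_half_plane \<subseteq> upper_half_plane"
      using Im_mob_pos[of _ "(0, -1, 1, 0)"] by (auto simp: upper_half_plane_def)
  qed
  then have hol: "D holomorphic_on upper_half_plane"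
    unfolding D_def o_def by (intro holomorphic_intros E)
  have "D z = 0"
  proof (rule analytic_continuation[OF hol open_upper_half_plane connected_upper_half_plane, where U = "(\<lambda>y. \<i> * of_real y) ` {0<..}" and \<xi> = \<i>])
    show "(\<lambda>y. \<i> * of_real y) ` {0<..} \<subseteq> upper_half_plane" by (auto simp: upper_half_plane_def)
    show "\<i> \<in> upper_half_plane" by (simp add: upper_half_plane_def)
    show "\<i> islimpt (\<lambda>y. \<i> * of_real y) ` {0<..}"
      unfolding islimpt_approachable
    proof (intro allI impI)
      fix e :: real assume e: "e > 0"
      have "\<i> * of_real (1 + e / 2) \<in> (\<lambda>y. \<i> * of_real y) ` {0<..}" using e by (intro imageI) simp
      moreover have "\<i> * of_real (1 + e / 2) \<noteq> \<i>" using e by (simp add: complex_eq_iff)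
      moreover have "dist (\<i> * of_real (1 + e / 2)) \<i> < e"
        using e by (simp add: dist_norm algebra_simps norm_mult)
      ultimately show "\<exists>x'\<in>(\<lambda>y. \<i> * of_real y) ` {0<..}. x' \<noteq> \<i> \<and> dist x' \<i> < e" by blast
    qed
    fix w assume "w \<in> (\<lambda>y. \<i> * of_real y) ` {0<..}"
    then obtain y where y: "y > 0" "w = \<i> * of_real y" by auto
    have "poly ?p w = \<i> ^ Suc N * (\<Sum>n\<le>N. of_nat (N choose n) * (\<i> * w) ^ n * moment f (N - n))"
      by (simp add: poly_sum poly_monom sum_distrib_left power_mult_distrib mult_ac)
    moreover have "k - 2 = N" using k by simp
    ultimately show "D w = 0"
      unfolding D_def y(2) using period_on_imaginary_axis[OF f k ev y(1)] by simp
  qed (use z in auto)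
  then show "poly ?p z = ?E z - z ^ (k - 2) * ?E (- 1 / z)" by (simp add: D_def)
qed

section \<open>Zeros of self-inversive polynomials\<close>

lemma self_inversive_zeros_on_unit_circle:
  fixes h :: "nat \<Rightarrow> real" and b :: "nat \<Rightarrow> complex"
  assumes m: "m \<ge> 1" and b: "\<And>n. n \<le> 2 * m \<Longrightarrow> b n = \<i> ^ n * of_real (h n)"
    and reflect: "\<And>n. n \<le> 2 * m \<Longrightarrow> b (2 * m - n) = - ((-1) ^ n * b n)"
    and H: "\<And>z. norm z \<le> 1 \<Longrightarrow> (\<Sum>n<m. b n * z ^ n) + b m / 2 * z ^ m \<noteq> 0"
    and zero: "(\<Sum>n\<le>2*m. b n * z ^ n) = 0"
  shows "norm z = 1"
proof -
  define P where "P = (\<lambda>z. \<Sum>n\<le>2*m. b n * z ^ n)"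
  define H where "H = (\<lambda>z. (\<Sum>n<m. b n * z ^ n) + b m / 2 * z ^ m)"
  \<comment> \<open>The upper half of the polynomial is -z G(z). Every exponent in it is at least m
    >= 1, so a factor z can be split off; it makes the comparison with H strict inside the
    disc.\<close>
  define G where "G = (\<lambda>z. (\<Sum>n<m. (-1) ^ n * b n * z ^ (2 * m - n - 1)) + (-1) ^ m * b m / 2 * z ^ (m - 1))"
  have H0: "H z \<noteq> 0" if "norm z \<le> 1" for z using H[OF that] by (simp add: H_def)
  have zG: "z * G z = (\<Sum>n<m. (-1) ^ n * b n * z ^ (2 * m - n)) + (-1) ^ m * b m / 2 * z ^ m" for z
  proof -
    have "z * z ^ (2 * m - n - 1) = z ^ (2 * m - n)" if "n < m" for n
      using that by (simp flip: power_Suc add: Suc_diff_Suc)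
    moreover have "z * z ^ (m - 1) = z ^ m" using m by (simp flip: power_Suc)
    moreover have "z * G z = (\<Sum>n<m. (-1) ^ n * b n * (z * z ^ (2 * m - n - 1))) + (-1) ^ m * b m / 2 * (z * z ^ (m - 1))"
      by (simp add: G_def ring_distribs sum_distrib_left mult_ac)
    ultimately show ?thesis by simp
  qed
  have P: "P z = H z - z * G z" for z
  proof -
    have split: "{..2*m} = {..<m} \<union> {m} \<union> {m<..2*m}" by auto
    have "P z = (\<Sum>n<m. b n * z ^ n) + b m * z ^ m + (\<Sum>n\<in>{m<..2*m}. b n * z ^ n)"
      unfolding P_def split by (subst sum.union_disjoint; auto)+
    also have "(\<Sum>n\<in>{m<..2*m}. b n * z ^ n) = (\<Sum>n<m. b (2 * m - n) * z ^ (2 * m - n))"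
      by (rule sum.reindex_bij_witness[of _ "\<lambda>n. 2 * m - n" "\<lambda>n. 2 * m - n"]) auto
    also have "\<dots> = (\<Sum>n<m. - ((-1) ^ n * b n * z ^ (2 * m - n)))"
      by (intro sum.cong) (auto simp: reflect)
    finally have step: "P z = (\<Sum>n<m. b n * z ^ n) + b m * z ^ m + (\<Sum>n<m. - ((-1) ^ n * b n * z ^ (2 * m - n)))" .
    \<comment> \<open>This is void for odd m and forces \<open>b m = 0\<close> for even m; in both
      cases the middle term divides evenly between H and z G.\<close>
    have reflect_m: "(-1) ^ m * b m = - b m" using arg_cong[OF reflect[of m], of uminus] by simp
    have "b m * z ^ m = b m / 2 * z ^ m - (-1) ^ m * b m / 2 * z ^ m"
      
      unfolding reflect_m by simp
    then show ?thesis unfolding step zG H_def by (simp add: sum_negf)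
  qed
  \<comment> \<open>Reality of \<open>h n\<close> gives cnj (b n) = (-1)^n b n. Since cnj z = 1/z on
    the circle, z G(z) is z^(2m) times the conjugate of H(z).\<close>
  have norm_eq: "norm (G z) = norm (H z)" if z: "norm z = 1" for z
  proof -
    have zc: "z * cnj z = 1" using z by (simp flip: complex_norm_square)
    have cb: "cnj (b n) = (-1) ^ n * b n" if "n \<le> 2 * m" for n
      using that by (simp add: b power_mult_distrib[symmetric])
    have cz: "z ^ (2 * m) * cnj z ^ n = z ^ (2 * m - n)" if "n \<le> 2 * m" for n
    proof -
      have "z ^ (2 * m) = z ^ (2 * m - n) * z ^ n" using that by (simp flip: power_add)
      then have "z ^ (2 * m) * cnj z ^ n = z ^ (2 * m - n) * (z * cnj z) ^ n"
        by (simp add: power_mult_distrib)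
      then show ?thesis by (simp add: zc)
    qed
    have "z ^ (2 * m) * cnj (H z) = (\<Sum>n<m. cnj (b n) * (z ^ (2 * m) * cnj z ^ n)) + cnj (b m) / 2 * (z ^ (2 * m) * cnj z ^ m)"
      by (simp add: H_def ring_distribs sum_distrib_left mult_ac)
    also have "\<dots> = z * G z"
    proof -
      have mm: "2 * m - m = m" by simp
      have "(\<Sum>n<m. cnj (b n) * (z ^ (2 * m) * cnj z ^ n)) = (\<Sum>n<m. (-1) ^ n * b n * z ^ (2 * m - n))"
        by (intro sum.cong) (simp_all add: cb cz)
      moreover have "z ^ (2 * m) * cnj z ^ m = z ^ m" using cz[of m] mm by simp
      ultimately show ?thesis unfolding zG by (simp add: cb)
    qed
    finally have "norm (z ^ (2 * m) * cnj (H z)) = norm (z * G z)" by simp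
    then show ?thesis by (simp add: norm_mult norm_power z)
  qed
  have le: "norm (G z / H z) \<le> 1" if "norm z \<le> 1" for z
  proof (rule maximum_modulus_frontier[where S = "cball 0 1" and f = "\<lambda>z. G z / H z"])
    have "(\<lambda>z. G z / H z) holomorphic_on cball 0 1"
      unfolding G_def using H0 unfolding H_def by (intro holomorphic_intros) auto
    then show "(\<lambda>z. G z / H z) holomorphic_on interior (cball 0 1)" "continuous_on (closure (cball 0 1)) (\<lambda>z. G z / H z)"
      by (auto intro: holomorphic_on_subset holomorphic_on_imp_continuous_on)
    show "z \<in> cball 0 1" using that by simp
    fix u assume "u \<in> frontier (cball (0::complex) 1)"
    then have "norm u = 1" by (simp add: frontier_cball)
    then show "norm (G u / H u) \<le> 1" by (simp add: norm_divide norm_eq divide_le_eq)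
  qed simp
  have inner: "P z \<noteq> 0" if z: "norm z < 1" for z
  proof
    assume "P z = 0"
    then have "norm (H z) = norm z * norm (G z)" by (simp add: P norm_mult)
    also have "norm (G z) \<le> norm (H z)" using le[of z] z H0[of z] by (simp add: norm_divide divide_le_eq)
    also have "norm z * norm (H z) < 1 * norm (H z)" using z H0[of z] by (intro mult_strict_right_mono) auto
    finally show False by (simp add: mult_left_mono)
  qed
  \<comment> \<open>The symmetry z^(2m) P(-1/z) = -P(z) carries zeros outside the disc to zeros
    inside.\<close>
  have outer: "P z \<noteq> 0" if z: "norm z > 1" for z
  proof -
    have z0: "z \<noteq> 0" using z by auto
    have "z ^ (2 * m) * P (- 1 / z) = (\<Sum>n\<le>2*m. (-1) ^ n * b n * z ^ (2 * m - n))"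
      unfolding P_def sum_distrib_left
    proof (intro sum.cong refl)
      fix n assume "n \<in> {..2*m}"
      then have "z ^ (2 * m) = z ^ (2 * m - n) * z ^ n" by (simp flip: power_add)
      moreover have "(- 1 / z) ^ n = (- 1) ^ n / z ^ n" by (rule power_divide)
      ultimately show "z ^ (2 * m) * (b n * (- 1 / z) ^ n) = (-1) ^ n * b n * z ^ (2 * m - n)"
        using z0 by simp
    qed
    also have "\<dots> = (\<Sum>n\<le>2*m. (-1) ^ (2 * m - n) * b (2 * m - n) * z ^ n)"
      by (rule sum.reindex_bij_witness[of _ "\<lambda>n. 2 * m - n" "\<lambda>n. 2 * m - n"]) auto
    also have "\<dots> = (\<Sum>n\<le>2*m. - (b n * z ^ n))"
    proof (intro sum.cong refl)
      fix n assume n: "n \<in> {..2*m}"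
      then have "(-1::complex) ^ (2 * m - n) * (-1) ^ n = 1" by (simp flip: power_add)
      then show "(-1) ^ (2 * m - n) * b (2 * m - n) * z ^ n = - (b n * z ^ n)"
        using n by (simp add: reflect mult.assoc[symmetric])
    qed
    also have "\<dots> = - P z" by (simp add: P_def sum_negf)
    finally have "z ^ (2 * m) * P (- 1 / z) = - P z" .
    moreover have "P (- 1 / z) \<noteq> 0" using z by (intro inner) (simp add: norm_divide divide_less_eq)
    ultimately show ?thesis using z0 by auto
  qed
  have "P z = 0" using zero by (simp add: P_def)
  then show ?thesis using inner[of z] outer[of z] by linarith
qed

section \<open>Period polynomials of large weight\<close>

text \<open>The term l = 0 is 1/0 = 0, so this is zeta(2).\<close>

definition zeta2 :: real where "zeta2 = (\<Sum>l. 1 / real l ^ 2)"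

lemma zeta2_sums: "(\<lambda>l. 1 / real l ^ 2) sums zeta2"
  unfolding zeta2_def using inverse_power_summable[of 2, where 'a = real]
  by (intro summable_sums) (simp add: field_simps)

lemma zeta2_nonneg: "zeta2 \<ge> 0"
  using zeta2_sums by (rule sums_le[OF _ sums_zero, rotated]) simp

lemma norm_sums_le:
  fixes f :: "nat \<Rightarrow> 'a :: banach"
  assumes "f sums s" "\<And>n. norm (f n) \<le> g n" "g sums t"
  shows "norm s \<le> t"
  unfolding sums_unique[OF assms(1)] sums_unique[OF assms(3)]
  by (rule norm_suminf_le[OF assms(2) sums_summable[OF assms(3)]])

text \<open>A form of weight k = 2 m + 2; the exponent m + 2 is k/2 + 1 from
  \<open>hecke_eigenvalue_bound\<close>, and A is the difference of the coefficient sums. The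
  condition on m keeps the subtractions m - 2 and m - 3 exact.\<close>

locale large_weight_form =
  fixes f :: "complex \<Rightarrow> complex" and a :: "nat \<Rightarrow> complex" and m :: nat and A B :: real
  assumes f: "f \<in> cusp_forms (2 * m + 2)" and a: "cusp_expansion f a"
    and real_coeff: "\<And>n. Im (a n) = 0" and a1: "a 1 = of_real A" and A: "A > 0"
    and bound: "\<And>n. norm (a n) \<le> B * real n ^ (m + 2)" and m: "m \<ge> 3"
begin

lemma B_nonneg: "B \<ge> 0"
  using order_trans[OF norm_ge_zero bound[of 1]] by simp

lemma a0: "a 0 = 0"
  using a by (simp add: cusp_expansion_def)

text \<open>Of the powers of l left over after the coefficient bound, two make the series converge
  and i remain for decay. Convergence alone requires j >= m + 3.\<close>

lemma coeff_term_bound: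
  assumes "l > 0" "m + 3 + i \<le> j"
  shows "norm (a l) / real l ^ Suc j \<le> B * (1 / real l ^ 2) * (1 / real l ^ i)"
proof -
  have "real l ^ (m + 2) * real l ^ (2 + i) \<le> real l ^ Suc j"
    unfolding power_add[symmetric] using assms by (intro power_increasing) auto
  then have "B * real l ^ (m + 2) / real l ^ Suc j \<le> B * real l ^ (m + 2) / (real l ^ (m + 2) * real l ^ (2 + i))"
    using assms B_nonneg by (intro divide_left_mono mult_pos_pos) auto
  also have "\<dots> = B * (1 / real l ^ 2) * (1 / real l ^ i)" using assms by (simp add: power_add power2_eq_square)
  finally show ?thesis
    using divide_right_mono[OF bound[of l], of "real l ^ Suc j"] by (simp del: power_Suc)
qed

lemma coeff_summable:
  assumes "m + 3 \<le> j"
  shows "summable (\<lambda>l. norm (a l) / real l ^ Suc j)"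
proof (rule summable_comparison_test'[of "\<lambda>l. B * (1 / real l ^ 2)" 1])
  show "summable (\<lambda>l. B * (1 / real l ^ 2))" using zeta2_sums by (intro summable_mult) (auto simp: sums_iff)
  fix l :: nat assume "l \<ge> 1"
  then show "norm (norm (a l) / real l ^ Suc j) \<le> B * (1 / real l ^ 2)"
    using coeff_term_bound[of l 0 j] assms by simp
qed

text \<open>The main term is l = 1. For l >= 2 the spare factor l^(-i) of
  \<open>coeff_term_bound\<close>, with i = j - (m + 3), is at most 2^(-i).\<close>

lemma moment_approx:
  assumes j: "m + 3 \<le> j"
  shows "norm (moment f j - of_real (A * (fact j / (2 * pi) ^ Suc j))) \<le>
     B * zeta2 * (1 / 2 ^ (j - (m + 3))) * (fact j / (2 * pi) ^ Suc j)"
proof -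
  let ?K = "fact j / (2 * pi) ^ Suc j :: real"
  have K: "?K \<ge> 0" by simp
  have "(\<lambda>l. a l * of_real (mellin_factor j l)) sums moment f j"
    unfolding moment_def
    by (rule mellin_transform_sums(2)[OF a0 coeff_summable[OF j] cusp_expansion_imaginary_axis[OF a]])
  then have S1: "(\<lambda>l. a l * of_real (mellin_factor j l) - (if l = 1 then a 1 * of_real ?K else 0)) sums
      (moment f j - a 1 * of_real ?K)"
    by (intro sums_diff) (use sums_single[of 1 "\<lambda>_. a 1 * of_real ?K"] in simp_all)
  have le: "norm (a l * of_real (mellin_factor j l) - (if l = 1 then a 1 * of_real ?K else 0))
      \<le> (1 / real l ^ 2) * (B * (1 / 2 ^ (j - (m + 3))) * ?K)" for l
  proof -
    consider "l = 0" | "l = 1" | "l \<ge> 2" by linarith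
    then show ?thesis
    proof cases
      case 3
      have "norm (a l * of_real (mellin_factor j l)) = norm (a l) / real l ^ Suc j * ?K"
        by (rule norm_mellin_term)
      also have "\<dots> \<le> B * (1 / real l ^ 2) * (1 / real l ^ (j - (m + 3))) * ?K"
        using 3 j by (intro mult_right_mono coeff_term_bound K) auto
      also have "\<dots> \<le> B * (1 / real l ^ 2) * (1 / 2 ^ (j - (m + 3))) * ?K"
        using 3 B_nonneg by (intro mult_right_mono[OF _ K] mult_left_mono divide_left_mono power_mono mult_pos_pos) auto
      finally show ?thesis using 3 by (simp add: mult_ac del: power_Suc)
    qed (use a0 B_nonneg in \<open>simp_all del: power_Suc\<close>)
  qed
  have s: "(\<lambda>l. (1 / real l ^ 2) * (B * (1 / 2 ^ (j - (m + 3))) * ?K)) sums (zeta2 * (B * (1 / 2 ^ (j - (m + 3))) * ?K))"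
    by (intro sums_mult2 zeta2_sums)
  have "norm (moment f j - a 1 * of_real ?K) \<le> zeta2 * (B * (1 / 2 ^ (j - (m + 3))) * ?K)"
    by (rule norm_sums_le[OF S1 le s])
  moreover have "a 1 * of_real ?K = of_real (A * ?K)" by (simp only: a1 of_real_mult)
  moreover have "zeta2 * (B * (1 / 2 ^ (j - (m + 3))) * ?K) = B * zeta2 * (1 / 2 ^ (j - (m + 3))) * ?K"
    by (simp only: mult_ac)
  ultimately show ?thesis by (simp only:)
qed

text \<open>For v >= 1 the exponent may be raised to m + 3, where the Dirichlet series bound becomes
  available. It is applied to the series with coefficients |a_l|, which majorizes |f|, integrated
  over the whole half line.\<close>

lemma abs_moment_tail:
  assumes j: "j \<le> m + 3"
  shows "norm (integral {1..} (axis_moment f j)) \<le> B * zeta2 * (fact (m + 3) / (2 * pi) ^ (m + 4))"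
proof -
  define J where "J = m + 3"
  define g where "g = (\<lambda>t. \<Sum>l. norm (a l) * exp (- 2 * pi * real l * t))"
  have summ: "summable (\<lambda>l. norm (a l) * exp (- 2 * pi * real l * t))" if t: "t > 0" for t
  proof -
    have "summable (\<lambda>l. norm (a l * qexp (\<i> * of_real t) ^ l))"
      using t by (intro cusp_expansion_summable[OF a] norm_qexp_less_1) simp
    then show ?thesis by (simp add: norm_mult norm_power norm_qexp exp_of_nat_mult[symmetric] mult_ac)
  qed
  have gs: "(\<lambda>l. of_real (norm (a l)) * of_real (exp (- 2 * pi * real l * t))) sums (of_real (g t) :: complex)" if "t > 0" for t
    using sums_of_real[OF summable_sums[OF summ[OF that]], where 'a = complex] by (simp add: g_def)
  have g0: "g t \<ge> 0" if "t > 0" for t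
    unfolding g_def using summ[OF that] by (intro suminf_nonneg) auto
  have fg: "norm (f (\<i> * of_real t)) \<le> g t" if t: "t > 0" for t
  proof -
    have "norm (\<Sum>l. a l * of_real (exp (- 2 * pi * real l * t))) \<le> g t"
      unfolding g_def using summ[OF t] by (intro norm_suminf_le) (simp_all add: norm_mult)
    then show ?thesis using cusp_expansion_imaginary_axis[OF a t] by (simp add: sums_iff)
  qed
  let ?b = "\<lambda>l. of_real (norm (a l)) :: complex"
  have b1: "?b 0 = 0" "summable (\<lambda>l. norm (?b l) / real l ^ Suc J)"
    using coeff_summable[of J] by (simp_all add: a0 J_def del: power_Suc)
  note mel = mellin_transform_sums[OF b1 gs]
  let ?gJ = "\<lambda>t. g t * t ^ J"
  let ?gC = "\<lambda>t. of_real (g t) * of_real (t ^ J) :: complex"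
  have Re_gC: "Re \<circ> ?gC = ?gJ" by (auto simp: fun_eq_iff simp flip: of_real_power)
  have gC: "?gC integrable_on {0<..}" using mel(1) by (simp add: absolutely_integrable_on_def)
  have intg: "?gJ integrable_on {0<..}" using integrable_linear[OF gC bounded_linear_Re] unfolding Re_gC .
  have Ig: "integral {0<..} ?gJ = Re (integral {0<..} ?gC)"
    using integral_linear[OF gC bounded_linear_Re] unfolding Re_gC .
  let ?K = "fact J / (2 * pi) ^ Suc J :: real"
  have "norm (integral {0<..} ?gC) \<le> zeta2 * (B * ?K)"
  proof -
    have le: "norm (?b l * of_real (mellin_factor J l)) \<le> (1 / real l ^ 2) * (B * ?K)" for l
    proof (cases "l = 0")
      case False
      have "norm (?b l * of_real (mellin_factor J l)) = norm (a l) / real l ^ Suc J * ?K"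
        unfolding norm_mellin_term by simp
      also have "\<dots> \<le> B * (1 / real l ^ 2) * (1 / real l ^ 0) * ?K"
        using False by (intro mult_right_mono coeff_term_bound) (auto simp: J_def)
      finally show ?thesis by (simp add: mult_ac del: power_Suc)
    qed (simp add: a0)
    show ?thesis
      by (rule norm_sums_le[OF mel(2) le sums_mult2[OF zeta2_sums]])
  qed
  then have Ile: "integral {0<..} ?gJ \<le> zeta2 * (B * ?K)"
    unfolding Ig using complex_Re_le_cmod order_trans by blast
  have int1: "?gJ integrable_on {1..}"
  proof -
    have "?gJ absolutely_integrable_on {0<..}"
      using intg g0 by (intro nonnegative_absolutely_integrable_1) auto
    then have "?gJ absolutely_integrable_on {1..}" by (rule set_integrable_subset) auto
    then show ?thesis by (simp add: absolutely_integrable_on_def)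
  qed
  have "norm (integral {1..} (axis_moment f j)) \<le> integral {1..} ?gJ"
  proof (rule integral_norm_bound_integral)
    show "(axis_moment f j) integrable_on {1..}"
      using cusp_form_tail_integrable[OF f, of 1 j] by (simp add: absolutely_integrable_on_def)
    fix v :: real assume "v \<in> {1..}"
    then have v: "v \<ge> 1" by simp
    have "norm (f (\<i> * of_real v)) * v ^ j \<le> g v * v ^ J"
      using v j fg[of v] g0[of v] by (intro mult_mono power_increasing) (auto simp: J_def)
    then show "norm (f (\<i> * of_real v) * of_real (v ^ j)) \<le> ?gJ v"
      using v by (simp add: norm_mult norm_power)
  qed (rule int1)
  also have "\<dots> \<le> integral {0<..} ?gJ"
    using g0 by (intro integral_subset_le int1 intg) auto
  also have "\<dots> \<le> zeta2 * (B * ?K)" by (rule Ile)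
  finally show ?thesis by (simp add: J_def mult_ac add.commute del: power_Suc)
qed

end

section \<open>Error terms for the lower half of the polynomial\<close>

definition mid_bound :: "real \<Rightarrow> nat \<Rightarrow> real" where
  "mid_bound B m = 2 * B * zeta2 * (2 * pi) ^ m * real (m + 3) ^ 3 / fact (m - 2)"

definition exp_tail :: "nat \<Rightarrow> real" where
  "exp_tail M = exp (2 * pi) - (\<Sum>n<M. (2 * pi) ^ n / fact n)"

text \<open>The summands come from the coefficients n <= m - 3 (\<open>h_approx\<close>, summed to
  an exponential), from the three middle ones, and from the terms of A exp(2 pi i z) with n >= m -
  2. The last are counted from m - 2 because the middle coefficients are not compared with the
  exponential.\<close>

definition total_error :: "real \<Rightarrow> real \<Rightarrow> nat \<Rightarrow> real" where
  "total_error A B m = 8 * B * zeta2 / 2 ^ m * exp (4 * pi) + 3 * mid_bound B m + A * exp_tail (m - 2)"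

lemma exp_real_sums: "(\<lambda>n. (x :: real) ^ n / fact n) sums exp x"
  using exp_converges[of x] by (simp add: divide_inverse mult.commute)

context large_weight_form
begin

text \<open>Normalized so that the main term A j! / (2 pi)^(j+1) of the moment of order j = 2 m - n
  becomes A (2 pi)^n / n!, the modulus of the n-th Taylor coefficient of A exp(2 pi i z).\<close>

definition h :: "nat \<Rightarrow> real" where
  "h n = (2 * pi) ^ (2 * m + 1) / fact (2 * m) * real (2 * m choose n) * Re (moment f (2 * m - n))"

definition b :: "nat \<Rightarrow> complex" where
  "b n = \<i> ^ n * of_real (h n)"

definition half_poly :: "complex \<Rightarrow> complex" where
  "half_poly z = (\<Sum>n<m. b n * z ^ n) + b m / 2 * z ^ m"

abbreviation scale :: real where
  "scale \<equiv> fact (2 * m) / (2 * pi) ^ (2 * m + 1)"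

lemma moment_of_real: "j \<le> 2 * m \<Longrightarrow> moment f j = of_real (Re (moment f j))"
  using moment_real[OF f refl _ a real_coeff] by (simp add: complex_eq_iff)

lemma poly_period_poly:
  "poly (period_poly (2 * m + 2) f) z =
     \<i> ^ Suc (2 * m) * of_real scale * (\<Sum>n\<le>2*m. b n * z ^ n)"
proof -
  have "of_nat (2 * m choose n) * \<i> ^ n * moment f (2 * m - n) =
      of_real scale * b n" for n
  proof -
    have "scale * h n = real (2 * m choose n) * Re (moment f (2 * m - n))"
      by (simp add: h_def)
    then have "of_real scale * of_real (h n) =
        (of_real (real (2 * m choose n)) * of_real (Re (moment f (2 * m - n))) :: complex)"
      by (simp only: of_real_mult[symmetric])
    also have "\<dots> = of_nat (2 * m choose n) * moment f (2 * m - n)"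
      by (subst (2) moment_of_real) simp_all
    finally have *: "of_real scale * of_real (h n) =
        of_nat (2 * m choose n) * moment f (2 * m - n)" .
    have "of_real scale * b n =
        \<i> ^ n * (of_real scale * of_real (h n))"
      unfolding b_def by (simp only: mult_ac)
    also have "\<dots> = of_nat (2 * m choose n) * \<i> ^ n * moment f (2 * m - n)"
      unfolding * by (simp only: mult_ac)
    finally show ?thesis by (rule sym)
  qed
  then have "period_poly (2 * m + 2) f = (\<Sum>n\<le>2*m. monom (\<i> ^ Suc (2 * m) *
      (of_real scale * b n)) n)"
    by (subst period_poly_eq[OF f refl]) (simp, simp only:)
  then show ?thesis
    by (simp only: poly_sum poly_monom sum_distrib_left mult.assoc)
qed

lemma b_reflect:
  assumes n: "n \<le> 2 * m"
  shows "b (2 * m - n) = - ((-1) ^ n * b n)"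
proof -
  let ?k = "2 * m + 2"
  define c where "c = (2 * pi) ^ (2 * m + 1) / fact (2 * m) * real (2 * m choose n)"
  have hn: "h n = c * Re (moment f (2 * m - n))" by (simp add: h_def c_def)
  have "2 * m choose (2 * m - n) = 2 * m choose n" using binomial_symmetric[OF n] by simp
  then have hn': "h (2 * m - n) = c * Re (moment f n)" using n by (simp add: h_def c_def)
  have "moment f n = \<i> ^ ?k * moment f (2 * m - n)"
    by (rule moment_reflect[OF f refl n]) simp
  then have M: "of_real (Re (moment f n)) = \<i> ^ ?k * of_real (Re (moment f (2 * m - n)))"
    using moment_of_real[OF n] moment_of_real[of "2 * m - n"] by simp
  \<comment> \<open>After multiplication by \<open>\<i> ^ n\<close> the exponent on the left is 4 m
    + 2, so the sign is the same for every m.\<close>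
  have i: "\<i> ^ (2 * m - n) * \<i> ^ ?k = - ((-1) ^ n * \<i> ^ n)"
  proof -
    have "\<i> ^ n * (\<i> ^ (2 * m - n) * \<i> ^ ?k) = \<i> ^ (4 * m + 2)"
    proof -
      have "n + ((2 * m - n) + ?k) = 4 * m + 2" using n by simp
      then show ?thesis by (simp only: power_add[symmetric])
    qed
    also have "\<dots> = -1" by (simp add: power_add power_mult)
    also have "\<dots> = \<i> ^ n * (- ((-1) ^ n * \<i> ^ n))"
    proof -
      have "\<i> ^ n * \<i> ^ n = (-1) ^ n" by (simp flip: power_mult_distrib)
      moreover have "(-1) ^ n * (-1) ^ n = (1 :: complex)" by (simp flip: power_mult_distrib)
      moreover have "\<i> ^ n * (- ((-1) ^ n * \<i> ^ n)) = - ((-1) ^ n * (\<i> ^ n * \<i> ^ n))"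
        by (simp add: mult_ac)
      ultimately show ?thesis by (simp only:)
    qed
    finally show ?thesis by simp
  qed
  have "b (2 * m - n) = \<i> ^ (2 * m - n) * (of_real c * of_real (Re (moment f n)))"
    by (simp add: b_def hn')
  also have "\<dots> = (\<i> ^ (2 * m - n) * \<i> ^ ?k) * (of_real c * of_real (Re (moment f (2 * m - n))))"
    unfolding M by (simp only: mult_ac)
  also have "\<dots> = - ((-1) ^ n * b n)"
    unfolding i b_def hn by simp
  finally show ?thesis .
qed

lemma weight_eq:
  assumes n: "n \<le> 2 * m"
  shows "(2 * pi) ^ (2 * m + 1) / fact (2 * m) * real (2 * m choose n) = (2 * pi) ^ (2 * m + 1) / (fact n * fact (2 * m - n))"
  using binomial_fact[OF n, where 'a = real] by simp

text \<open>The assumption is j >= m + 3 for j = 2 m - n. The decay exponent of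
  \<open>moment_approx\<close> is then m - n - 3, so its power of two is 8 * 2^n / 2^m, and 2^n is
  absorbed by replacing 2 pi with 4 pi.\<close>

lemma h_approx:
  assumes n: "n + 3 \<le> m"
  shows "\<bar>h n - A * ((2 * pi) ^ n / fact n)\<bar> \<le> 8 * B * zeta2 / 2 ^ m * ((4 * pi) ^ n / fact n)"
proof -
  define j where "j = 2 * m - n"
  define W where "W = (2 * pi) ^ (2 * m + 1) / fact (2 * m) * real (2 * m choose n)"
  define K where "K = (fact j / (2 * pi) ^ Suc j :: real)"
  have W: "W \<ge> 0" by (simp add: W_def)
  have "2 * m + 1 = n + Suc j" using n by (simp add: j_def)
  then have "(2 * pi) ^ (2 * m + 1) = (2 * pi) ^ n * (2 * pi) ^ Suc j" by (simp only: power_add)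
  then have WK: "W * K = (2 * pi) ^ n / fact n"
    using n unfolding W_def K_def by (subst weight_eq) (simp_all add: j_def[symmetric] del: power_Suc)
  have "\<bar>Re (moment f j) - A * K\<bar> \<le> norm (moment f j - of_real (A * K))"
    using abs_Re_le_cmod[of "moment f j - of_real (A * K)"] by simp
  also have "\<dots> \<le> B * zeta2 * (1 / 2 ^ (j - (m + 3))) * K"
    unfolding K_def by (rule moment_approx) (use n in \<open>simp add: j_def\<close>)
  finally have "W * \<bar>Re (moment f j) - A * K\<bar> \<le> W * (B * zeta2 * (1 / 2 ^ (j - (m + 3))) * K)"
    using W by (intro mult_left_mono)
  also have "\<dots> = B * zeta2 * (1 / 2 ^ (j - (m + 3))) * (W * K)" by (simp only: mult_ac)
  also have "(1 / 2 ^ (j - (m + 3)) :: real) = 8 * 2 ^ n / 2 ^ m"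
  proof -
    have pw: "(2::real) ^ m = 2 ^ (j - (m + 3)) * (2 ^ n * 2 ^ 3)"
    proof -
      have "(j - (m + 3)) + (n + 3) = m" using n by (simp add: j_def)
      then show ?thesis by (simp only: power_add[symmetric])
    qed
    show ?thesis unfolding pw by simp
  qed
  also have "B * zeta2 * (8 * 2 ^ n / 2 ^ m) * (W * K) = 8 * B * zeta2 / 2 ^ m * ((4 * pi) ^ n / fact n)"
  proof -
    have "4 * pi = 2 * (2 * pi)" by simp
    then have "(4 * pi) ^ n = 2 ^ n * (2 * pi) ^ n" by (simp only: power_mult_distrib)
    then show ?thesis unfolding WK by simp
  qed
  also have "W * \<bar>Re (moment f j) - A * K\<bar> = \<bar>h n - A * ((2 * pi) ^ n / fact n)\<bar>"
  proof -
    have "h n - A * ((2 * pi) ^ n / fact n) = W * (Re (moment f j) - A * K)"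
      unfolding WK[symmetric] by (simp add: h_def W_def j_def right_diff_distrib)
    then show ?thesis using W by (simp add: abs_mult)
  qed
  finally show ?thesis .
qed

text \<open>Here n and 2 m - n are both at most m + 3, so \<open>moment_split\<close> and
  \<open>abs_moment_tail\<close> bound the moment by a multiple of (m+3)!. The normalization divides
  by two factorials, at least (m-2)! and m!; the latter reduces (m+3)! to a cubic factor and the
  former makes the bound small.\<close>

lemma h_middle:
  assumes n: "m - 2 \<le> n" "n \<le> m"
  shows "\<bar>h n\<bar> \<le> mid_bound B m"
proof -
  define j where "j = 2 * m - n"
  have j: "j \<le> 2 * m" "2 * m - j = n" "j \<le> m + 3" "n \<le> m + 3" "m \<le> j" using n m by (auto simp: j_def)
  define E where "E = B * zeta2 * (fact (m + 3) / (2 * pi) ^ (m + 4))"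
  let ?W = "(2 * pi) ^ (2 * m + 1) / (fact n * fact j) :: real"
  have E: "E \<ge> 0" using B_nonneg zeta2_nonneg by (simp add: E_def)
  define I where "I = (\<lambda>j. integral {1..} (\<lambda>v. f (\<i> * of_real v) * of_real (v ^ j)))"
  have "moment f j = I j + \<i> ^ (2 * m + 2) * I n"
    unfolding I_def using moment_split[OF f refl j(1)] by (simp only: j(2)) simp
  then have "norm (moment f j) \<le> norm (I j) + norm (\<i> ^ (2 * m + 2) * I n)"
    by (simp only: norm_triangle_ineq)
  also have "norm (\<i> ^ (2 * m + 2) * I n) = norm (I n)" by (simp add: norm_mult norm_power)
  also have "norm (I j) + norm (I n) \<le> E + E" unfolding E_def I_def by (intro add_mono abs_moment_tail j)
  finally have "\<bar>Re (moment f j)\<bar> \<le> 2 * E" using abs_Re_le_cmod[of "moment f j"] by linarith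
  then have "?W * \<bar>Re (moment f j)\<bar> \<le>
      ?W * (2 * E)"
    by (rule mult_left_mono) simp
  moreover have "h n = ?W * Re (moment f j)"
  proof -
    have "n \<le> 2 * m" using n by simp
    then show ?thesis unfolding h_def j_def by (simp only: weight_eq)
  qed
  ultimately have "\<bar>h n\<bar> \<le> ?W * (2 * E)"
    by (simp only: abs_mult) simp
  also have "\<dots> \<le> (2 * pi) ^ (2 * m + 1) / (fact (m - 2) * fact m) * (2 * E)"
    using n j E by (intro mult_right_mono divide_left_mono mult_mono fact_mono mult_pos_pos) auto
  also have "\<dots> = 2 * B * zeta2 * (2 * pi) ^ (m - 3) * (fact (m + 3) / fact m) / fact (m - 2)"
  proof -
    have "2 * m + 1 = (m - 3) + (m + 4)" using m by simp
    then have pw: "(2 * pi) ^ (2 * m + 1) = (2 * pi) ^ (m - 3) * (2 * pi) ^ (m + 4)" by (simp only: power_add)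
    have gen: "x * p / (u * v) * (2 * (B * zeta2 * (w / p))) = 2 * B * zeta2 * x * (w / v) / u"
      if "p > 0" for x p u v w :: real using that by (simp add: mult_ac)
    show ?thesis unfolding E_def pw by (rule gen) simp
  qed
  also have "\<dots> \<le> 2 * B * zeta2 * (2 * pi) ^ m * real (m + 3) ^ 3 / fact (m - 2)"
  proof (intro divide_right_mono mult_mono mult_left_mono)
    show "(2 * pi) ^ (m - 3) \<le> (2 * pi) ^ m" using pi_ge_two by (intro power_increasing) auto
    have "fact (m + 3) / fact m = real (m + 3) * (real (m + 2) * real (m + 1))"
      by (simp add: eval_nat_numeral)
    also have "\<dots> \<le> real (m + 3) * (real (m + 3) * real (m + 3))" by (intro mult_mono) auto
    finally show "fact (m + 3) / fact m \<le> real (m + 3) ^ 3" by (simp add: power3_eq_cube)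
  qed (use B_nonneg zeta2_nonneg in auto)
  finally show ?thesis by (simp add: mid_bound_def)
qed

lemma half_poly_approx:
  assumes z: "norm z \<le> 1"
  shows "norm (half_poly z - of_real A * exp (2 * of_real pi * \<i> * z)) \<le> total_error A B m"
proof -
  define b' where "b' = (\<lambda>n. if n < m then b n else if n = m then b m / 2 else 0)"
  define e where "e = (\<lambda>n. (2 * pi) ^ n / fact n :: real)"
  define X where "X = 8 * B * zeta2 / 2 ^ m"
  define T where "T = mid_bound B m"
  have X: "X \<ge> 0" using B_nonneg zeta2_nonneg by (simp add: X_def)
  have T: "T \<ge> 0" using B_nonneg zeta2_nonneg by (simp add: T_def mid_bound_def)
  have e: "e n \<ge> 0" for n by (simp add: e_def)
  have zn: "norm z ^ n \<le> 1" for n using z by (simp add: power_le_one)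
  have "(\<lambda>n. b' n * z ^ n) sums (\<Sum>n\<le>m. b' n * z ^ n)"
    by (rule sums_finite) (auto simp: b'_def)
  also have "(\<Sum>n\<le>m. b' n * z ^ n) = half_poly z"
    by (simp add: half_poly_def b'_def lessThan_Suc_atMost[symmetric])
  finally have s1: "(\<lambda>n. b' n * z ^ n) sums half_poly z" .
  have "(\<lambda>n. of_real A * ((2 * of_real pi * \<i> * z) ^ n / fact n)) sums (of_real A * exp (2 * of_real pi * \<i> * z))"
    using exp_converges[of "2 * of_real pi * \<i> * z"]
    by (intro sums_mult) (simp add: scaleR_conv_of_real divide_inverse mult.commute)
  then have s2: "(\<lambda>n. \<i> ^ n * of_real (A * e n) * z ^ n) sums (of_real A * exp (2 * of_real pi * \<i> * z))"
    by (simp add: e_def power_mult_distrib mult_ac)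
  \<comment> \<open>A summable majorant for the coefficient differences: its summands are active for
    n < m - 2, for the middle indices, and for all n >= m - 2 respectively, except that the first is
    kept for every n to sum to an exponential.\<close>
  define u where "u = (\<lambda>n. X * ((4 * pi) ^ n / fact n) + (if n \<in> {m-2..m} then T else 0) + A * (e n - (if n \<in> {..<m-2} then e n else 0)))"
  have "(\<lambda>n. if n \<in> {m-2..m} then T else 0) sums (\<Sum>n\<in>{m-2..m}. T)" by (rule sums_If_finite_set) simp
  moreover have "card {m-2..m} = 3" using m by simp
  ultimately have u2: "(\<lambda>n. if n \<in> {m-2..m} then T else 0) sums (3 * T)" by simp
  have "(\<lambda>n. if n \<in> {..<m-2} then e n else 0) sums (\<Sum>n<m-2. e n)" by (rule sums_If_finite_set) simp
  moreover have "e sums exp (2 * pi)" unfolding e_def by (rule exp_real_sums)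
  ultimately have "(\<lambda>n. e n - (if n \<in> {..<m-2} then e n else 0)) sums (exp (2 * pi) - (\<Sum>n<m-2. e n))"
    by (intro sums_diff)
  then have u3: "(\<lambda>n. e n - (if n \<in> {..<m-2} then e n else 0)) sums exp_tail (m - 2)"
    by (simp only: exp_tail_def e_def)
  have u: "u sums total_error A B m"
    unfolding u_def total_error_def X_def[symmetric] T_def[symmetric]
    by (intro sums_add sums_mult u2 u3 exp_real_sums)
  let ?d = "\<lambda>n. b' n * z ^ n - \<i> ^ n * of_real (A * e n) * z ^ n"
  have le: "norm (?d n) \<le> u n" for n
  proof -
    have gen: "norm (\<i> ^ n * of_real x * z ^ n) \<le> \<bar>x\<bar>" for x :: real
      using mult_left_mono[OF zn[of n], of "\<bar>x\<bar>"] by (simp add: norm_mult norm_power)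
    have X': "X * ((4 * pi) ^ n / fact n) \<ge> 0" using X by simp
    consider "n < m" | "n = m" | "n > m" by linarith
    then show ?thesis
    proof cases
      case 1
      then have "?d n = \<i> ^ n * of_real (h n - A * e n) * z ^ n"
        by (simp add: b'_def b_def algebra_simps)
      then have d: "norm (?d n) \<le> \<bar>h n - A * e n\<bar>" by (simp only: gen)
      show ?thesis
      proof (cases "n < m - 2")
        case True
        then have "\<bar>h n - A * e n\<bar> \<le> X * ((4 * pi) ^ n / fact n)"
          unfolding e_def X_def by (intro h_approx) simp
        with d True show ?thesis by (simp add: u_def)
      next
        case False
        have "\<bar>h n - A * e n\<bar> \<le> T + A * e n"
          using h_middle[of n] 1 False A e[of n] abs_triangle_ineq4[of "h n" "A * e n"] by (simp add: T_def abs_mult)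
        with d 1 False X' show ?thesis by (simp add: u_def)
      qed
    next
      case 2
      then have "?d n = \<i> ^ n * of_real (h n / 2 - A * e n) * z ^ n"
        by (simp add: b'_def b_def algebra_simps)
      also have "norm \<dots> \<le> \<bar>h n / 2 - A * e n\<bar>" by (rule gen)
      also have "\<dots> \<le> T + A * e n"
        using h_middle[of n] 2 A e[of n] abs_triangle_ineq4[of "h n / 2" "A * e n"] by (simp add: T_def abs_mult)
      also have "T + A * e n \<le> u n"
      proof -
        have "\<not> n < m - 2" using 2 by linarith
        then show ?thesis using 2 X' by (simp add: u_def)
      qed
      finally show ?thesis .
    next
      case 3
      then have "norm (?d n) = norm (\<i> ^ n * of_real (A * e n) * z ^ n)"
        by (simp add: b'_def)
      also have "\<dots> \<le> \<bar>A * e n\<bar>" by (rule gen)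
      also have "\<bar>A * e n\<bar> \<le> u n"
      proof -
        have "\<not> n < m - 2" using 3 by linarith
        then show ?thesis using 3 X' A e[of n] by (simp add: u_def abs_mult)
      qed
      finally show ?thesis .
    qed
  qed
  show ?thesis by (rule norm_sums_le[OF sums_diff[OF s1 s2] le u])
qed

lemma unimodular_period_poly:
  assumes small: "total_error A B m < A * exp (- 2 * pi)"
  shows "unimodular (period_poly (2 * m + 2) f)"
  unfolding unimodular_def
proof (intro allI impI)
  fix z assume "poly (period_poly (2 * m + 2) f) z = 0"
  then have "\<i> ^ Suc (2 * m) * of_real scale = (0 :: complex) \<or>
      (\<Sum>n\<le>2*m. b n * z ^ n) = 0"
    unfolding poly_period_poly by (subst (asm) mult_eq_0_iff)
  moreover have "\<i> ^ Suc (2 * m) * of_real scale \<noteq> (0 :: complex)" by simp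
  ultimately have zero: "(\<Sum>n\<le>2*m. b n * z ^ n) = 0" by blast
  show "norm z = 1"
  proof (rule self_inversive_zeros_on_unit_circle[OF _ _ b_reflect _ zero])
    show "m \<ge> 1" using m by simp
    show "b n = \<i> ^ n * of_real (h n)" for n by (rule b_def)
    fix z :: complex assume z: "norm z \<le> 1"
    \<comment> \<open>The modulus of exp(2 pi i z) depends only on Im z and is smallest on the
      closed disc at z = i.\<close>
    have "A * exp (- 2 * pi) \<le> norm (of_real A * exp (2 * of_real pi * \<i> * z))"
    proof -
      have "\<bar>Im z\<bar> \<le> 1" using abs_Im_le_cmod[of z] z by linarith
      then have "- 2 * pi \<le> - 2 * pi * Im z" by simp
      then show ?thesis using A by (simp add: norm_mult norm_exp_eq_Re)
    qed
    then show "(\<Sum>n<m. b n * z ^ n) + b m / 2 * z ^ m \<noteq> 0"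
      using half_poly_approx[OF z] small by (auto simp: half_poly_def)
  qed
qed

end

section \<open>Passage to large weight\<close>

lemma tendsto_total_error: "(total_error A B) \<longlonglongrightarrow> 0"
proof -
  have 1: "(\<lambda>m. 8 * B * zeta2 / 2 ^ m * exp (4 * pi)) \<longlonglongrightarrow> 0" by real_asymp
  have "(\<lambda>p. (2 * pi * exp 1) ^ p / fact p :: real) \<longlonglongrightarrow> 0"
    using summable_LIMSEQ_zero sums_summable[OF exp_real_sums] by blast
  then have lim: "(\<lambda>p. 2 * \<bar>B\<bar> * zeta2 * (2 * pi) ^ 2 * 6 * exp 5 * ((2 * pi * exp 1) ^ p / fact p)) \<longlonglongrightarrow> 0"
    by (rule tendsto_mult_right_zero)
  have "(\<lambda>p. mid_bound B (p + 2)) \<longlonglongrightarrow> 0"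
  proof (rule Lim_null_comparison[OF _ lim], rule always_eventually, rule allI)
    fix p :: nat
    \<comment> \<open>The cubic factor is replaced by an exponential, so that the bound becomes a
      constant times x^p / p! with x = 2 pi e, a null sequence.\<close>
    have "real (p + 5) ^ 3 \<le> fact 3 * exp (real (p + 5))" by (rule power_le_fact_mult_exp) simp
    also have "exp (real (p + 5)) = exp 5 * exp 1 ^ p"
      by (simp add: exp_add exp_of_nat_mult[symmetric])
    finally have p3: "real (p + 5) ^ 3 \<le> 6 * exp 5 * exp 1 ^ p" by (simp add: fact_numeral)
    have "norm (mid_bound B (p + 2)) = 2 * \<bar>B\<bar> * zeta2 * (2 * pi) ^ (p + 2) * real (p + 5) ^ 3 / fact p"
      using zeta2_nonneg by (simp add: mid_bound_def abs_mult add.commute)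
    also have "\<dots> \<le> 2 * \<bar>B\<bar> * zeta2 * (2 * pi) ^ (p + 2) * (6 * exp 5 * exp 1 ^ p) / fact p"
      using p3 zeta2_nonneg by (intro divide_right_mono mult_left_mono) auto
    also have "\<dots> = 2 * \<bar>B\<bar> * zeta2 * (2 * pi) ^ 2 * 6 * exp 5 * ((2 * pi * exp 1) ^ p / fact p)"
      by (simp add: power_add power_mult_distrib power2_eq_square)
    finally show "norm (mid_bound B (p + 2)) \<le> \<dots>" .
  qed
  then have "(mid_bound B) \<longlonglongrightarrow> 0" by (rule LIMSEQ_offset)
  then have 2: "(\<lambda>m. 3 * mid_bound B m) \<longlonglongrightarrow> 0" by (rule tendsto_mult_right_zero)
  have "(\<lambda>M. \<Sum>n<M. (2 * pi) ^ n / fact n) \<longlonglongrightarrow> exp (2 * pi)"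
    by (rule exp_real_sums[of "2 * pi", unfolded sums_def])
  then have "(\<lambda>M. exp (2 * pi) - (\<Sum>n<M. (2 * pi) ^ n / fact n)) \<longlonglongrightarrow> exp (2 * pi) - exp (2 * pi)"
    by (intro tendsto_diff tendsto_const)
  then have "exp_tail \<longlonglongrightarrow> 0" by (simp add: exp_tail_def[abs_def])
  moreover have "(\<lambda>m. (m + 2) - 2) = (\<lambda>m::nat. m)" by simp
  ultimately have "(\<lambda>m. exp_tail ((m + 2) - 2)) \<longlonglongrightarrow> 0" by simp
  then have "(\<lambda>m. exp_tail (m - 2)) \<longlonglongrightarrow> 0" by (rule LIMSEQ_offset)
  then have 3: "(\<lambda>m. A * exp_tail (m - 2)) \<longlonglongrightarrow> 0" by (rule tendsto_mult_right_zero)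
  show ?thesis
    using tendsto_add[OF tendsto_add[OF 1 2] 3] by (simp add: total_error_def[abs_def])
qed

text \<open>The error depends on the form only through A and B, so a single threshold serves all
  forms sharing these two constants.\<close>

lemma period_poly_unimodular_eventually:
  assumes A: "A > 0"
  obtains k0 where "\<And>k f a. k \<ge> k0 \<Longrightarrow> even k \<Longrightarrow> f \<in> cusp_forms k \<Longrightarrow> cusp_expansion f a \<Longrightarrow>
    (\<And>n. Im (a n) = 0) \<Longrightarrow> a 1 = of_real A \<Longrightarrow>
    (\<And>n. norm (a n) \<le> B * (real n * sqrt n ^ k)) \<Longrightarrow> unimodular (period_poly k f)"
proof -
  have "eventually (\<lambda>m. total_error A B m < A * exp (- 2 * pi)) sequentially"
    using A by (intro order_tendstoD[OF tendsto_total_error]) simp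
  then obtain m0 where m0: "\<And>m. m \<ge> m0 \<Longrightarrow> total_error A B m < A * exp (- 2 * pi)"
    by (auto simp: eventually_sequentially)
  show ?thesis
  proof (rule that[of "2 * (m0 + 3) + 2"])
    fix k f a
    assume k: "k \<ge> 2 * (m0 + 3) + 2" "even k" and f: "f \<in> cusp_forms k" and a: "cusp_expansion f a"
      "\<And>n. Im (a n) = 0" "a 1 = of_real A" "\<And>n. norm (a n) \<le> B * (real n * sqrt n ^ k)"
    define m where "m = k div 2 - 1"
    have km: "k = 2 * m + 2" "m \<ge> m0" "m \<ge> 3" using k by (auto simp: m_def)
    have pow: "real n * sqrt n ^ k = real n ^ (m + 2)" for n
    proof -
      have "k = 2 * (m + 1)" using km(1) by simp
      then have "sqrt n ^ k = real n ^ (m + 1)" by (simp only: power_mult) simp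
      then show ?thesis by simp
    qed
    have f': "f \<in> cusp_forms (2 * m + 2)" using f unfolding km(1) .
    have bd: "norm (a n) \<le> B * real n ^ (m + 2)" for n using a(4)[of n] unfolding pow .
    interpret large_weight_form f a m A B
      by unfold_locales (fact f' a(1) a(2) a(3) A bd km(3))+
    show "unimodular (period_poly k f)"
      unfolding km(1) by (rule unimodular_period_poly[OF m0[OF km(2)]])
  qed
qed

section \<open>Combinations of normalized eigenforms\<close>

lemma even_weight:
  assumes f: "f \<in> cusp_forms k" and nz: "f \<noteq> (\<lambda>z. 0)"
  shows "even k"
proof (rule ccontr)
  assume "odd k"
  have "f z = 0" if z: "Im z > 0" for z
    using cusp_form_transform[OF f _ z, of "(-1, 0, 0, -1)"] \<open>odd k\<close> by simp
  with cusp_form_zero_offI[OF f] nz show False by blast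
qed

lemma comb_form_properties:
  assumes F: "F \<in> comb_forms k c a" and c: "\<forall>x\<in>set c. 0 \<le> x" and a: "\<forall>x\<in>set a. 0 \<le> x"
    and less: "sum_list c > sum_list a"
  obtains \<alpha> where "even k" "F \<in> cusp_forms k" "cusp_expansion F \<alpha>" "\<And>n. Im (\<alpha> n) = 0"
    "\<alpha> 1 = of_real (sum_list c - sum_list a)"
    "\<And>n. norm (\<alpha> n) \<le> (sum_list c + sum_list a) * (real n * sqrt n ^ k)"
proof -
  obtain fs gs where F: "F = (\<lambda>z. (\<Sum>l<length c. of_real (c ! l) * (fs ! l) z) - (\<Sum>j<length a. of_real (a ! j) * (gs ! j) z))"
    and len: "length fs = length c" "length gs = length a" and S: "set (fs @ gs) \<subseteq> normalized_eigenforms k"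
    using F unfolding comb_forms_def by blast
  \<comment> \<open>A disjoint sum of index sets merges both parts into one linear combination with
    signed coefficients, so the facts on sums apply once.\<close>
  define I where "I = {..<length c} <+> {..<length a}"
  define x where "x = case_sum (\<lambda>l. c ! l) (\<lambda>j. - (a ! j))"
  define g where "g = case_sum (\<lambda>l. fs ! l) (\<lambda>j. gs ! j)"
  have sumI: "sum u I = (\<Sum>l<length c. u (Inl l)) + (\<Sum>j<length a. u (Inr j))" for u :: "nat + nat \<Rightarrow> 'b::comm_monoid_add"
    by (simp add: I_def sum.Plus o_def)
  have g: "g i \<in> normalized_eigenforms k" if "i \<in> I" for i
    using that S len by (auto simp: I_def g_def)
  have Feq: "F = (\<lambda>z. \<Sum>i\<in>I. of_real (x i) * g i z)"
    by (simp add: F sumI x_def g_def sum_negf)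
  define \<alpha> where "\<alpha> = (\<lambda>n. \<Sum>i\<in>I. of_real (x i) * fcoeff (g i) n)"
  have sc: "sum_list c = (\<Sum>l<length c. c ! l)" "sum_list a = (\<Sum>j<length a. a ! j)"
    by (simp_all add: sum_list_sum_nth atLeast0LessThan)
  have sx: "(\<Sum>i\<in>I. x i) = sum_list c - sum_list a"
    by (simp add: sumI x_def sc sum_negf)
  have sax: "(\<Sum>i\<in>I. \<bar>x i\<bar>) = sum_list c + sum_list a"
    using c a by (simp add: sumI x_def sc)
  \<comment> \<open>The strict inequality makes c nonempty. The combination therefore contains an
    eigenform of weight k, and a nonzero form forces k to be even.\<close>
  have "0 \<le> sum_list a" using a by (simp add: sum_list_nonneg)
  then have "c \<noteq> []" using less by auto
  then have "Inl 0 \<in> I" by (auto simp: I_def)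
  show ?thesis
  proof (rule that[of \<alpha>])
    show "even k"
      using even_weight normalized_eigenform(1,2)[OF g[OF \<open>Inl 0 \<in> I\<close>]] by blast
    show "F \<in> cusp_forms k" unfolding Feq by (rule cusp_forms_sum) (rule normalized_eigenform(1)[OF g])
    show "cusp_expansion F \<alpha>" unfolding Feq \<alpha>_def by (rule cusp_expansion_sum) (rule normalized_eigenform(3)[OF g])
    show "Im (\<alpha> n) = 0" for n
      unfolding \<alpha>_def Im_sum by (rule sum.neutral) (simp add: normalized_eigenform(6)[OF g])
    have "\<alpha> 1 = (\<Sum>i\<in>I. of_real (x i))"
      unfolding \<alpha>_def by (intro sum.cong refl) (simp add: normalized_eigenform(4)[OF g, simplified])
    then show "\<alpha> 1 = of_real (sum_list c - sum_list a)" by (simp only: of_real_sum[symmetric] sx)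
    show "norm (\<alpha> n) \<le> (sum_list c + sum_list a) * (real n * sqrt n ^ k)" for n
    proof -
      have "norm (\<alpha> n) \<le> (\<Sum>i\<in>I. \<bar>x i\<bar> * (real n * sqrt n ^ k))"
        unfolding \<alpha>_def
        by (intro sum_norm_le) (simp only: norm_mult norm_of_real, intro mult_left_mono normalized_eigenform(7) g, auto)
      then show ?thesis by (simp only: sum_distrib_right[symmetric] sax)
    qed
  qed
qed

theorem theorem1p6:
  fixes c a :: "real list"
  assumes "\<forall>x\<in>set c. 0 \<le> x" and "\<forall>x\<in>set a. 0 \<le> x"
    and "sum_list c > sum_list a"
  shows "(\<exists>k0. \<forall>k\<ge>k0. \<forall>f\<in>comb_forms k c a. unimodular (period_poly k f)) \<and>
    finite {f \<in> all_comb_forms c a. \<exists>k. f \<in> comb_forms k c a \<and> \<not> unimodular (period_poly k f)}"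
proof -
  have "sum_list c - sum_list a > 0" using assms(3) by simp
  from period_poly_unimodular_eventually[OF this, of "sum_list c + sum_list a"]
  obtain k0 where k0: "\<And>k f \<alpha>. k \<ge> k0 \<Longrightarrow> even k \<Longrightarrow> f \<in> cusp_forms k \<Longrightarrow> cusp_expansion f \<alpha> \<Longrightarrow>
    (\<And>n. Im (\<alpha> n) = 0) \<Longrightarrow> \<alpha> 1 = of_real (sum_list c - sum_list a) \<Longrightarrow>
    (\<And>n. norm (\<alpha> n) \<le> (sum_list c + sum_list a) * (real n * sqrt n ^ k)) \<Longrightarrow> unimodular (period_poly k f)"
    by blast
  have main: "unimodular (period_poly k f)" if k: "k \<ge> k0" and f: "f \<in> comb_forms k c a" for k f
  proof -
    obtain \<alpha> where "even k" "f \<in> cusp_forms k" "cusp_expansion f \<alpha>" "\<And>n. Im (\<alpha> n) = 0"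
      "\<alpha> 1 = of_real (sum_list c - sum_list a)"
      "\<And>n. norm (\<alpha> n) \<le> (sum_list c + sum_list a) * (real n * sqrt n ^ k)"
      using comb_form_properties[OF f assms] by blast
    then show ?thesis by (intro k0[OF k])
  qed
  have "{f \<in> all_comb_forms c a. \<exists>k. f \<in> comb_forms k c a \<and> \<not> unimodular (period_poly k f)} \<subseteq>
      (\<Union>k<k0. comb_forms k c a)"
  proof
    fix f assume "f \<in> {f \<in> all_comb_forms c a. \<exists>k. f \<in> comb_forms k c a \<and> \<not> unimodular (period_poly k f)}"
    then obtain k where k: "f \<in> comb_forms k c a" "\<not> unimodular (period_poly k f)" by blast
    then have "k < k0" using main[OF _ k(1)] by (meson not_le)
    then show "f \<in> (\<Union>k<k0. comb_forms k c a)" using k(1) by blast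
  qed
  moreover have "finite (\<Union>k<k0. comb_forms k c a)" by (intro finite_UN_I finite_comb_forms) simp
  ultimately show ?thesis using main finite_subset by blast
qed

end
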